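(* Let $p$ be an odd prime. The ring $\hat{\mathcal{E}}$ is the free graded commutative $\mathbb{F}_p$-algebra on generators $E^\epsilon_n$ ($\epsilon\in\{0,1\}$, $n\ge\epsilon$) modulo all relations implied (by comparing coefficients) by the power series identities $$\tilde{E}^0(s)\circ\tilde{E}^0(t)=\tilde{E}^0(s)\circ\tilde{E}^0(s+t),$$ $$\tilde{E}^0(s)\circ\tilde{E}^1(t)=\tilde{E}^0(s)\circ\tilde{E}^1(s+t),$$ $$\tilde{E}^1(s)\circ\tilde{E}^0(t)=\tilde{E}^1(s)\circ\tilde{E}^0(s+t)+\tilde{E}^0(s)\circ\tilde{E}^1(s+t),$$ $$\tilde{E}^1(s)\circ\tilde{E}^1(t)=\tilde{E}^1(s)\circ\tilde{E}^1(s+t).$$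
   Context: $H_*$ denotes homology with $\mathbb{F}_p$-coefficients. Let $\pi$ be the cyclic group of order $p$ with chosen generator $t$, and let $V_n=\pi^n$, an $\mathbb{F}_p$-vector space of rank $n$ acted on by $GL_n(\mathbb{F}_p)$. $\hat{\mathcal{E}}=\bigoplus_{n\ge0}H_*(V_n)_{GL_n(\mathbb{F}_p)}$ (coinvariants), with ring structure, denoted $\circ$, induced by the tensor algebra structure on $TH_*(\pi)=\bigoplus_{n\ge0}H_*(\pi)^{\otimes n}=\bigoplus_{n\ge0}H_*(V_n)$. Graded commutativity is with respect to homological degree. Let $e_n\in H_n(\pi)$ be the class of the generator in degree $n$ of the standard resolution of $\mathbb{F}_p$ by free modules $\mathbb{F}_p[\pi]e_n$ with $d(e_{2i+1})=(t-1)e_{2i}$, $d(e_{2i+2})=(1+t+\dots+t^{p-1})e_{2i+1}$. In $\hat{\mathcal{E}}$, $E^0_n$ ($n\ge0$) is the image of $e_{2(p-1)n}$ and $E^1_n$ ($n\ge1$) is the image of $e_{2(p-1)n-1}$ in $H_*(V_1)_{GL_1(\mathbb{F}_p)}$, so $\deg E^\epsilon_n=2n(p-1)-\epsilon$. Set $E^\epsilon(s)=\sum_{n\ge\epsilon}E^\epsilon_ns^n$, $\tilde{E}^0(s)=E^0(s^{p-1})$ and $\tilde{E}^1(s)=s^{-1}E^1(s^{p-1})$. *)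

theory Defs
  imports
    "HOL-Library.Poly_Mapping"
    "HOL-Computational_Algebra.Formal_Power_Series"
    "HOL-Algebra.QuotRing"
    "HOL-Algebra.Generated_Groups"
    "Jordan_Normal_Form.Matrix"
    "Berlekamp_Zassenhaus.Finite_Field"
begin

section \<open>Free associative algebras\<close>

text \<open>
  Lists form the free monoid under concatenation, so that \<open>'x list \<Rightarrow>\<^sub>0 'k\<close>, with the convolution
  product of \<open>Poly_Mapping\<close>, is the free associative algebra (tensor algebra) over \<open>'k\<close> on \<open>'x\<close>.
\<close>

instantiation list :: (type) monoid_add
begin

definition zero_list :: "'a list" where "zero_list = []"

definition plus_list :: "'a list \<Rightarrow> 'a list \<Rightarrow> 'a list" where "plus_list = append"

instance
  by standard (simp_all add: zero_list_def plus_list_def)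

end

abbreviation word :: "'x list \<Rightarrow> ('x list \<Rightarrow>\<^sub>0 'k::zero_neq_one)" where
  "word w \<equiv> Poly_Mapping.single w 1"

text \<open>The linear extension of a map defined on basis elements. The factor
  \<open>Poly_Mapping.single 0 c\<close>, with \<open>0\<close> the empty word, is the scalar \<open>c\<close>.\<close>

definition lin :: "('a \<Rightarrow> ('b list \<Rightarrow>\<^sub>0 'k::ring_1)) \<Rightarrow> ('a \<Rightarrow>\<^sub>0 'k) \<Rightarrow> ('b list \<Rightarrow>\<^sub>0 'k)" where
  "lin f x = (\<Sum>w\<in>Poly_Mapping.keys x. Poly_Mapping.single 0 (Poly_Mapping.lookup x w) * f w)"

section \<open>Homology of elementary abelian groups\<close>

text \<open>
  The prime is \<open>CARD('p)\<close> with \<open>'p :: prime_card\<close>, and the field is \<open>'p mod_ring\<close>, i.e. the integers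
  modulo \<open>CARD('p)\<close>. The cyclic group \<open>\<pi>\<close> is the additive group of \<open>'p mod_ring\<close>, with generator
  \<open>t = 1\<close>, and \<open>V_n = \<pi>^n\<close> is \<open>carrier_vec n\<close>.

  The standard resolution \<open>P\<close> of \<open>\<pi>\<close> has the vector space basis \<open>t^a e_i\<close>, encoded as \<open>(a, i)\<close>. The
  \<open>n\<close>-fold tensor power of \<open>P\<close> is a free resolution for \<open>V_n\<close>; its vector space basis consists of
  the words of length \<open>n\<close> in the letters \<open>(a, i)\<close>. All tensor powers together form the type
  \<open>'p resol\<close>. Applying trivial coefficients forgets the group parts \<open>a\<close>: in \<open>'p chains\<close> the word
  \<open>[i_1, \<dots>, i_n]\<close> stands for \<open>e_{i_1} \<otimes> \<dots> \<otimes> e_{i_n}\<close>.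
\<close>

type_synonym 'p resol = "('p mod_ring \<times> nat) list \<Rightarrow>\<^sub>0 'p mod_ring"
type_synonym 'p chains = "nat list \<Rightarrow>\<^sub>0 'p mod_ring"

fun bd_letter :: "'p::prime_card mod_ring \<times> nat \<Rightarrow> 'p resol" where
  "bd_letter (a, 0) = 0"
| "bd_letter (a, Suc i) =
     (if even i then word [(a + 1, i)] - word [(a, i)]
      else (\<Sum>j<CARD('p). word [(a + of_nat j, i)]))"

fun bd_word :: "('p::prime_card mod_ring \<times> nat) list \<Rightarrow> 'p resol" where
  "bd_word [] = 0"
| "bd_word (x # w) = bd_letter x * word w + (- 1) ^ snd x * word [x] * bd_word w"

definition bd :: "'p::prime_card resol \<Rightarrow> 'p resol" where
  "bd = lin bd_word"

definition word_degree :: "('p mod_ring \<times> nat) list \<Rightarrow> nat" where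
  "word_degree w = sum_list (map snd w)"

definition resolution :: "nat \<Rightarrow> 'p::prime_card resol set" where
  "resolution n = {x. \<forall>w\<in>Poly_Mapping.keys x. length w = n}"

definition resolution_degree :: "nat \<Rightarrow> nat \<Rightarrow> 'p::prime_card resol set" where
  "resolution_degree n k =
     {x \<in> resolution n. \<forall>w\<in>Poly_Mapping.keys x. word_degree w = k}"

definition augmentation :: "'p::prime_card resol \<Rightarrow> 'p mod_ring" where
  "augmentation x =
     (\<Sum>w\<in>Poly_Mapping.keys x. if word_degree w = 0 then Poly_Mapping.lookup x w else 0)"

definition translate :: "'p::prime_card mod_ring vec \<Rightarrow> 'p resol \<Rightarrow> 'p resol" where
  "translate v = lin (\<lambda>w. word (map2 (\<lambda>g (a, i). (g + a, i)) (list_of_vec v) w))"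

definition trivialize :: "'p::prime_card resol \<Rightarrow> 'p chains" where
  "trivialize = lin (\<lambda>w. word (map snd w))"

text \<open>The differential induced on trivial coefficients, \<open>1 \<otimes> e_\<alpha> \<mapsto> 1 \<otimes> d e_\<alpha>\<close>.\<close>

definition bd_triv :: "'p::prime_card chains \<Rightarrow> 'p chains" where
  "bd_triv = lin (\<lambda>\<alpha>. trivialize (bd_word (map (Pair 0) \<alpha>)))"

definition cycles :: "'p::prime_card chains ring" where
  "cycles = \<lparr>carrier = {z. bd_triv z = 0}, mult = (*), one = 1, zero = 0, add = (+)\<rparr>"

text \<open>The ring \<open>TH_*(\<pi>) = \<Oplus>_n H_*(V_n)\<close>, cycles modulo boundaries; its product is the exterior
  product of homology classes, i.e. the product of the tensor algebra.\<close>

definition TH :: "'p::prime_card chains set ring" where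
  "TH = cycles Quot (range bd_triv)"

definition hclass :: "'p::prime_card chains \<Rightarrow> 'p chains set" where
  "hclass z = range bd_triv +>\<^bsub>cycles\<^esub> z"

definition homology :: "nat \<Rightarrow> 'p::prime_card chains set set" where
  "homology n =
     hclass ` {z \<in> carrier cycles. \<forall>\<alpha>\<in>Poly_Mapping.keys z. length \<alpha> = n}"

section \<open>The action of the general linear groups\<close>

definition GL :: "nat \<Rightarrow> 'p::prime_card mod_ring mat set" where
  "GL n = {A \<in> carrier_mat n n. invertible_mat A}"

text \<open>
  Augmentation preserving chain maps from the resolution for \<open>V_n\<close> to itself which are equivariant
  along \<open>A : V_n \<rightarrow> V_n\<close>. Additive maps are automatically linear, the field being prime. The map
  that \<open>A\<close> induces on homology is by definition induced by any such chain map.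
\<close>

definition lifts :: "nat \<Rightarrow> 'p::prime_card mod_ring mat \<Rightarrow> ('p resol \<Rightarrow> 'p resol) \<Rightarrow> bool" where
  "lifts n A \<phi> \<longleftrightarrow>
     (\<forall>x\<in>resolution n. \<forall>y\<in>resolution n. \<phi> (x + y) = \<phi> x + \<phi> y) \<and>
     (\<forall>k. \<forall>x\<in>resolution_degree n k. \<phi> x \<in> resolution_degree n k) \<and>
     (\<forall>x\<in>resolution n. \<phi> (bd x) = bd (\<phi> x)) \<and>
     (\<forall>x\<in>resolution n. augmentation (\<phi> x) = augmentation x) \<and>
     (\<forall>v\<in>carrier_vec n. \<forall>x\<in>resolution n. \<phi> (translate v x) = translate (A *\<^sub>v v) (\<phi> x))"

definition gl_act ::
  "nat \<Rightarrow> 'p::prime_card mod_ring mat \<Rightarrow> 'p chains set \<Rightarrow> 'p chains set" where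
  "gl_act n A c = (THE c'. \<exists>\<phi> x. lifts n A \<phi> \<and> x \<in> resolution n \<and>
     trivialize x \<in> carrier cycles \<and>
     c = hclass (trivialize x) \<and> c' = hclass (trivialize (\<phi> x)))"

text \<open>The additive span of all \<open>A c - c\<close>; dividing \<open>TH\<close> by it gives the direct sum over \<open>n\<close> of the
  coinvariants of \<open>GL n\<close> on \<open>homology n\<close>.\<close>

definition coinv_relations :: "'p::prime_card chains set set" where
  "coinv_relations =
     generate (add_monoid TH) {gl_act n A c \<ominus>\<^bsub>TH\<^esub> c | n A c. A \<in> GL n \<and> c \<in> homology n}"

definition Ehat :: "'p::prime_card chains set set ring" where
  "Ehat = TH Quot coinv_relations"

definition E_class :: "nat \<Rightarrow> nat \<Rightarrow> 'p::prime_card chains set set" where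
  "E_class \<epsilon> n = coinv_relations +>\<^bsub>TH\<^esub> hclass (word [2 * (CARD('p) - 1) * n - \<epsilon>])"

section \<open>Free graded commutative algebras\<close>

definition free_alg :: "'x set \<Rightarrow> ('x list \<Rightarrow>\<^sub>0 'k::field) ring" where
  "free_alg X = \<lparr>carrier = {f. \<forall>w\<in>Poly_Mapping.keys f. set w \<subseteq> X},
     mult = (*), one = 1, zero = 0, add = (+)\<rparr>"

definition homogeneous :: "('x \<Rightarrow> nat) \<Rightarrow> nat \<Rightarrow> ('x list \<Rightarrow>\<^sub>0 'k::field) \<Rightarrow> bool" where
  "homogeneous dg k f \<longleftrightarrow> (\<forall>w\<in>Poly_Mapping.keys f. sum_list (map dg w) = k)"

text \<open>In odd characteristic the relations \<open>a b = (-1)^(k l) b a\<close> include \<open>a\<^sup>2 = 0\<close> for \<open>a\<close> of odd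
  degree.\<close>

definition gc_ideal :: "'x set \<Rightarrow> ('x \<Rightarrow> nat) \<Rightarrow> ('x list \<Rightarrow>\<^sub>0 'k::field) set" where
  "gc_ideal X dg = Idl\<^bsub>free_alg X\<^esub> {a * b - (- 1) ^ (k * l) * b * a | a b k l.
     a \<in> carrier (free_alg X) \<and> b \<in> carrier (free_alg X) \<and>
     homogeneous dg k a \<and> homogeneous dg l b}"

definition free_gc_alg :: "'x set \<Rightarrow> ('x \<Rightarrow> nat) \<Rightarrow> ('x list \<Rightarrow>\<^sub>0 'k::field) set ring" where
  "free_gc_alg X dg = free_alg X Quot gc_ideal X dg"

section \<open>The presented algebra\<close>

text \<open>The generator \<open>E^\<epsilon>_n\<close> is the letter \<open>(\<epsilon>, n)\<close>.\<close>

type_synonym 'p E_free = "(nat \<times> nat) list \<Rightarrow>\<^sub>0 'p mod_ring"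

definition E_gens :: "(nat \<times> nat) set" where
  "E_gens = {(\<epsilon>, n). \<epsilon> \<in> {0, 1} \<and> n \<ge> \<epsilon>}"

definition E_degree :: "nat \<Rightarrow> nat \<times> nat \<Rightarrow> nat" where
  "E_degree p = (\<lambda>(\<epsilon>, n). 2 * n * (p - 1) - \<epsilon>)"

definition E_series :: "nat \<Rightarrow> 'p::prime_card E_free fps" where
  "E_series \<epsilon> = Abs_fps (\<lambda>n. if n \<ge> \<epsilon> then word [(\<epsilon>, n)] else 0)"

text \<open>\<open>fps_shift 1\<close> is division by the variable; the series it is applied to has no constant term.\<close>

definition E0_tilde :: "'p::prime_card E_free fps" where
  "E0_tilde = fps_compose (E_series 0) (fps_X ^ (CARD('p) - 1))"

definition E1_tilde :: "'p::prime_card E_free fps" where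
  "E1_tilde = fps_shift 1 (fps_compose (E_series 1) (fps_X ^ (CARD('p) - 1)))"

text \<open>
  Power series in \<open>s\<close> and \<open>t\<close> are series in \<open>t\<close> whose coefficients are series in \<open>s\<close>. For a series
  \<open>f\<close> in one variable, the following are \<open>f(s)\<close>, \<open>f(t)\<close> and \<open>f(s + t)\<close>; the last is given by the
  binomial expansion of \<open>(s + t)^(i + j)\<close>.
\<close>

definition at_s :: "'a::ring_1 fps \<Rightarrow> 'a fps fps" where
  "at_s f = fps_const f"

definition at_t :: "'a::ring_1 fps \<Rightarrow> 'a fps fps" where
  "at_t f = Abs_fps (\<lambda>j. fps_const (fps_nth f j))"

definition at_s_plus_t :: "'a::ring_1 fps \<Rightarrow> 'a fps fps" where
  "at_s_plus_t f =
     Abs_fps (\<lambda>j. Abs_fps (\<lambda>i. of_nat ((i + j) choose i) * fps_nth f (i + j)))"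

definition E_identities :: "('p::prime_card E_free fps fps \<times> 'p E_free fps fps) set" where
  "E_identities =
     {(at_s E0_tilde * at_t E0_tilde, at_s E0_tilde * at_s_plus_t E0_tilde),
      (at_s E0_tilde * at_t E1_tilde, at_s E0_tilde * at_s_plus_t E1_tilde),
      (at_s E1_tilde * at_t E0_tilde,
         at_s E1_tilde * at_s_plus_t E0_tilde + at_s E0_tilde * at_s_plus_t E1_tilde),
      (at_s E1_tilde * at_t E1_tilde, at_s E1_tilde * at_s_plus_t E1_tilde)}"

definition E_gc_alg :: "'p::prime_card E_free set ring" where
  "E_gc_alg = free_gc_alg E_gens (E_degree CARD('p))"

definition E_gc_class :: "'p::prime_card E_free \<Rightarrow> 'p E_free set" where
  "E_gc_class f = gc_ideal E_gens (E_degree CARD('p)) +>\<^bsub>free_alg E_gens\<^esub> f"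

definition E_ideal :: "'p::prime_card E_free set set" where
  "E_ideal = Idl\<^bsub>E_gc_alg\<^esub>
     {E_gc_class (fps_nth (fps_nth (l - r) j) i) | l r i j. (l, r) \<in> E_identities}"

definition E_presented :: "'p::prime_card E_free set set ring" where
  "E_presented = E_gc_alg Quot E_ideal"

definition E_gen :: "nat \<Rightarrow> nat \<Rightarrow> 'p::prime_card E_free set set" where
  "E_gen \<epsilon> n = E_ideal +>\<^bsub>E_gc_alg\<^esub> E_gc_class (word [(\<epsilon>, n)])"

end

theory Submission
  imports Defs "Jordan_Normal_Form.Gauss_Jordan_Elimination"
begin

text \<open>
  With trivial coefficients all differentials vanish, so \<open>TH_*(\<pi>)\<close> is the tensor algebra on the
  classes \<open>e_k\<close>. The group \<open>GL_n\<close> is generated by dilations of one coordinate, interchanges of adjacent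
  coordinates and adjacent shears \<open>(a, b) \<mapsto> (a, a + b)\<close>, and block sums of matrices act through tensor
  products. The relations of the coinvariants therefore form the two-sided ideal generated by those of
  these three matrices in \<open>H_*(V_1)\<close> and \<open>H_*(V_2)\<close>. Dilations kill all \<open>e_k\<close> except the \<open>E^\<epsilon>_n\<close>,
  interchanges give graded commutativity, and shears give the power series identities. An action is
  computed on any chain lift, as two lifts are chain homotopic; each of the three matrices has an
  explicit one.
\<close>

section \<open>Linear maps on free algebras\<close>

text \<open>The form of the identities comes from the generating series X(s) = sum of e_{2i} s^i and
  Y(s) = sum of e_{2i+1} s^i. The classes of degree 2i behave like divided powers, so a shear acts
  through the binomial expansion of (s + t)^m: it sends X(s) X(t) to X(s) X(s + t), and similarly
  for Y. Once dilations have killed most classes, X and Y become the tilde series; this is the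
  origin of the substitution s^(p-1) and of the factor s^(-1). The obstacle is a chain lift of the
  shear. Its group map t \<mapsto> t u turns the norm of t into the norm of t u, whereas the natural
  candidate for the lift has the norms of t and of u in its boundary. The defect is the boundary of
  a sum of p (p - 1) / 2 cells, which vanishes with trivial coefficients because p is odd. For the
  isomorphism, both rings are quotients of the free algebra on the E^\<epsilon>_n. Their kernels are
  compared by two algebra maps, \<open>from_generators\<close> and \<open>to_generators\<close>,
  between this free algebra and the tensor algebra on the e_k; they are inverse to each other up to
  relations.\<close>

lemma zero_list_Nil [simp]: "(0 :: 'x list) = []"
  by (simp add: zero_list_def)

lemma plus_list_append [simp]: "(u :: 'x list) + v = u @ v"
  by (simp add: plus_list_def)

lemma word_append: "word (u @ v) = word u * (word v :: 'x list \<Rightarrow>\<^sub>0 'k::comm_ring_1)"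
  by (simp add: mult_single)

lemma word_Cons: "word (x # w) = word [x] * (word w :: 'x list \<Rightarrow>\<^sub>0 'k::comm_ring_1)"
  by (simp add: mult_single)

lemma word_Nil [simp]: "word [] = (1 :: 'x list \<Rightarrow>\<^sub>0 'k::comm_ring_1)"
  using single_one by (metis zero_list_Nil)

abbreviation scalar :: "'k \<Rightarrow> ('x list \<Rightarrow>\<^sub>0 'k::zero)" where
  "scalar \<equiv> Poly_Mapping.single []"

lemma scalar_word: "scalar c * word w = Poly_Mapping.single w (c :: 'k::comm_ring_1)"
  by (simp add: mult_single)

lemma poly_mapping_decomposition:
  "x = (\<Sum>w\<in>Poly_Mapping.keys x. Poly_Mapping.single w (Poly_Mapping.lookup x w))"
  by (rule poly_mapping_eqI)
    (auto simp: lookup_sum lookup_single when_def in_keys_iff sum.delta')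

lemma free_algebra_induct [case_names single zero add]:
  fixes x :: "'x \<Rightarrow>\<^sub>0 'k::comm_monoid_add"
  assumes "\<And>w c. w \<in> Poly_Mapping.keys x \<Longrightarrow> P (Poly_Mapping.single w c)"
    and "P 0" and "\<And>y z. P y \<Longrightarrow> P z \<Longrightarrow> P (y + z)"
  shows "P x"
proof -
  have "P (\<Sum>w\<in>A. Poly_Mapping.single w (Poly_Mapping.lookup x w))"
    if "finite A" "A \<subseteq> Poly_Mapping.keys x" for A
    using that by (induction A rule: finite_induct) (auto intro: assms)
  then show ?thesis
    using poly_mapping_decomposition[of x] by (metis finite_keys order_refl)
qed

lemma scalar_commute:
  "scalar c * x = x * (scalar c :: 'x list \<Rightarrow>\<^sub>0 'k::comm_ring_1)"
  by (induction x rule: free_algebra_induct)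
    (simp_all add: mult_single mult.commute algebra_simps)

lemma scalar_left_commute:
  "x * (scalar c * y) = scalar c * (x * y)"
  for x y :: "'x list \<Rightarrow>\<^sub>0 'k::comm_ring_1"
  by (metis mult.assoc scalar_commute)

lemma scalar_mult: "scalar c * (scalar d * x) =
    scalar (c * d) * (x :: 'x list \<Rightarrow>\<^sub>0 'k::comm_ring_1)"
  by (simp add: mult.assoc[symmetric] mult_single)

lemma scalar_of_nat: "scalar (of_nat m) = (of_nat m :: 'x list \<Rightarrow>\<^sub>0 'k::comm_ring_1)"
  using single_of_nat by (metis zero_list_Nil)

lemma scalar_minus_one_power:
  "(- 1) ^ k = (scalar ((- 1) ^ k) :: 'x list \<Rightarrow>\<^sub>0 'k::comm_ring_1)"
  by (cases "even k") (auto simp: single_uminus)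

lemma sign_left_commute: "x * ((- 1) ^ k * y) = (- 1) ^ k * (x * y)" for x :: "'a::ring_1"
  by (cases "even k") auto

lemma lin_superset:
  assumes "finite A" "Poly_Mapping.keys x \<subseteq> A"
  shows "lin f x = (\<Sum>w\<in>A. scalar (Poly_Mapping.lookup x w) * f w)"
  unfolding lin_def zero_list_Nil using assms
  by (intro sum.mono_neutral_left) (auto simp: in_keys_iff)

lemma lin_add [simp]: "lin f (x + y) = lin f x + lin f y"
proof -
  let ?A = "Poly_Mapping.keys x \<union> Poly_Mapping.keys y"
  have "lin f z = (\<Sum>w\<in>?A. scalar (Poly_Mapping.lookup z w) * f w)"
    if "Poly_Mapping.keys z \<subseteq> ?A" for z
    using that by (intro lin_superset) auto
  then show ?thesis
    using Poly_Mapping.keys_add[of x y]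
    by (simp add: lookup_add single_add distrib_right sum.distrib)
qed

lemma additive_lin: "Modules.additive (lin f)"
  by standard simp

lemmas lin_zero [simp] = additive.zero[OF additive_lin]
  and lin_uminus [simp] = additive.minus[OF additive_lin]
  and lin_diff [simp] = additive.diff[OF additive_lin]
  and lin_sum = additive.sum[OF additive_lin]

lemma lin_single: "lin f (Poly_Mapping.single w c) = scalar c * f w"
  by (auto simp: lin_def)

lemma lin_word [simp]: "lin f (word w) = (f w :: 'x list \<Rightarrow>\<^sub>0 'k::comm_ring_1)"
  by (simp add: lin_single)

lemma lin_one [simp]: "lin f (1 :: 'y list \<Rightarrow>\<^sub>0 'k) = (f [] :: 'x list \<Rightarrow>\<^sub>0 'k::comm_ring_1)"
  using lin_word[of f "[]"] by simp

lemma lin_scalar [simp]: "lin f (scalar c * x) =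
    scalar c * (lin f x :: 'x list \<Rightarrow>\<^sub>0 'k::comm_ring_1)"
  by (induction x rule: free_algebra_induct)
    (simp_all add: mult_single lin_single distrib_left scalar_mult)

lemma lin_sign [simp]: "lin f ((- 1) ^ k * (x :: 'y list \<Rightarrow>\<^sub>0 'k)) = (- 1) ^ k * (lin f x :: 'x list \<Rightarrow>\<^sub>0 'k::comm_ring_1)"
  by (simp add: scalar_minus_one_power)

lemma lin_of_nat [simp]: "lin f (of_nat m * (x :: 'y list \<Rightarrow>\<^sub>0 'k)) = of_nat m * (lin f x :: 'x list \<Rightarrow>\<^sub>0 'k::comm_ring_1)"
  unfolding scalar_of_nat[symmetric] by (rule lin_scalar)

lemma lin_cong: "(\<And>w. w \<in> Poly_Mapping.keys x \<Longrightarrow> f w = g w) \<Longrightarrow> lin f x = lin g x"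
  by (simp add: lin_def)

lemma lin_zero_fun [simp]: "lin (\<lambda>_. 0) x = 0"
  by (simp add: lin_def)

lemma lin_lin: "lin f (lin g x) = (lin (\<lambda>w. lin f (g w)) x :: 'x list \<Rightarrow>\<^sub>0 'k::comm_ring_1)"
  by (induction x rule: free_algebra_induct) (simp_all add: lin_single)

lemma lin_words [simp]: "lin word x = (x :: 'x list \<Rightarrow>\<^sub>0 'k::comm_ring_1)"
  by (induction x rule: free_algebra_induct) (simp_all add: lin_single scalar_word)

lemma lin_mult_right: "lin (\<lambda>w. f w * y) x = lin f x * (y :: 'x list \<Rightarrow>\<^sub>0 'k::comm_ring_1)"
  by (simp add: lin_def sum_distrib_right mult.assoc)

lemma lin_mult_left: "lin (\<lambda>w. y * f w) x = y * (lin f x :: 'x list \<Rightarrow>\<^sub>0 'k::comm_ring_1)"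
  by (simp add: lin_def sum_distrib_left scalar_left_commute)

lemma lin_fun_add: "lin (\<lambda>w. f w + g w) x = lin f x + lin g x"
  by (simp add: lin_def sum.distrib distrib_left)

lemma lin_fun_diff: "lin (\<lambda>w. f w - g w) x = lin f x - lin g x"
  by (simp add: lin_def sum_subtractf right_diff_distrib)

text \<open>The factors may be treated by different maps \<open>g\<close> and \<open>h\<close>, and
  the factorization is demanded only on words that occur. This covers maps that act on the first
  letters of a word and fix the others, where the lengths decide which letters belong to which
  factor.\<close>

lemma lin_times:
  fixes f :: "'y list \<Rightarrow> ('x list \<Rightarrow>\<^sub>0 'k::comm_ring_1)"
  assumes "\<And>u v. u \<in> Poly_Mapping.keys x \<Longrightarrow> v \<in> Poly_Mapping.keys y \<Longrightarrow> f (u @ v) = g u * h v"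
  shows "lin f (x * y) = lin g x * lin h y"
proof -
  have *: "lin f (word u * y) = g u * lin h y" if u: "u \<in> Poly_Mapping.keys x" for u
  proof -
    have "word u * y = lin (\<lambda>v. word (u @ v)) y"
      by (simp add: word_append lin_mult_left)
    then have "lin f (word u * y) = lin (\<lambda>v. f (u @ v)) y"
      by (simp add: lin_lin)
    also have "\<dots> = lin (\<lambda>v. g u * h v) y"
      using assms u by (intro lin_cong) auto
    finally show ?thesis
      by (simp add: lin_mult_left)
  qed
  have "lin f (x * y) = lin f (lin (\<lambda>u. word u * y) x)"
    by (simp add: lin_mult_right)
  also have "\<dots> = lin (\<lambda>u. g u * lin h y) x"
    unfolding lin_lin by (intro lin_cong) (simp add: *)
  finally show ?thesis
    by (simp add: lin_mult_right)
qed

lemma lin_word_map: "lin (\<lambda>w. word (map h w)) (x * y) =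
    lin (\<lambda>w. word (map h w)) x * (lin (\<lambda>w. word (map h w)) y :: 'x list \<Rightarrow>\<^sub>0 'k::comm_ring_1)"
  by (intro lin_times) (simp add: word_append)

text \<open>Fixed length, fixed degree and letters from a given set are all conditions of this form,
  so that closure under the algebra operations and under \<open>lin\<close> is proved once.\<close>

definition supp :: "('x \<Rightarrow> bool) \<Rightarrow> ('x \<Rightarrow>\<^sub>0 'k::zero) set" where
  "supp P = {x. \<forall>w\<in>Poly_Mapping.keys x. P w}"

lemma supp_zero [simp]: "0 \<in> supp P"
  by (simp add: supp_def)

lemma supp_add: "x \<in> supp P \<Longrightarrow> y \<in> supp P \<Longrightarrow> x + y \<in> supp P"
  unfolding supp_def using Poly_Mapping.keys_add[of x y] by blast

lemma supp_uminus: "x \<in> supp P \<Longrightarrow> - x \<in> supp (P :: 'x \<Rightarrow> bool)" for x :: "'x \<Rightarrow>\<^sub>0 'k::ab_group_add"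
  by (auto simp: supp_def in_keys_iff)

lemma supp_diff: "x \<in> supp P \<Longrightarrow> y \<in> supp P \<Longrightarrow> x - y \<in> supp P"
  for x y :: "'x \<Rightarrow>\<^sub>0 'k::ab_group_add"
  using supp_add[of x P "- y"] supp_uminus[of y P] by simp

lemma supp_sum: "(\<And>i. i \<in> A \<Longrightarrow> f i \<in> supp P) \<Longrightarrow> sum f A \<in> supp P"
  by (induction A rule: infinite_finite_induct) (auto intro: supp_add)

lemma supp_single: "P w \<Longrightarrow> Poly_Mapping.single w c \<in> supp P"
  by (auto simp: supp_def)

lemma supp_mono: "x \<in> supp P \<Longrightarrow> (\<And>w. w \<in> Poly_Mapping.keys x \<Longrightarrow> P w \<Longrightarrow> Q w) \<Longrightarrow> x \<in> supp Q"
  by (auto simp: supp_def)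

lemma supp_conjD: "x \<in> supp (\<lambda>w. P w \<and> Q w) \<Longrightarrow> x \<in> supp P"
  by (auto simp: supp_def)

lemma supp_induct [consumes 1, case_names single zero add]:
  fixes x :: "'x \<Rightarrow>\<^sub>0 'k::comm_monoid_add"
  assumes "x \<in> supp P" "\<And>w c. P w \<Longrightarrow> R (Poly_Mapping.single w c)"
    and "R 0" and "\<And>y z. y \<in> supp P \<Longrightarrow> z \<in> supp P \<Longrightarrow> R y \<Longrightarrow> R z \<Longrightarrow> R (y + z)"
  shows "R x"
proof -
  have P: "P w" if "w \<in> Poly_Mapping.keys x" for w
    using assms(1) that by (simp add: supp_def)
  have "x \<in> supp P \<and> R x"
    by (induction x rule: free_algebra_induct)
      (use P in \<open>auto intro: assms(2-4) supp_add supp_single\<close>)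
  then show ?thesis by simp
qed

lemma supp_times:
  fixes x y :: "'x list \<Rightarrow>\<^sub>0 'k::comm_ring_1"
  assumes "x \<in> supp P" "y \<in> supp Q" "\<And>u v. P u \<Longrightarrow> Q v \<Longrightarrow> R (u @ v)"
  shows "x * y \<in> supp R"
  using assms Poly_Mapping.keys_mult[of x y] by (fastforce simp: supp_def)

lemma supp_scalar: "x \<in> supp P \<Longrightarrow> scalar c * x \<in> supp P"
  for x :: "'x list \<Rightarrow>\<^sub>0 'k::comm_ring_1"
  using supp_times[of "scalar c" "\<lambda>u. u = []" x P P] by (simp add: supp_single)

lemma supp_sign: "x \<in> supp P \<Longrightarrow> (- 1) ^ k * x \<in> supp P"
  for x :: "'x list \<Rightarrow>\<^sub>0 'k::comm_ring_1"
  by (simp add: scalar_minus_one_power supp_scalar)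

lemma supp_of_nat: "x \<in> supp P \<Longrightarrow> of_nat m * x \<in> supp P"
  for x :: "'x list \<Rightarrow>\<^sub>0 'k::comm_ring_1"
  unfolding scalar_of_nat[symmetric] by (rule supp_scalar)

lemma supp_lin:
  fixes f :: "'y list \<Rightarrow> ('x list \<Rightarrow>\<^sub>0 'k::comm_ring_1)"
  assumes "x \<in> supp P" "\<And>w. P w \<Longrightarrow> f w \<in> supp Q"
  shows "lin f x \<in> supp Q"
  using assms unfolding lin_def zero_list_Nil by (intro supp_sum supp_scalar) (auto simp: supp_def)

lemma lin_cong_supp: "x \<in> supp P \<Longrightarrow> (\<And>w. P w \<Longrightarrow> f w = g w) \<Longrightarrow> lin f x = lin g x"
  by (intro lin_cong) (auto simp: supp_def)

section \<open>The resolution\<close>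

lemma bij_of_nat_mod_ring: "bij_betw of_nat {..<CARD('p)} (UNIV :: 'p::prime_card mod_ring set)"
proof -
  have "of_nat ` {..<CARD('p)} = (UNIV :: 'p mod_ring set)"
    using surj_of_nat_mod_ring by fastforce
  then show ?thesis
    by (simp add: bij_betw_def eq_card_imp_inj_on)
qed

text \<open>Turns the norm in \<open>bd_letter\<close>, a sum that starts at \<open>a\<close>, into
  a sum over the whole group, where its invariance under translation is visible.\<close>

lemma sum_translates:
  "(\<Sum>j<CARD('p). f (a + of_nat j)) = (\<Sum>x\<in>(UNIV :: 'p::prime_card mod_ring set). f x)"
proof -
  have "(\<Sum>j<CARD('p). f (a + of_nat j)) = (\<Sum>x\<in>(UNIV :: 'p mod_ring set). f (a + x))"
    by (rule sum.reindex_bij_betw[OF bij_of_nat_mod_ring])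
  also have "\<dots> = (\<Sum>x\<in>UNIV. f x)"
    by (rule sum.reindex_bij_betw) (rule bij_betw_byWitness[where f' = "\<lambda>x. x - a"], auto)
  finally show ?thesis .
qed

lemma sum_translate_UNIV: "(\<Sum>x\<in>UNIV. f (x + a)) = (\<Sum>x\<in>(UNIV :: 'p::prime_card mod_ring set). f x)"
  by (rule sum.reindex_bij_betw) (rule bij_betw_byWitness[where f' = "\<lambda>x. x - a"], auto)

lemma of_nat_CARD_free_algebra [simp]: "of_nat CARD('p) = (0 :: 'x list \<Rightarrow>\<^sub>0 'p::prime_card mod_ring)"
  by (simp add: scalar_of_nat[symmetric])

text \<open>A natural number is needed because the length of a partial sum 1 + t + ... + t^(a-1)
  depends on a representative of \<open>a\<close>; such sums occur in the contraction and in the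
  lift of a dilation.\<close>

definition rep :: "'p::prime_card mod_ring \<Rightarrow> nat" where
  "rep a = nat (to_int_mod_ring a)"

lemma to_int_mod_ring_range: "to_int_mod_ring a \<in> {0..<int CARD('p)}" for a :: "'p::prime_card mod_ring"
  using range_to_int_mod_ring by blast

lemma rep_less: "rep (a :: 'p::prime_card mod_ring) < CARD('p)"
  unfolding rep_def using to_int_mod_ring_range[of a] by (simp add: nat_less_iff)

lemma of_nat_rep [simp]: "of_nat (rep a) = (a :: 'p::prime_card mod_ring)"
  unfolding rep_def of_nat_of_int_mod_ring o_def
  using to_int_mod_ring_range[of a] by simp

lemma rep_of_nat: "m < CARD('p) \<Longrightarrow> rep (of_nat m :: 'p::prime_card mod_ring) = m"
  using inj_onD[OF bij_betw_imp_inj_on[OF bij_of_nat_mod_ring[where 'p = 'p]], of "rep (of_nat m :: 'p mod_ring)" m]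
  by (simp add: rep_less)

lemma rep_0 [simp]: "rep 0 = 0"
  by (simp add: rep_def)

lemma rep_minus_1: "rep (- 1 :: 'p::prime_card mod_ring) = CARD('p) - 1"
proof -
  have "of_nat (CARD('p) - 1) = (- 1 :: 'p mod_ring)"
    by (simp add: of_nat_diff Suc_leI)
  moreover have "rep (of_nat (CARD('p) - 1) :: 'p mod_ring) = CARD('p) - 1"
    by (rule rep_of_nat) (simp add: zero_less_card_finite)
  ultimately show ?thesis by simp
qed

lemma rep_Suc:
  assumes "a \<noteq> - 1"
  shows "rep (a + 1 :: 'p::prime_card mod_ring) = Suc (rep a)"
proof -
  have "Suc (rep a) \<noteq> CARD('p)"
  proof
    assume "Suc (rep a) = CARD('p)"
    then have "of_nat (Suc (rep a)) = (0 :: 'p mod_ring)" by simp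
    then show False
      using assms by (simp add: eq_neg_iff_add_eq_0 add.commute)
  qed
  then have "Suc (rep a) < CARD('p)"
    using rep_less[of a] by simp
  then have "rep (of_nat (Suc (rep a)) :: 'p mod_ring) = Suc (rep a)"
    by (rule rep_of_nat)
  then show ?thesis
    by (simp add: add.commute)
qed

section \<open>Tensor powers of the standard resolution and their differential\<close>

type_synonym 'p cell = "('p mod_ring \<times> nat) list"

lemma resolution_supp: "resolution n = supp (\<lambda>w. length w = n)"
  by (simp add: resolution_def supp_def)

lemma resolution_degree_supp: "resolution_degree n k = supp (\<lambda>w. length w = n \<and> word_degree w = k)"
  by (auto simp: resolution_degree_def resolution_def supp_def)

lemma word_degree_simps [simp]:
  "word_degree [] = 0" "word_degree (x # w) = snd x + word_degree w"
  "word_degree (u @ v) = word_degree u + word_degree v"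
  by (simp_all add: word_degree_def)

lemma bd_word_singleton [simp]: "bd_word [x] = bd_letter x"
  by simp

lemma bd_of_word [simp]: "bd (word w) = bd_word w"
  by (simp add: bd_def)

lemma additive_bd: "Modules.additive bd"
  by standard (simp add: bd_def)

lemmas bd_add [simp] = additive.add[OF additive_bd]
  and bd_zero [simp] = additive.zero[OF additive_bd]
  and bd_diff [simp] = additive.diff[OF additive_bd]
  and bd_sum = additive.sum[OF additive_bd]

lemma bd_scalar [simp]: "bd (scalar c * x) = scalar c * bd x"
  by (simp add: bd_def)

lemma bd_sign [simp]: "bd ((- 1) ^ k * x) = (- 1) ^ k * bd x"
  by (simp add: bd_def)

lemma bd_letter_odd [simp]: "even i \<Longrightarrow> bd_letter (a, Suc i) = word [(a + 1, i)] - word [(a, i)]"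
  by simp

lemma bd_letter_even [simp]: "odd i \<Longrightarrow> bd_letter (a, Suc i) = (\<Sum>x\<in>UNIV. word [(x, i)])"
  by (simp add: sum_translates[where f = "\<lambda>x. word [(x, i)]"])

text \<open>The two parity rules above take over, with the norm as a sum over the group.\<close>

declare bd_letter.simps(2) [simp del]

text \<open>With \<open>Suc\<close> on the side of the boundary no word qualifies when the letter
  has degree 0, so the bound also says that the boundary vanishes there; truncated subtraction would
  lose this.\<close>

lemma bd_letter_supp: "bd_letter x \<in> supp (\<lambda>w. length w = 1 \<and> Suc (word_degree w) = snd x)"
  by (cases x rule: bd_letter.cases) (auto simp: bd_letter.simps(2) intro!: supp_diff supp_sum supp_single)

lemma bd_word_supp: "bd_word w \<in> supp (\<lambda>u. length u = length w \<and> Suc (word_degree u) = word_degree w)"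
proof (induction w)
  case (Cons x w)
  have "bd_letter x * word w \<in> supp (\<lambda>u. length u = length (x # w) \<and> Suc (word_degree u) = word_degree (x # w))"
    by (rule supp_times[OF bd_letter_supp supp_single[of "\<lambda>u. u = w"]]) auto
  moreover have "word [x] * bd_word w \<in> supp (\<lambda>u. length u = length (x # w) \<and> Suc (word_degree u) = word_degree (x # w))"
    by (rule supp_times[OF supp_single[of "\<lambda>u. u = [x]"] Cons]) auto
  ultimately show ?case
    by (auto simp: mult.assoc intro!: supp_add supp_sign)
qed simp

lemma bd_word_append:
  "bd_word (u @ v) = bd_word u * word v + (- 1) ^ word_degree u * word u * bd_word v"
proof (induction u)
  case (Cons x u)
  have "bd_word ((x # u) @ v) = bd_letter x * (word u * word v)
      + (- 1) ^ snd x * word [x] * (bd_word u * word v + (- 1) ^ word_degree u * word u * bd_word v)"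
    by (simp add: Cons word_append)
  also have "\<dots> = (bd_letter x * word u + (- 1) ^ snd x * word [x] * bd_word u) * word v
      + (- 1) ^ snd x * ((- 1) ^ word_degree u * (word [x] * (word u * bd_word v)))"
    by (simp only: distrib_left distrib_right mult.assoc add.assoc sign_left_commute[of "word [x]"])
  finally show ?case
    by (simp only: word_Cons[of x u] bd_word.simps word_degree_simps power_add mult.assoc)
qed simp

lemma bd_times:
  assumes "x \<in> supp (\<lambda>w. word_degree w = k)"
  shows "bd (x * y) = bd x * y + (- 1) ^ k * x * bd y"
proof -
  have 1: "bd (word w * y) = bd_word w * y + (- 1) ^ word_degree w * word w * bd y" for w
  proof (induction y rule: free_algebra_induct)
    case (single v c)
    show ?case
      unfolding scalar_word[of c v, symmetric] scalar_left_commute[of "word w"] bd_scalar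
        word_append[symmetric] bd_of_word bd_word_append
      by (simp only: distrib_left scalar_left_commute[of "bd_word w"]
          scalar_left_commute[of "(- 1) ^ word_degree w * word w"])
  qed (simp_all add: algebra_simps)
  show ?thesis
    using assms
  proof (induction x rule: supp_induct)
    case (single w c)
    show ?case
      unfolding scalar_word[of c w, symmetric] mult.assoc bd_scalar 1 bd_of_word
      using single
      by (simp only: distrib_left mult.assoc scalar_left_commute[of "(- 1) ^ k"])
  qed (simp_all add: algebra_simps)
qed

text \<open>The norm is annihilated by t - 1 on either side, being invariant under
  translation.\<close>

lemma bd_bd_letter: "bd (bd_letter x) = 0"
proof (cases x)
  case (Pair a k)
  show ?thesis
  proof (cases k)
    case (Suc i)
    show ?thesis
    proof (cases i)
      case (Suc j)
      show ?thesis
      proof (cases "even j")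
        case True
        then have "bd (bd_letter x) = (\<Sum>x\<in>UNIV. word [(x + 1, j)] - word [(x, j)])"
          using Pair \<open>k = Suc i\<close> Suc by (simp add: bd_sum)
        then show ?thesis
          using sum_translate_UNIV[of "\<lambda>x. word [(x, j)]" 1] by (simp add: sum_subtractf)
      next
        case False
        then show ?thesis
          using Pair \<open>k = Suc i\<close> Suc by simp
      qed
    qed (simp add: Pair \<open>k = Suc i\<close>)
  qed (simp add: Pair)
qed

lemma bd_bd_word: "bd (bd_word w) = 0"
proof (induction w)
  case (Cons x w)
  have "bd (bd_letter x * word w) = - ((- 1) ^ snd x * bd_letter x * bd_word w)"
  proof (cases "snd x")
    case 0
    then have "bd_letter x = 0" by (cases x) simp
    then show ?thesis by simp
  next
    case (Suc i)
    have "bd_letter x \<in> supp (\<lambda>u. word_degree u = i)"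
      using Suc by (intro supp_mono[OF bd_letter_supp[of x]]) auto
    then show ?thesis
      by (simp add: bd_times bd_bd_letter Suc)
  qed
  moreover have "bd (word [x] * bd_word w) = bd_letter x * bd_word w"
    by (simp add: bd_times[of "word [x]" "snd x"] supp_single Cons)
  ultimately show ?case
    by (simp add: mult.assoc)
qed simp

subsection \<open>A contraction\<close>

text \<open>The classical contraction: in even degree t^a becomes (t^a - 1) / (t - 1). In odd degree
  only the last exponent \<open>a = - 1\<close> contributes, so that the sum over a whole orbit
  gives the next basis cell exactly once.\<close>

fun contr_letter :: "'p::prime_card mod_ring \<times> nat \<Rightarrow> 'p resol" where
  "contr_letter (a, i) =
     (if even i then \<Sum>j<rep a. word [(of_nat j, Suc i)]
      else if a = - 1 then word [(0, Suc i)] else 0)"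

definition base_letter :: "'p::prime_card mod_ring \<times> nat \<Rightarrow> 'p resol" where
  "base_letter x = (if snd x = 0 then word [(0, 0)] else 0)"

fun base_word :: "'p::prime_card cell \<Rightarrow> 'p resol" where
  "base_word [] = 1"
| "base_word (x # w) = base_letter x * base_word w"

fun contr_word :: "'p::prime_card cell \<Rightarrow> 'p resol" where
  "contr_word [] = 0"
| "contr_word (x # w) = contr_letter x * word w + base_letter x * contr_word w"

lemma contr_letter_supp: "contr_letter x \<in> supp (\<lambda>u. length u = 1 \<and> word_degree u = Suc (snd x))"
  by (cases x) (auto intro!: supp_sum supp_single)

lemma base_letter_supp: "base_letter x \<in> supp (\<lambda>u. length u = 1 \<and> word_degree u = snd x)"
  by (auto simp: base_letter_def intro!: supp_single)

lemma contr_word_supp: "contr_word w \<in> supp (\<lambda>u. length u = length w \<and> word_degree u = Suc (word_degree w))"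
proof (induction w)
  case (Cons x w)
  have "contr_letter x * word w \<in> supp (\<lambda>u. length u = length (x # w) \<and> word_degree u = Suc (word_degree (x # w)))"
    by (rule supp_times[OF contr_letter_supp supp_single[of "\<lambda>u. u = w"]]) auto
  moreover have "base_letter x * contr_word w \<in> supp (\<lambda>u. length u = length (x # w) \<and> word_degree u = Suc (word_degree (x # w)))"
    by (rule supp_times[OF base_letter_supp Cons]) auto
  ultimately show ?case by (simp add: supp_add)
qed simp

lemma contr_letter:
  fixes x :: "'p::prime_card mod_ring \<times> nat"
  shows "bd (contr_letter x) + lin contr_word (bd_letter x) = word [x] - base_letter x"
proof -
  obtain a i where x: "x = (a, i)" by force
  have 1: "lin contr_word (word [y]) = contr_letter y" for y :: "'p mod_ring \<times> nat"
    by simp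
  show ?thesis
  proof (cases "even i")
    case True
    have "bd (contr_letter x) = (\<Sum>j<rep a. word [(of_nat (Suc j), i)] - word [(of_nat j, i)])"
      using True by (simp add: x bd_sum add.commute[of 1])
    also have "\<dots> = word [(a, i)] - word [(0, i)]"
      by (subst sum_lessThan_telescope) simp
    finally have b: "bd (contr_letter x) = word [(a, i)] - word [(0, i)]" .
    show ?thesis
    proof (cases i)
      case 0
      with b show ?thesis by (simp add: x base_letter_def)
    next
      case (Suc j)
      have "lin contr_word (bd_letter x) = (\<Sum>y\<in>UNIV. contr_letter (y, j))"
        using True Suc by (simp add: x lin_sum del: contr_letter.simps)
      also have "\<dots> = (\<Sum>y\<in>(UNIV :: 'p mod_ring set). if y = - 1 then word [(0, i)] else 0)"
        using True Suc by (intro sum.cong) auto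
      also have "\<dots> = word [(0, i)]"
        by simp
      finally show ?thesis
        using b Suc by (simp add: x base_letter_def)
    qed
  next
    case False
    then obtain j where j: "i = Suc j" "even j" by (metis even_Suc not0_implies_Suc even_zero)
    have "lin contr_word (bd_letter x) = contr_letter (a + 1, j) - contr_letter (a, j)"
      using j by (simp only: x bd_letter_odd lin_diff 1)
    moreover have "bd (contr_letter x) = (if a = - 1 then (\<Sum>y\<in>UNIV. word [(y, i)]) else 0)"
    proof (cases "a = - 1")
      case True
      then have "bd (contr_letter x) = bd_letter (0, Suc i)"
        using False by (simp only: x contr_letter.simps simp_thms if_True if_False bd_of_word bd_word_singleton)
      then show ?thesis
        using False True by simp
    qed (use False in \<open>simp add: x\<close>)
    \<comment> \<open>The wrap-around \<open>a = - 1\<close>: the norm consists of the partial sum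
      that the contraction assigns to the exponent p - 1, and of one more term, the letter
      \<open>x\<close> itself.\<close>
    moreover have "(\<Sum>y\<in>UNIV. word [(y, i)] :: 'p resol) = (\<Sum>m<rep (- 1 :: 'p mod_ring). word [(of_nat m, i)]) + word [(- 1 :: 'p mod_ring, i)]"
    proof -
      have "(\<Sum>y\<in>UNIV. word [(y, i)] :: 'p resol) = (\<Sum>m<CARD('p). word [(of_nat m, i)])"
        using sum_translates[of "\<lambda>y. word [(y, i)] :: 'p resol" 0] by simp
      also have "CARD('p) = Suc (rep (- 1 :: 'p mod_ring))"
        by (simp add: rep_minus_1)
      finally show ?thesis by (simp only: sum.lessThan_Suc of_nat_rep)
    qed
    moreover have "contr_letter (a + 1, j) - contr_letter (a, j) =
        (if a = - 1 then - (\<Sum>m<rep (- 1 :: 'p mod_ring). word [(of_nat m, i)]) else word [x])"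
      using j rep_Suc[of a] by (cases "a = - 1") (simp_all add: x)
    ultimately show ?thesis
      using False odd_pos[of i] by (cases "a = - 1") (simp_all add: x base_letter_def)
  qed
qed

lemma bd_base_letter: "bd (base_letter x) = 0"
  by (simp add: base_letter_def)

lemma lin_base_bd_letter: "lin base_word (bd_letter x) = 0"
  by (cases x rule: bd_letter.cases) (auto simp: bd_letter.simps(2) lin_sum base_letter_def)

lemma lin_contr_times:
  assumes "x \<in> supp (\<lambda>w. length w = 1)"
  shows "lin contr_word (x * y) = lin contr_word x * y + lin base_word x * lin contr_word y"
proof -
  have *: "lin contr_word (word [z] * y) = contr_letter z * y + base_letter z * lin contr_word y" for z
  proof (induction y rule: free_algebra_induct)
    case (single v c)
    have "lin contr_word (word [z] * word v) = contr_letter z * word v + base_letter z * contr_word v"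
      unfolding word_append[symmetric] by simp
    then show ?case
      unfolding scalar_word[of c v, symmetric] scalar_left_commute[of "word [z]"] lin_scalar
      by (simp add: distrib_left scalar_left_commute[of "contr_letter z"] scalar_left_commute[of "base_letter z"])
  qed (simp_all add: algebra_simps)
  show ?thesis
    using assms
  proof (induction x rule: supp_induct)
    case (single w c)
    then obtain z where w: "w = [z]" by (auto simp: length_Suc_conv)
    show ?case
      unfolding w scalar_word[of c "[z]", symmetric] mult.assoc lin_scalar *
      by (simp add: distrib_left mult.assoc)
  qed (simp_all add: algebra_simps)
qed

lemma bd_contr_word: "bd (contr_word w) + lin contr_word (bd_word w) = word w - base_word w"
proof (induction w)
  case (Cons x w)
  define s :: "'a resol" where "s = (- 1) ^ snd x"
  have s1: "bd (contr_letter x * word w) = bd (contr_letter x) * word w - s * contr_letter x * bd_word w"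
    unfolding s_def by (subst bd_times[OF supp_mono[OF contr_letter_supp[of x]]]) auto
  have s2: "bd (base_letter x * contr_word w) = base_letter x * bd (contr_word w)"
  proof -
    have "base_letter x \<in> supp (\<lambda>u. word_degree u = 0)"
      by (auto simp: base_letter_def intro!: supp_single)
    then show ?thesis
      by (simp add: bd_times bd_base_letter)
  qed
  have s3: "lin contr_word (bd_letter x * word w) = lin contr_word (bd_letter x) * word w"
    by (subst lin_contr_times[OF supp_mono[OF bd_letter_supp[of x]]]) (auto simp: lin_base_bd_letter)
  have s4: "lin contr_word (word [x] * bd_word w) = contr_letter x * bd_word w + base_letter x * lin contr_word (bd_word w)"
    by (subst lin_contr_times) (simp_all add: supp_single)
  have ls: "lin contr_word (s * y) = s * lin contr_word y" for y
    by (simp add: s_def)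
  \<comment> \<open>The base letter is nonzero only in degree 0, where the sign is 1.\<close>
  have s5: "s * base_letter x = base_letter x"
    by (simp add: s_def base_letter_def)
  have "bd (contr_word (x # w)) + lin contr_word (bd_word (x # w)) =
      (bd (contr_letter x) + lin contr_word (bd_letter x)) * word w
      + base_letter x * bd (contr_word w) + (s * base_letter x) * lin contr_word (bd_word w)"
    by (simp add: ls s1 s2 s3 s4 s_def[symmetric] mult.assoc algebra_simps)
  also have "\<dots> = (word [x] - base_letter x) * word w + base_letter x * (bd (contr_word w) + lin contr_word (bd_word w))"
    by (simp add: s5 contr_letter distrib_left)
  also have "\<dots> = word [x] * word w - base_letter x * base_word w"
    by (simp add: Cons algebra_simps)
  finally show ?case
    by (simp add: word_append[symmetric])
qed simp

lemma bd_contr: "bd (lin contr_word x) + lin contr_word (bd x) = x - lin base_word x"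
proof -
  have "bd (lin contr_word x) + lin contr_word (bd x)
      = lin (\<lambda>w. bd (contr_word w) + lin contr_word (bd_word w)) x"
    by (simp add: bd_def lin_lin lin_fun_add)
  also have "\<dots> = lin word x - lin base_word x"
    by (simp only: bd_contr_word lin_fun_diff)
  finally show ?thesis by simp
qed

lemma base_word_eq: "base_word w = (if word_degree w = 0 then word (replicate (length w) (0, 0)) else 0)"
  by (induction w) (auto simp: base_letter_def word_append[symmetric])

section \<open>The augmentation\<close>

lemma single_sum: "Poly_Mapping.single k (sum g A) = (\<Sum>a\<in>A. Poly_Mapping.single k (g a))"
  by (induction A rule: infinite_finite_induct) (simp_all add: single_add)

text \<open>Rewritten as a linear extension with values in the scalars, the augmentation inherits
  additivity from \<open>lin\<close> and can be compared with \<open>base_word\<close>.\<close>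

lemma augmentation_eq: "scalar (augmentation x) =
    (lin (\<lambda>w. if word_degree w = 0 then 1 else 0) x :: 'x list \<Rightarrow>\<^sub>0 'p::prime_card mod_ring)"
  unfolding augmentation_def lin_def zero_list_Nil single_sum by (intro sum.cong) auto

lemma additive_augmentation: "Modules.additive (augmentation :: 'p::prime_card resol \<Rightarrow> _)"
proof
  fix x y :: "'p resol"
  have "scalar (augmentation (x + y)) =
      (scalar (augmentation x + augmentation y) :: nat list \<Rightarrow>\<^sub>0 _)"
    by (simp add: augmentation_eq single_add)
  then show "augmentation (x + y) = augmentation x + augmentation y"
    by (metis lookup_single_eq)
qed

lemmas augmentation_add [simp] = additive.add[OF additive_augmentation]
  and augmentation_zero [simp] = additive.zero[OF additive_augmentation]
  and augmentation_diff [simp] = additive.diff[OF additive_augmentation]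
  and augmentation_sum = additive.sum[OF additive_augmentation]

lemma augmentation_single: "augmentation (Poly_Mapping.single w c) = (if word_degree w = 0 then c else 0)"
  by (simp add: augmentation_def)

lemma augmentation_scalar [simp]: "augmentation (scalar c * x) = c * augmentation x"
  by (induction x rule: free_algebra_induct)
    (simp_all add: augmentation_single mult_single algebra_simps)

lemma augmentation_lin: "augmentation (lin f x) =
    (\<Sum>w\<in>Poly_Mapping.keys x. Poly_Mapping.lookup x w * augmentation (f w))"
  unfolding lin_def zero_list_Nil by (simp add: augmentation_sum)

lemma augmentation_times: "augmentation (x * y) = augmentation x * augmentation y"
proof (induction x rule: free_algebra_induct)
  case (single u c)
  show ?case
    by (induction y rule: free_algebra_induct)
      (simp_all add: mult_single augmentation_single distrib_left)
qed (simp_all add: distrib_right)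

text \<open>All words of length n and degree 0 have the same base cell, so only the augmentation is
  left of them. By \<open>bd_contr\<close>, a cycle of augmentation 0 is then the boundary of its
  contraction.\<close>

lemma lin_base_word_supp:
  assumes "x \<in> supp (\<lambda>w. length w = n)"
  shows "lin base_word x = scalar (augmentation x) * word (replicate n (0, 0))"
  unfolding augmentation_eq lin_mult_right[symmetric]
  by (rule lin_cong_supp[OF assms]) (simp add: base_word_eq)

section \<open>Equivariant chain maps\<close>

text \<open>Group elements are lists here and not vectors, so that splitting the coordinates into
  blocks is \<open>append\<close>, as it is for cells.\<close>

definition translate_word :: "'p::prime_card mod_ring list \<Rightarrow> 'p cell \<Rightarrow> 'p cell" where
  "translate_word v w = map2 (\<lambda>g (a, i). (g + a, i)) v w"

definition translate_list :: "'p::prime_card mod_ring list \<Rightarrow> 'p resol \<Rightarrow> 'p resol" where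
  "translate_list v = lin (\<lambda>w. word (translate_word v w))"

lemma translate_eq: "translate v = translate_list (list_of_vec v)"
  by (simp add: translate_def translate_list_def translate_word_def)

lemma length_translate_word [simp]: "length (translate_word v w) = min (length v) (length w)"
  by (simp add: translate_word_def)

lemma translate_word_Nil [simp]: "translate_word [] [] = []"
  by (simp add: translate_word_def)

lemma translate_word_Cons [simp]: "translate_word (g # v) (x # w) = (g + fst x, snd x) # translate_word v w"
  by (simp add: translate_word_def split: prod.split)

lemma word_degree_translate: "length v = length w \<Longrightarrow> word_degree (translate_word v w) = word_degree w"
  by (induction v w rule: list_induct2) auto

lemma map_snd_translate: "length v = length w \<Longrightarrow> map snd (translate_word v w) = map snd w"
  by (induction v w rule: list_induct2) auto

lemma map_fst_translate: "length v = length w \<Longrightarrow> map fst (translate_word v w) = map2 (+) v (map fst w)"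
  by (induction v w rule: list_induct2) auto

lemma translate_word_append: "length u = length w \<Longrightarrow>
    translate_word (u @ v) (w @ z) = translate_word u w @ translate_word v z"
  by (simp add: translate_word_def)

lemma translate_word_translate: "length u = length w \<Longrightarrow> length v = length w \<Longrightarrow>
    translate_word u (translate_word v w) = translate_word (map2 (+) u v) w"
proof -
  assume "length u = length w" "length v = length w"
  then have "length u = length v" "length v = length w" by simp_all
  then show ?thesis
    by (induction u v w rule: list_induct3) (auto simp: add.assoc)
qed

lemma translate_base: "translate_word (map fst w) (map (Pair 0) (map snd w)) = w"
  by (induction w) auto

lemma translate_list_word [simp]: "translate_list v (word w) = word (translate_word v w)"
  by (simp add: translate_list_def)

lemma additive_translate_list: "Modules.additive (translate_list v)"
  by standard (simp add: translate_list_def)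

lemmas translate_list_add [simp] = additive.add[OF additive_translate_list]
  and translate_list_zero [simp] = additive.zero[OF additive_translate_list]
  and translate_list_diff [simp] = additive.diff[OF additive_translate_list]
  and translate_list_sum = additive.sum[OF additive_translate_list]

lemma translate_list_scalar [simp]:
  "translate_list v (scalar c * x) = scalar c * translate_list v x"
  by (simp add: translate_list_def)

lemma translate_list_sign [simp]: "translate_list v ((- 1) ^ k * x) = (- 1) ^ k * translate_list v x"
  by (simp add: translate_list_def)

lemma translate_list_times:
  assumes "x \<in> supp (\<lambda>w. length w = length u)"
  shows "translate_list (u @ v) (x * y) = translate_list u x * translate_list v y"
  unfolding translate_list_def using assms
  by (intro lin_times) (auto simp: translate_word_append word_append supp_def)

lemma translate_list_translate:
  assumes "x \<in> supp (\<lambda>w. length w = length u)" "length u = length v"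
  shows "translate_list u (translate_list v x) = translate_list (map2 (+) u v) x"
  unfolding translate_list_def lin_lin using assms
  by (intro lin_cong_supp[OF assms(1)]) (simp add: translate_word_translate)

lemma translate_list_supp:
  assumes "x \<in> supp (\<lambda>w. length w = length v \<and> word_degree w = k)"
  shows "translate_list v x \<in> supp (\<lambda>w. length w = length v \<and> word_degree w = k)"
  unfolding translate_list_def by (intro supp_lin[OF assms] supp_single) (auto simp: word_degree_translate)

lemma translate_bd_letter: "translate_list [g] (bd_letter (a, k)) = bd_letter (g + a, k)"
proof (cases k)
  case (Suc i)
  show ?thesis
  proof (cases "even i")
    case False
    have "(\<Sum>x\<in>UNIV. word [(g + x, i)]) = (\<Sum>x\<in>UNIV. word [(x, i)])"
      using sum_translate_UNIV[of "\<lambda>x. word [(x, i)]" g] by (simp add: add.commute)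
    with False show ?thesis
      by (simp add: Suc translate_list_sum)
  qed (simp add: Suc add.assoc)
qed simp

lemma translate_bd_word: "length v = length w \<Longrightarrow> translate_list v (bd_word w) = bd_word (translate_word v w)"
proof (induction v w rule: list_induct2)
  case (Cons g v x w)
  have "translate_list ([g] @ v) (bd_letter x * word w) = bd_letter (g + fst x, snd x) * word (translate_word v w)"
    by (subst translate_list_times[OF supp_mono[OF bd_letter_supp[of x]]])
      (use translate_bd_letter[of g "fst x" "snd x"] in auto)
  moreover have "translate_list ([g] @ v) (word [x] * bd_word w)
      = word [(g + fst x, snd x)] * bd_word (translate_word v w)"
    by (subst translate_list_times) (auto intro: supp_single simp: Cons.IH)
  ultimately show ?case
    by (simp add: mult.assoc)
qed simp

lemma translate_bd:
  assumes "x \<in> supp (\<lambda>w. length w = length v)"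
  shows "translate_list v (bd x) = bd (translate_list v x)"
  unfolding bd_def translate_list_def lin_lin
  by (rule lin_cong_supp[OF assms])
    (use translate_bd_word[of v] in \<open>simp add: translate_list_def\<close>)

section \<open>Passage to trivial coefficients\<close>

lemma trivialize_word [simp]: "trivialize (word w) = word (map snd w)"
  by (simp add: trivialize_def)

lemma additive_trivialize: "Modules.additive trivialize"
  by standard (simp add: trivialize_def)

lemmas trivialize_add [simp] = additive.add[OF additive_trivialize]
  and trivialize_zero [simp] = additive.zero[OF additive_trivialize]
  and trivialize_diff [simp] = additive.diff[OF additive_trivialize]
  and trivialize_sum = additive.sum[OF additive_trivialize]

lemma trivialize_scalar [simp]:
  "trivialize (scalar c * x) = scalar c * trivialize x"
  by (simp add: trivialize_def)

lemma trivialize_sign [simp]: "trivialize ((- 1) ^ k * x) = (- 1) ^ k * trivialize x"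
  by (simp add: trivialize_def)

lemma trivialize_times [simp]: "trivialize (x * y) = trivialize x * trivialize y"
  unfolding trivialize_def by (rule lin_word_map)

lemma trivialize_translate:
  assumes "x \<in> supp (\<lambda>w. length w = length v)"
  shows "trivialize (translate_list v x) = trivialize x"
  unfolding trivialize_def translate_list_def lin_lin
  by (rule lin_cong_supp[OF assms]) (simp add: map_snd_translate)

text \<open>Forgetting the group parts turns t - 1 into 0 and the norm into p, which is 0 in the
  field.\<close>

lemma trivialize_bd_letter: "trivialize (bd_letter x) = 0"
  by (cases x rule: bd_letter.cases) (auto simp: bd_letter.simps(2) trivialize_sum)

lemma trivialize_bd_word: "trivialize (bd_word w) = 0"
  by (induction w) (simp_all add: trivialize_bd_letter mult.assoc)

lemma trivialize_bd: "trivialize (bd x) = 0"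
proof -
  have "trivialize (bd x) = lin (\<lambda>w. trivialize (bd_word w)) x"
    by (simp add: bd_def trivialize_def lin_lin)
  then show ?thesis
    by (simp add: trivialize_bd_word)
qed

text \<open>A lift is determined by its values on words; \<open>g\<close> is the map of the groups \<open>V_n\<close>, written on
  lists.\<close>

definition chain_map :: "nat \<Rightarrow> ('p::prime_card mod_ring list \<Rightarrow> 'p mod_ring list) \<Rightarrow>
    ('p cell \<Rightarrow> 'p resol) \<Rightarrow> bool" where
  "chain_map n g f \<longleftrightarrow> (\<forall>w. length w = n \<longrightarrow>
     f w \<in> supp (\<lambda>u. length u = n \<and> word_degree u = word_degree w) \<and>
     lin f (bd_word w) = bd (f w) \<and>
     augmentation (f w) = augmentation (word w) \<and>
     (\<forall>v. length v = n \<longrightarrow> f (translate_word v w) = translate_list (g v) (f w)))"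

definition additive_on_lists :: "nat \<Rightarrow> ('p::prime_card mod_ring list \<Rightarrow> 'p mod_ring list) \<Rightarrow> bool" where
  "additive_on_lists n g \<longleftrightarrow> (\<forall>u v. length u = n \<longrightarrow> length v = n \<longrightarrow>
     length (g u) = n \<and> g (map2 (+) u v) = map2 (+) (g u) (g v))"

text \<open>Cells with group parts 0 form a basis of the resolution over the group ring. From this
  basis \<open>H\<close> is extended equivariantly along \<open>g\<close>.\<close>

definition equivariant_ext :: "('p::prime_card mod_ring list \<Rightarrow> 'p mod_ring list) \<Rightarrow> (nat list \<Rightarrow> 'p resol) \<Rightarrow>
    'p cell \<Rightarrow> 'p resol" where
  "equivariant_ext g H w = translate_list (g (map fst w)) (H (map snd w))"

text \<open>Two lifts of the same map are chain homotopic. The homotopy is built on the free basis by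
  induction on the degree, using the contraction.\<close>

primrec homotopy :: "('p::prime_card mod_ring list \<Rightarrow> 'p mod_ring list) \<Rightarrow>
    ('p cell \<Rightarrow> 'p resol) \<Rightarrow> nat \<Rightarrow> nat list \<Rightarrow> 'p resol" where
  "homotopy g \<theta> 0 = (\<lambda>\<alpha>. 0)"
| "homotopy g \<theta> (Suc k) = (\<lambda>\<alpha>. if sum_list \<alpha> = k
     then lin contr_word (\<theta> (map (Pair 0) \<alpha>) -
            lin (equivariant_ext g (homotopy g \<theta> k)) (bd_word (map (Pair 0) \<alpha>)))
     else homotopy g \<theta> k \<alpha>)"

text \<open>The properties of a difference \<theta> of two lifts of \<open>g\<close>: it is again an
  equivariant chain map, now with augmentation 0.\<close>

locale null_lift =
  fixes n :: nat and g :: "'p::prime_card mod_ring list \<Rightarrow> 'p mod_ring list"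
    and \<theta> :: "'p cell \<Rightarrow> 'p resol"
  assumes additive_g: "additive_on_lists n g"
    and supp_theta: "length w = n \<Longrightarrow> \<theta> w \<in> supp (\<lambda>u. length u = n \<and> word_degree u = word_degree w)"
    and bd_theta: "length w = n \<Longrightarrow> lin \<theta> (bd_word w) = bd (\<theta> w)"
    and augmentation_theta: "length w = n \<Longrightarrow> augmentation (\<theta> w) = 0"
    and translate_theta: "length w = n \<Longrightarrow> length v = n \<Longrightarrow> \<theta> (translate_word v w) = translate_list (g v) (\<theta> w)"
begin

abbreviation "H \<equiv> homotopy g \<theta>"
abbreviation "E k \<equiv> equivariant_ext g (H k)"

lemma length_g: "length v = n \<Longrightarrow> length (g v) = n"
  using additive_g by (auto simp: additive_on_lists_def)

lemma word_degree_base: "word_degree (map (Pair 0) \<alpha>) = sum_list \<alpha>"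
  by (simp add: word_degree_def o_def)

lemma sum_list_map_snd: "sum_list (map snd w) = word_degree w"
  by (simp add: word_degree_def)

lemma supp_ext:
  assumes "\<And>\<alpha>. length \<alpha> = n \<Longrightarrow> K \<alpha> \<in> supp (\<lambda>u. length u = n \<and> word_degree u = Suc (sum_list \<alpha>))"
    and "length w = n"
  shows "equivariant_ext g K w \<in> supp (\<lambda>u. length u = n \<and> word_degree u = Suc (word_degree w))"
  unfolding equivariant_ext_def
  using translate_list_supp[of "K (map snd w)" "g (map fst w)" "Suc (word_degree w)"]
    assms(1)[of "map snd w"] assms(2) length_g[of "map fst w"]
  by (simp add: sum_list_map_snd)

lemma supp_homotopy:
  "length \<alpha> = n \<Longrightarrow> H k \<alpha> \<in> supp (\<lambda>u. length u = n \<and> word_degree u = Suc (sum_list \<alpha>))"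
proof (induction k arbitrary: \<alpha>)
  case (Suc k)
  show ?case
  proof (cases "sum_list \<alpha> = k")
    case True
    let ?w = "map (Pair 0) \<alpha>"
    have "lin (E k) (bd_word ?w) \<in> supp (\<lambda>u. length u = n \<and> word_degree u = k)"
    proof (rule supp_lin[OF bd_word_supp[of ?w]])
      fix u :: "'p cell"
      assume "length u = length ?w \<and> Suc (word_degree u) = word_degree ?w"
      then have "length u = n" "Suc (word_degree u) = k"
        using Suc.prems True by (simp_all add: word_degree_base)
      then show "E k u \<in> supp (\<lambda>u. length u = n \<and> word_degree u = k)"
        using supp_ext[OF Suc.IH, of u] by simp
    qed
    moreover have "\<theta> ?w \<in> supp (\<lambda>u. length u = n \<and> word_degree u = k)"
      using supp_theta[of ?w] Suc.prems True by (simp add: word_degree_base)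
    ultimately have "\<theta> ?w - lin (E k) (bd_word ?w) \<in> supp (\<lambda>u. length u = n \<and> word_degree u = k)"
      by (rule supp_diff[rotated])
    then have "lin contr_word (\<theta> ?w - lin (E k) (bd_word ?w)) \<in> supp (\<lambda>u. length u = n \<and> word_degree u = Suc k)"
      by (rule supp_lin) (rule supp_mono[OF contr_word_supp], auto)
    then show ?thesis
      using True by (simp del: lin_diff)
  qed (use Suc in simp)
qed simp

lemma ext_translate:
  assumes "length v = n" "length w = n"
  shows "E k (translate_word v w) = translate_list (g v) (E k w)"
proof -
  have "translate_list (g v) (E k w) = translate_list (map2 (+) (g v) (g (map fst w))) (H k (map snd w))"
    unfolding equivariant_ext_def
    by (rule translate_list_translate)
      (use supp_conjD[OF supp_homotopy[of "map snd w" k]] assms length_g in auto)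
  moreover have "g (map2 (+) v (map fst w)) = map2 (+) (g v) (g (map fst w))"
    using additive_g assms by (simp add: additive_on_lists_def)
  ultimately show ?thesis
    unfolding equivariant_ext_def using assms by (simp add: map_snd_translate map_fst_translate)
qed

lemma lin_ext_translate:
  assumes "length v = n" "x \<in> supp (\<lambda>w. length w = n)"
  shows "lin (E k) (translate_list v x) = translate_list (g v) (lin (E k) x)"
  unfolding translate_list_def lin_lin
  by (rule lin_cong_supp[OF assms(2)])
    (use ext_translate[OF assms(1)] in \<open>simp add: translate_list_def\<close>)

text \<open>Equivariance reduces the claim to a basis cell \<open>e\<close>. In the new degree
  \<open>k\<close> the element \<theta> e - H (d e) is a cycle by the relation in lower degrees, and
  its contraction is the new value of the homotopy.\<close>

lemma homotopy_relation:
  "length w = n \<Longrightarrow> word_degree w < k \<Longrightarrow> \<theta> w = bd (E k w) + lin (E k) (bd_word w)"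
proof (induction k arbitrary: w)
  case (Suc k)
  define \<alpha> where "\<alpha> = map snd w"
  define e :: "'p cell" where "e = map (Pair 0) \<alpha>"
  have len: "length \<alpha> = n" "length e = n" and deg: "sum_list \<alpha> = word_degree w" "word_degree e = word_degree w"
    using Suc.prems by (simp_all add: e_def word_degree_base) (simp_all add: \<alpha>_def sum_list_map_snd)
  have w: "w = translate_word (map fst w) e"
    unfolding e_def \<alpha>_def by (simp only: translate_base)
  have bde: "bd_word e \<in> supp (\<lambda>u. length u = n \<and> word_degree u < k)"
    using bd_word_supp[of e] by (rule supp_mono) (use len deg Suc.prems in auto)
  \<comment> \<open>Stage \<open>Suc k\<close> changes the homotopy in degree \<open>k\<close>
    only.\<close>
  have step: "lin (E (Suc k)) x = lin (E k) x" if "x \<in> supp (\<lambda>u. length u = n \<and> word_degree u < k)" for x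
    by (rule lin_cong_supp[OF that]) (simp add: equivariant_ext_def sum_list_map_snd)
  have base: "\<theta> e = bd (H (Suc k) \<alpha>) + lin (E k) (bd_word e)"
  proof (cases "word_degree w = k")
    case False
    \<comment> \<open>The group parts of \<open>e\<close> are 0 and the additive map
      \<open>g\<close> fixes 0, so the extension translates by 0.\<close>
    have "E k e = H k \<alpha>"
    proof -
      have "replicate n 0 = map2 (+) (replicate n 0) (replicate n (0 :: 'p mod_ring))"
        by (induction n) auto
      then have "g (replicate n 0) = map2 (+) (g (replicate n 0)) (g (replicate n 0))"
        using additive_g by (metis additive_on_lists_def length_replicate)
      have z: "g (replicate n 0) = replicate n 0"
      proof (rule nth_equalityI)
        fix i assume i: "i < length (g (replicate n 0))"
        let ?z = "g (replicate n 0)"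
        have "?z ! i = map2 (+) ?z ?z ! i"
          using \<open>?z = map2 (+) ?z ?z\<close> by simp
        then have "?z ! i = ?z ! i + ?z ! i"
          using i by (metis length_map length_zip min.idem nth_map nth_zip prod.simps(2))
        then have "?z ! i = 0"
          by (rule add_cancel_right_right[THEN iffD1])
        then show "?z ! i = replicate n 0 ! i"
          using i length_g by simp
      qed (simp add: length_g)
      have "translate_word (replicate (length u) 0) u = u" for u :: "'p cell"
        by (induction u) auto
      then have "translate_list (replicate n 0) x = lin word x" if "x \<in> supp (\<lambda>u. length u = n)" for x :: "'p resol"
        unfolding translate_list_def by (intro lin_cong_supp[OF that]) auto
      moreover have "H k \<alpha> \<in> supp (\<lambda>u. length u = n)"
        using supp_conjD[OF supp_homotopy[OF len(1)]] .
      moreover have "map fst e = replicate n 0" "map snd e = \<alpha>"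
        using len by (simp_all add: e_def o_def map_replicate_const)
      ultimately show ?thesis
        by (simp add: equivariant_ext_def z)
    qed
    then show ?thesis
      using Suc.IH[of e] False Suc.prems len deg by simp
  next
    case True
    let ?y = "\<theta> e - lin (E k) (bd_word e)"
    have IH: "lin \<theta> x = bd (lin (E k) x) + lin (E k) (bd x)"
      if "x \<in> supp (\<lambda>u. length u = n \<and> word_degree u < k)" for x
    proof -
      have "lin \<theta> x = lin (\<lambda>w. bd (E k w) + lin (E k) (bd_word w)) x"
        by (rule lin_cong_supp[OF that]) (use Suc.IH in blast)
      then show ?thesis
        by (simp add: lin_fun_add bd_def lin_lin)
    qed
    have "bd ?y = 0"
      using IH[OF bde] bd_theta[of e] len by (simp add: bd_bd_word)
    moreover have supp_y: "?y \<in> supp (\<lambda>u. length u = n \<and> word_degree u = k)"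
    proof (rule supp_diff)
      show "lin (E k) (bd_word e) \<in> supp (\<lambda>u. length u = n \<and> word_degree u = k)"
      proof (rule supp_lin[OF bd_word_supp[of e]])
        fix u :: "'p cell"
        assume "length u = length e \<and> Suc (word_degree u) = word_degree e"
        then have "length u = n" "Suc (word_degree u) = k"
          using len deg True by simp_all
        then show "E k u \<in> supp (\<lambda>u. length u = n \<and> word_degree u = k)"
          using supp_ext[OF supp_homotopy[of _ k], of u] by simp
      qed
    qed (use supp_theta[of e] len deg True in simp)
    \<comment> \<open>In positive degree \<open>base_word\<close> vanishes; in degree 0 it measures
      the augmentation of \<theta>, which is 0.\<close>
    moreover have "lin base_word ?y = 0"
    proof (cases k)
      case 0
      have "bd_word e = 0"
        using bde 0 by (auto simp: supp_def intro: poly_mapping_eqI)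
      moreover have "\<theta> e \<in> supp (\<lambda>w. length w = n)"
        using supp_conjD[OF supp_theta[of e]] len by simp
      ultimately show ?thesis
        using augmentation_theta[of e] len by (simp add: lin_base_word_supp)
    next
      case (Suc m)
      have "lin base_word ?y = lin (\<lambda>_. 0) ?y"
        by (rule lin_cong_supp[OF supp_y]) (simp add: base_word_eq Suc)
      then show ?thesis by simp
    qed
    ultimately have "bd (lin contr_word ?y) = ?y"
      using bd_contr[of ?y] by simp
    then show ?thesis
      using True deg by (simp add: e_def)
  qed
  have "\<theta> w = translate_list (g (map fst w)) (\<theta> e)"
    using w translate_theta[of e "map fst w"] len Suc.prems by simp
  also have "\<dots> = translate_list (g (map fst w)) (bd (H (Suc k) \<alpha>)) +
      translate_list (g (map fst w)) (lin (E (Suc k)) (bd_word e))"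
    by (simp only: base step[OF bde] translate_list_add)
  also have "translate_list (g (map fst w)) (bd (H (Suc k) \<alpha>)) = bd (E (Suc k) w)"
    unfolding equivariant_ext_def \<alpha>_def[symmetric]
    using supp_conjD[OF supp_homotopy[OF len(1), of "Suc k"]] length_g[of "map fst w"] Suc.prems
    by (intro translate_bd) simp
  also have "translate_list (g (map fst w)) (lin (E (Suc k)) (bd_word e)) = lin (E (Suc k)) (bd_word w)"
    using lin_ext_translate[of "map fst w" "bd_word e" "Suc k"] bde Suc.prems
      translate_bd_word[of "map fst w" e] len w supp_mono[OF bde, of "\<lambda>u. length u = n"] by simp
  finally show ?case .
qed simp

text \<open>Write \<theta> = d H + H d. The first summand dies as a boundary. In the second,
  translations become invisible after trivialization, so the value depends only on the trivialized
  argument, and this is a boundary as well.\<close>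

lemma trivialize_theta:
  assumes "length w = n"
  shows "trivialize (\<theta> w) = 0"
proof -
  define k where "k = Suc (word_degree w)"
  have *: "trivialize (E k u) = trivialize (H k (map snd u))" if "length u = n" for u
    unfolding equivariant_ext_def
    by (rule trivialize_translate) (use supp_conjD[OF supp_homotopy[of "map snd u" k]] that length_g in simp)
  have "trivialize (lin (E k) (bd_word w)) = lin (\<lambda>u. trivialize (E k u)) (bd_word w)"
    by (simp add: trivialize_def lin_lin)
  also have "\<dots> = lin (\<lambda>u. trivialize (H k (map snd u))) (bd_word w)"
    by (rule lin_cong_supp[OF bd_word_supp]) (use * assms in simp)
  also have "\<dots> = lin (\<lambda>\<alpha>. trivialize (H k \<alpha>)) (trivialize (bd_word w))"
    by (simp add: trivialize_def lin_lin)
  finally show ?thesis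
    using homotopy_relation[OF assms, of k] by (simp add: k_def trivialize_bd trivialize_bd_word)
qed

end

lemma chain_map_unique:
  assumes "chain_map n g f1" "chain_map n g f2" "additive_on_lists n g" "length w = n"
  shows "trivialize (f1 w) = trivialize (f2 w)"
proof -
  interpret null_lift n g "\<lambda>w. f1 w - f2 w"
    using assms by unfold_locales (auto simp: chain_map_def lin_fun_diff intro: supp_diff)
  show ?thesis
    using trivialize_theta[OF assms(4)] by simp
qed

section \<open>The action on homology\<close>

definition mat_fun :: "'k::semiring_0 mat \<Rightarrow> 'k list \<Rightarrow> 'k list" where
  "mat_fun A v = list_of_vec (A *\<^sub>v vec_of_list v)"

lemma list_of_vec_add: "dim_vec u = dim_vec v \<Longrightarrow> list_of_vec (u + v) = map2 (+) (list_of_vec u) (list_of_vec v)"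
  by (intro nth_equalityI) (auto simp: list_of_vec_index)

lemma vec_of_list_add: "length u = length v \<Longrightarrow> vec_of_list (map2 (+) u v) = vec_of_list u + vec_of_list v"
  by (intro eq_vecI) (auto simp: vec_of_list_index)

lemma additive_mat_fun:
  assumes "A \<in> carrier_mat n n"
  shows "additive_on_lists n (mat_fun A)"
  using assms
  by (auto simp: additive_on_lists_def mat_fun_def vec_of_list_add list_of_vec_add
      mult_add_distrib_mat_vec[of A n n] carrier_vecI simp del: vec_of_list_map)

lemma chain_mapD:
  assumes "chain_map n g f" "length w = n"
  shows "f w \<in> supp (\<lambda>u. length u = n \<and> word_degree u = word_degree w)"
    and "lin f (bd_word w) = bd (f w)"
    and "augmentation (f w) = augmentation (word w)"
    and "length v = n \<Longrightarrow> f (translate_word v w) = translate_list (g v) (f w)"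
  using assms unfolding chain_map_def by blast+

lemma chain_map_cong:
  assumes "chain_map n g f" "\<And>v. length v = n \<Longrightarrow> g v = g' v"
  shows "chain_map n g' f"
  using assms by (simp add: chain_map_def)

lemma chain_map_lin:
  assumes "chain_map n g f"
  shows "x \<in> supp (\<lambda>w. length w = n \<and> word_degree w = k) \<Longrightarrow> lin f x \<in> supp (\<lambda>w. length w = n \<and> word_degree w = k)"
    and "x \<in> supp (\<lambda>w. length w = n) \<Longrightarrow> lin f (bd x) = bd (lin f x)"
    and "x \<in> supp (\<lambda>w. length w = n) \<Longrightarrow> augmentation (lin f x) = augmentation x"
    and "x \<in> supp (\<lambda>w. length w = n) \<Longrightarrow> length v = n \<Longrightarrow>
      lin f (translate_list v x) = translate_list (g v) (lin f x)"
proof -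
  assume x: "x \<in> supp (\<lambda>w. length w = n \<and> word_degree w = k)"
  show "lin f x \<in> supp (\<lambda>w. length w = n \<and> word_degree w = k)"
    by (rule supp_lin[OF x]) (use assms in \<open>auto simp: chain_map_def\<close>)
next
  assume x: "x \<in> supp (\<lambda>w. length w = n)"
  show "lin f (bd x) = bd (lin f x)"
    unfolding bd_def lin_lin
    by (rule lin_cong_supp[OF x]) (use assms in \<open>auto simp: chain_map_def bd_def\<close>)
  have "augmentation (lin f x) = augmentation (lin word x)"
    unfolding augmentation_lin using assms x by (intro sum.cong) (auto simp: chain_map_def supp_def)
  then show "augmentation (lin f x) = augmentation x"
    by simp
  show "lin f (translate_list v x) = translate_list (g v) (lin f x)" if "length v = n"
    unfolding translate_list_def lin_lin
    by (rule lin_cong_supp[OF x]) (use assms that in \<open>auto simp: chain_map_def translate_list_def\<close>)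
qed

lemma chain_map_compose:
  assumes "chain_map n g f" "chain_map n g' f'" "\<And>v. length v = n \<Longrightarrow> length (g' v) = n"
  shows "chain_map n (\<lambda>v. g (g' v)) (\<lambda>w. lin f (f' w))"
  unfolding chain_map_def
proof (intro allI impI conjI)
  fix w :: "'a cell"
  assume w: "length w = n"
  have f': "f' w \<in> supp (\<lambda>u. length u = n \<and> word_degree u = word_degree w)"
    using assms(2) w by (simp add: chain_map_def)
  note f'_len = supp_conjD[OF f']
  show "lin f (f' w) \<in> supp (\<lambda>u. length u = n \<and> word_degree u = word_degree w)"
    by (rule chain_map_lin(1)[OF assms(1) f'])
  have "lin (\<lambda>w. lin f (f' w)) (bd_word w) = lin f (lin f' (bd_word w))"
    by (simp add: lin_lin)
  also have "\<dots> = bd (lin f (f' w))"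
    using assms(2) w chain_map_lin(2)[OF assms(1) f'_len] by (simp add: chain_map_def)
  finally show "lin (\<lambda>w. lin f (f' w)) (bd_word w) = bd (lin f (f' w))" .
  show "augmentation (lin f (f' w)) = augmentation (word w)"
    using chain_map_lin(3)[OF assms(1) f'_len] assms(2) w by (simp add: chain_map_def)
  show "lin f (f' (translate_word v w)) = translate_list (g (g' v)) (lin f (f' w))" if "length v = n" for v
    using chain_map_lin(4)[OF assms(1) f'_len, of "g' v"] assms(2,3) w that by (simp add: chain_map_def)
qed

lemma lifts_of_chain_map:
  assumes "chain_map n (mat_fun A) f" "A \<in> carrier_mat n n"
  shows "lifts n A (lin f)"
  unfolding lifts_def resolution_supp resolution_degree_supp translate_eq
proof (intro conjI ballI allI)
  fix v :: "'a mod_ring vec" and x :: "'a resol"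
  assume "v \<in> carrier_vec n" "x \<in> supp (\<lambda>w. length w = n)"
  then show "lin f (translate_list (list_of_vec v) x) = translate_list (list_of_vec (A *\<^sub>v v)) (lin f x)"
    using chain_map_lin(4)[OF assms(1), of x "list_of_vec v"] by (simp add: mat_fun_def vec_list)
qed (use chain_map_lin[OF assms(1)] in auto)

text \<open>\<open>lifts\<close> constrains \<phi> on the resolution only and asks merely for
  additivity. Every scalar of the prime field is a natural multiple of 1, so \<phi> agrees there
  with the linear extension of its values on words.\<close>

lemma chain_map_of_lifts:
  assumes "lifts n A \<phi>"
  shows "chain_map n (mat_fun A) (\<lambda>w. \<phi> (word w))"
    and "x \<in> resolution n \<Longrightarrow> \<phi> x = lin (\<lambda>w. \<phi> (word w)) x"
proof -
  note L = assms[unfolded lifts_def resolution_supp resolution_degree_supp]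
  have zero: "\<phi> 0 = 0"
  proof -
    have "\<phi> (0 + 0) = \<phi> 0 + \<phi> 0"
      using L by (metis supp_zero)
    then show ?thesis by simp
  qed
  have of_nat: "\<phi> (of_nat m * x) = of_nat m * \<phi> x" if "x \<in> supp (\<lambda>w. length w = n)" for m x
  proof (induction m)
    case (Suc m)
    have "\<phi> (of_nat (Suc m) * x) = \<phi> (x + of_nat m * x)"
      by (simp add: distrib_right)
    also have "\<dots> = \<phi> x + \<phi> (of_nat m * x)"
      using L that supp_of_nat[OF that] by blast
    finally show ?case
      by (simp add: Suc distrib_right)
  qed (simp add: zero)
  have lin: "\<phi> x = lin (\<lambda>w. \<phi> (word w)) x" if "x \<in> supp (\<lambda>w. length w = n)" for x
    using that
  proof (induction x rule: supp_induct)
    case (single w c)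
    have "Poly_Mapping.single w c = of_nat (rep c) * word w"
      unfolding scalar_of_nat[symmetric] by (simp add: scalar_word)
    then show ?case
      using of_nat[of "word w" "rep c"] supp_single[of "\<lambda>w. length w = n" w 1] single by simp
  next
    case (add y z)
    then show ?case using L by simp
  qed (simp add: zero)
  then show "x \<in> resolution n \<Longrightarrow> \<phi> x = lin (\<lambda>w. \<phi> (word w)) x"
    by (simp add: resolution_supp)
  show "chain_map n (mat_fun A) (\<lambda>w. \<phi> (word w))"
    unfolding chain_map_def
  proof (intro allI impI conjI)
    fix w :: "'a cell"
    assume w: "length w = n"
    have word: "word w \<in> supp (\<lambda>u. length u = n)" "word w \<in> supp (\<lambda>u. length u = n \<and> word_degree u = word_degree w)"
      using w by (auto intro: supp_single)
    have bd_w: "bd_word w \<in> supp (\<lambda>u. length u = n)"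
      using supp_conjD[OF bd_word_supp[of w]] w by simp
    show "\<phi> (word w) \<in> supp (\<lambda>u. length u = n \<and> word_degree u = word_degree w)"
      using L word(2) by blast
    have "\<phi> (bd (word w)) = bd (\<phi> (word w))"
      using L word(1) by blast
    then show "lin (\<lambda>w. \<phi> (word w)) (bd_word w) = bd (\<phi> (word w))"
      using lin[OF bd_w] by simp
    show "augmentation (\<phi> (word w)) = augmentation (word w)"
      using L word(1) by blast
    show "\<phi> (word (translate_word v w)) = translate_list (mat_fun A v) (\<phi> (word w))" if "length v = n" for v
    proof -
      have "vec_of_list v \<in> carrier_vec n"
        using that by (simp add: carrier_vecI)
      then have "\<phi> (translate (vec_of_list v) (word w)) = translate (A *\<^sub>v vec_of_list v) (\<phi> (word w))"
        using L word(1) by blast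
      then show ?thesis
        by (simp add: translate_eq mat_fun_def list_vec)
    qed
  qed
qed

section \<open>The map that a lift induces on homology\<close>

definition induced :: "('p::prime_card cell \<Rightarrow> 'p resol) \<Rightarrow> nat list \<Rightarrow> 'p chains" where
  "induced f \<alpha> = trivialize (f (map (Pair 0) \<alpha>))"

text \<open>By equivariance the value at a cell is a translate of the value at the basis cell with
  the same degrees, and trivialization does not see the translation.\<close>

lemma trivialize_lin:
  assumes "chain_map n g f" "\<And>v. length v = n \<Longrightarrow> length (g v) = n" "x \<in> supp (\<lambda>w. length w = n)"
  shows "trivialize (lin f x) = lin (induced f) (trivialize x)"
proof -
  have "trivialize (f w) = induced f (map snd w)" if "length w = n" for w
  proof -
    let ?e = "map (Pair 0) (map snd w) :: 'a cell"
    have "f w = translate_list (g (map fst w)) (f ?e)"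
      using chain_mapD(4)[OF assms(1), of ?e "map fst w"] that unfolding translate_base by simp
    moreover have "f ?e \<in> supp (\<lambda>u. length u = length (g (map fst w)))"
    proof -
      have "f ?e \<in> supp (\<lambda>u. length u = n \<and> word_degree u = word_degree ?e)"
        using chain_mapD(1)[OF assms(1), of ?e] that by simp
      then show ?thesis
        using assms(2) that by (simp add: supp_conjD)
    qed
    ultimately show ?thesis
      by (simp add: trivialize_translate induced_def)
  qed
  then have "trivialize (lin f x) = lin (\<lambda>w. induced f (map snd w)) x"
    unfolding trivialize_def lin_lin by (intro lin_cong_supp[OF assms(3)]) (simp add: trivialize_def)
  then show ?thesis
    by (simp add: trivialize_def lin_lin)
qed

lemma bd_triv_zero: "bd_triv x = 0"
  by (simp add: bd_triv_def trivialize_bd_word)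

lemma range_bd_triv: "range bd_triv = {0}"
  by (auto simp: bd_triv_zero)

lemma hclass_eq: "hclass z = {z}"
  by (simp add: hclass_def range_bd_triv a_r_coset_def r_coset_def cycles_def)

text \<open>The description in \<open>gl_act\<close> is met by the given lift, applied to
  \<open>z\<close> with group parts 0. It has only one solution because homotopic lifts agree after
  trivialization, boundaries being 0 there.\<close>

lemma gl_act_eq:
  assumes A: "A \<in> carrier_mat n n" and f: "chain_map n (mat_fun A) f" and z: "z \<in> supp (\<lambda>\<alpha>. length \<alpha> = n)"
  shows "gl_act n A (hclass z) = hclass (lin (induced f) z)"
proof -
  have len: "length (mat_fun A v) = n" if "length v = n" for v
    using additive_mat_fun[OF A] that by (auto simp: additive_on_lists_def)
  define x :: "'a resol" where "x = lin (\<lambda>\<alpha>. word (map (Pair 0) \<alpha>)) z"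
  have x: "x \<in> supp (\<lambda>w. length w = n)"
    unfolding x_def by (rule supp_lin[OF z]) (simp add: supp_single)
  have triv_x: "trivialize x = z"
    by (simp add: x_def trivialize_def lin_lin o_def)
  have uniq: "hclass (trivialize (\<phi> y)) = hclass (lin (induced f) z)"
    if "lifts n A \<phi>" "y \<in> resolution n" "hclass z = hclass (trivialize y)" for \<phi> y
  proof -
    have y: "y \<in> supp (\<lambda>w. length w = n)" "trivialize y = z"
      using that by (simp_all add: resolution_supp hclass_eq)
    let ?f = "\<lambda>w. \<phi> (word w)"
    have "trivialize (\<phi> y) = lin (induced ?f) z"
      using chain_map_of_lifts(2)[OF that(1,2)] trivialize_lin[OF chain_map_of_lifts(1)[OF that(1)] len y(1)] y(2)
      by simp
    also have "\<dots> = lin (induced f) z"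
      by (rule lin_cong_supp[OF z])
        (simp add: induced_def chain_map_unique[OF chain_map_of_lifts(1)[OF that(1)] f additive_mat_fun[OF A]])
    finally show ?thesis by simp
  qed
  show ?thesis
    unfolding gl_act_def
  proof (rule the_equality)
    show "\<exists>\<phi> x. lifts n A \<phi> \<and> x \<in> resolution n \<and> trivialize x \<in> carrier cycles \<and>
        hclass z = hclass (trivialize x) \<and> hclass (lin (induced f) z) = hclass (trivialize (\<phi> x))"
      by (rule exI[of _ "lin f"], rule exI[of _ x])
        (use x triv_x lifts_of_chain_map[OF f A] trivialize_lin[OF f len x] in
          \<open>simp add: resolution_supp cycles_def bd_triv_zero\<close>)
  qed (use uniq in blast)
qed

subsection \<open>Extending a chain map by the identity\<close>

lemma length_add_split: "length w = i + m \<Longrightarrow> \<exists>u y. w = u @ y \<and> length u = i \<and> length y = m"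
  by (rule exI[of _ "take i w"], rule exI[of _ "drop i w"]) simp

lemma chain_map_prefix:
  assumes "chain_map m g f"
  shows "chain_map (i + m) (\<lambda>v. take i v @ g (drop i v)) (\<lambda>w. word (take i w) * f (drop i w))"
    (is "chain_map _ ?g ?f")
  unfolding chain_map_def
proof (intro allI impI)
  fix w :: "'a cell"
  assume "length w = i + m"
  with length_add_split[OF this] obtain u y where w: "w = u @ y" and u: "length u = i" and y: "length y = m"
    by blast
  have fy: "f y \<in> supp (\<lambda>z. length z = m \<and> word_degree z = word_degree y)" "lin f (bd_word y) = bd (f y)"
      "augmentation (f y) = augmentation (word y)"
      "\<And>v. length v = m \<Longrightarrow> f (translate_word v y) = translate_list (g v) (f y)"
    using assms y by (auto simp: chain_map_def)
  have fw: "?f w = word u * f y"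
    by (simp add: w u)
  have lin: "lin ?f (a * b) = a * lin f b" if "a \<in> supp (\<lambda>z. length z = i)" for a b
  proof -
    have "lin ?f (a * b) = lin word a * lin f b"
      using that by (intro lin_times) (auto simp: supp_def)
    then show ?thesis by simp
  qed
  have word_u: "word u \<in> supp (\<lambda>z. z = u)" "word u \<in> supp (\<lambda>z. word_degree z = word_degree u)"
    "(word u :: 'a resol) \<in> supp (\<lambda>z. length z = i)"
    using u by (auto intro: supp_single)
  have supp: "?f w \<in> supp (\<lambda>z. length z = i + m \<and> word_degree z = word_degree w)"
    unfolding fw by (rule supp_times[OF word_u(1) fy(1)]) (auto simp: w u)
  have "lin ?f (bd_word w) = bd_word u * lin f (word y) + (- 1) ^ word_degree u * (word u * lin f (bd_word y))"
    unfolding w bd_word_append mult.assoc lin_add lin_sign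
    using lin[OF supp_conjD[OF bd_word_supp[of u], unfolded u]] lin[OF word_u(3)] by simp
  also have "\<dots> = bd (?f w)"
    unfolding fw bd_times[OF word_u(2)] using fy(2) by (simp add: mult.assoc)
  finally have bd: "lin ?f (bd_word w) = bd (?f w)" .
  have aug: "augmentation (?f w) = augmentation (word w)"
    unfolding fw augmentation_times fy(3) unfolding w word_append augmentation_times ..
  have trans: "?f (translate_word v w) = translate_list (?g v) (?f w)" if len_v: "length v = i + m" for v
  proof -
    obtain v1 v2 where v: "v = v1 @ v2" and v1: "length v1 = i" and v2: "length v2 = m"
      using length_add_split[OF len_v] by blast
    have "?f (translate_word v w) = word (translate_word v1 u) * f (translate_word v2 y)"
      using v1 v2 u y by (simp add: v w translate_word_append)
    also have "\<dots> = translate_list (?g v) (?f w)"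
      using v1 v2 u word_u(3) translate_list_times[of "word u" v1 "g v2" "f y"] by (simp add: v w fy(4))
    finally show ?thesis .
  qed
  show "?f w \<in> supp (\<lambda>z. length z = i + m \<and> word_degree z = word_degree w) \<and>
      lin ?f (bd_word w) = bd (?f w) \<and> augmentation (?f w) = augmentation (word w) \<and>
      (\<forall>v. length v = i + m \<longrightarrow> ?f (translate_word v w) = translate_list (?g v) (?f w))"
    using supp bd aug trans by blast
qed

text \<open>The sign of the Leibniz rule comes from the degree of the left factor, which
  \<open>f\<close> preserves; no sign has to be inserted.\<close>

lemma chain_map_suffix:
  assumes "chain_map m g f" and g: "\<And>v. length v = m \<Longrightarrow> length (g v) = m"
  shows "chain_map (m + k) (\<lambda>v. g (take m v) @ drop m v) (\<lambda>w. f (take m w) * word (drop m w))"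
    (is "chain_map _ ?g ?f")
  unfolding chain_map_def
proof (intro allI impI)
  fix w :: "'a cell"
  assume "length w = m + k"
  with length_add_split[OF this] obtain y u where w: "w = y @ u" and u: "length u = k" and y: "length y = m"
    by blast
  have fy: "f y \<in> supp (\<lambda>z. length z = m \<and> word_degree z = word_degree y)" "lin f (bd_word y) = bd (f y)"
      "augmentation (f y) = augmentation (word y)"
      "\<And>v. length v = m \<Longrightarrow> f (translate_word v y) = translate_list (g v) (f y)"
    using assms(1) y by (auto simp: chain_map_def)
  have fw: "?f w = f y * word u"
    by (simp add: w y)
  have lin: "lin ?f (a * b) = lin f a * b" if "a \<in> supp (\<lambda>z. length z = m)" for a b
  proof -
    have "lin ?f (a * b) = lin f a * lin word b"
      using that by (intro lin_times) (auto simp: supp_def)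
    then show ?thesis by simp
  qed
  have word_u: "word u \<in> supp (\<lambda>z. z = u)" and word_y: "word y \<in> supp (\<lambda>z. length z = m)"
    using y by (auto intro: supp_single)
  have supp: "?f w \<in> supp (\<lambda>z. length z = m + k \<and> word_degree z = word_degree w)"
    unfolding fw by (rule supp_times[OF fy(1) word_u]) (auto simp: w u)
  have deg: "f y \<in> supp (\<lambda>z. word_degree z = word_degree y)"
    by (rule supp_mono[OF fy(1)]) simp
  have "lin ?f (bd_word w) = lin f (bd_word y) * word u + (- 1) ^ word_degree y * (lin f (word y) * bd_word u)"
    unfolding w bd_word_append mult.assoc lin_add lin_sign
    using lin[OF supp_conjD[OF bd_word_supp[of y], unfolded y]] lin[OF word_y] by simp
  also have "\<dots> = bd (?f w)"
    unfolding fw bd_times[OF deg] using fy(2) by (simp add: mult.assoc)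
  finally have bd: "lin ?f (bd_word w) = bd (?f w)" .
  have aug: "augmentation (?f w) = augmentation (word w)"
    unfolding fw augmentation_times fy(3) unfolding w word_append augmentation_times ..
  have trans: "?f (translate_word v w) = translate_list (?g v) (?f w)" if len_v: "length v = m + k" for v
  proof -
    obtain v1 v2 where v: "v = v1 @ v2" and v1: "length v1 = m" and v2: "length v2 = k"
      using length_add_split[OF len_v] by blast
    have "?f (translate_word v w) = f (translate_word v1 y) * word (translate_word v2 u)"
      using v1 v2 u y by (simp add: v w translate_word_append)
    also have "\<dots> = translate_list (?g v) (?f w)"
      using v1 v2 y u g[OF v1] supp_conjD[OF fy(1)] translate_list_times[of "f y" "g v1" v2 "word u"]
      by (simp add: v w fy(4))
    finally show ?thesis .
  qed
  show "?f w \<in> supp (\<lambda>z. length z = m + k \<and> word_degree z = word_degree w) \<and>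
      lin ?f (bd_word w) = bd (?f w) \<and> augmentation (?f w) = augmentation (word w) \<and>
      (\<forall>v. length v = m + k \<longrightarrow> ?f (translate_word v w) = translate_list (?g v) (?f w))"
    using supp bd aug trans by blast
qed

definition extend_map :: "nat \<Rightarrow> nat \<Rightarrow> ('k list \<Rightarrow> 'k list) \<Rightarrow> 'k list \<Rightarrow> 'k list" where
  "extend_map i m g v = take i v @ g (take m (drop i v)) @ drop (i + m) v"

definition extend_chain_map :: "nat \<Rightarrow> nat \<Rightarrow> ('p::prime_card cell \<Rightarrow> 'p resol) \<Rightarrow>
    'p cell \<Rightarrow> 'p resol" where
  "extend_chain_map i m f w = word (take i w) * (f (take m (drop i w)) * word (drop (i + m) w))"

lemma chain_map_extend:
  assumes "chain_map m g f" "\<And>v. length v = m \<Longrightarrow> length (g v) = m" "i + m \<le> n"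
  shows "chain_map n (extend_map i m g) (extend_chain_map i m f)"
proof -
  obtain k where n: "n = i + (m + k)"
    using assms(3) by (metis add.assoc le_iff_add)
  have "extend_map i m g = (\<lambda>v. take i v @ g (take m (drop i v)) @ drop m (drop i v))"
    by (rule ext) (simp add: extend_map_def add.commute)
  moreover have "extend_chain_map i m f = (\<lambda>w. word (take i w) * (f (take m (drop i w)) * word (drop m (drop i w))))"
    by (rule ext) (simp add: extend_chain_map_def add.commute)
  ultimately show ?thesis
    using chain_map_prefix[OF chain_map_suffix[OF assms(1,2)], of i k] by (simp add: n)
qed

lemma induced_extend:
  assumes "length u = i" "length \<alpha> = m"
  shows "induced (extend_chain_map i m f) (u @ \<alpha> @ v) = word u * induced f \<alpha> * word v"
  using assms by (simp add: induced_def extend_chain_map_def mult.assoc o_def)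

section \<open>Generators of the general linear groups\<close>

text \<open>Row reduction read backwards: a property of the identity matrix that is reflected by
  each elementary row operation holds for every matrix that reduces to the identity.\<close>

lemma gauss_jordan_main_induct:
  fixes A :: "'k::field mat"
  assumes "A \<in> carrier_mat n n" "B \<in> carrier_mat n m" "fst (gauss_jordan_main A B i j) = 1\<^sub>m n" "P (1\<^sub>m n)"
    and swap: "\<And>A k l. A \<in> carrier_mat n n \<Longrightarrow> k < n \<Longrightarrow> l < n \<Longrightarrow> P (swaprows k l A) \<Longrightarrow> P A"
    and scale: "\<And>A k c. A \<in> carrier_mat n n \<Longrightarrow> k < n \<Longrightarrow> c \<noteq> 0 \<Longrightarrow> P (multrow k c A) \<Longrightarrow> P A"
    and shear: "\<And>A k l c. A \<in> carrier_mat n n \<Longrightarrow> k < n \<Longrightarrow> l < n \<Longrightarrow> k \<noteq> l \<Longrightarrow> P (addrow c k l A) \<Longrightarrow> P A"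
  shows "P A"
  using assms(1-3)
proof (induction A B i j rule: gauss_jordan_main.induct)
  case (1 A B i j)
  have dim: "dim_row A = n" "dim_col A = n"
    using 1(5) by auto
  note IH = 1(1-4)[OF dim[symmetric]]
  note simp = gauss_jordan_main.simps[of A B i j] Let_def
  show ?case
  proof (cases "i < n \<and> j < n")
    case False
    then show ?thesis
      using 1(7) \<open>P (1\<^sub>m n)\<close> unfolding simp dim by (simp only: if_False fst_conv)
  next
    case valid: True
    note IH = IH[OF valid refl]
    show ?thesis
    proof (cases "A $$ (i, j) = 0")
      case True
      show ?thesis
      proof (cases "[i' . i' <- [Suc i ..< n], A $$ (i', j) \<noteq> 0]")
        case Nil
        with IH(1)[OF True Nil 1(5,6)] 1(7) valid True show ?thesis
          by (simp add: simp dim)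
      next
        case (Cons i' xs)
        then have "i' \<in> set [i' . i' <- [Suc i ..< n], A $$ (i', j) \<noteq> 0]" by simp
        then have "i' < n" by auto
        moreover have "P (swaprows i i' A)"
          using IH(2)[OF True Cons] 1(5-7) valid True Cons by (simp add: simp dim)
        ultimately show ?thesis
          using swap[OF 1(5), of i i'] valid by blast
      qed
    next
      case nZ: False
      show ?thesis
      proof (cases "A $$ (i, j) = 1")
        case False
        have "P (multrow i (inverse (A $$ (i, j))) A)"
          using IH(4)[OF nZ False refl] 1(5-7) valid nZ False by (simp add: simp dim)
        then show ?thesis
          using scale[OF 1(5), of i "inverse (A $$ (i, j))"] valid nZ by simp
      next
        case True
        \<comment> \<open>The pivot is 1 by now. Column \<open>j\<close> is cleared one row at a
          time, and each pair holds the multiple of the pivot row and the row to which it is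
          added.\<close>
        let ?is = "map (\<lambda>i'. (- A $$ (i', j), i')) (filter (\<lambda>i'. i' \<noteq> i) [0 ..< n])"
        have e1: "P (eliminate_entries (\<lambda>i. A $$ (i, j)) A i j)"
          using IH(3)[OF nZ True refl carrier_eliminate_entries(1)[OF 1(5)] carrier_eliminate_entries(1)[OF 1(6)]]
            1(7) valid nZ True by (simp add: simp dim)
        have e2: "eliminate_entries (\<lambda>i. A $$ (i, j)) A i j = eliminate_entries_rec A i ?is"
          using eliminate_entries_convert[of j A i A] valid dim by simp
        have e3: "P (eliminate_entries_rec C i xs) \<Longrightarrow> P C"
          if "C \<in> carrier_mat n n" "\<forall>(c, k) \<in> set xs. k < n \<and> k \<noteq> i" for C :: "'k mat" and xs
          using that
        proof (induction xs arbitrary: C)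
          case (Cons x xs)
          obtain c k where x: "x = (c, k)" by force
          have "P (addrow c k i C)"
            by (rule Cons.IH) (use Cons.prems x in auto)
          then show ?case
            using shear[of C k i c] Cons.prems valid x by auto
        qed simp
        show ?thesis
          by (rule e3[of A ?is]) (use e1 e2 1(5) in auto)
      qed
    qed
  qed
qed

lemma invertible_mat_Units:
  assumes "A \<in> carrier_mat n n" "invertible_mat A"
  shows "A \<in> Units (ring_mat TYPE('k::field) n b)"
proof -
  obtain B where B: "A * B = 1\<^sub>m (dim_row A)" "B * A = 1\<^sub>m (dim_row B)"
    using assms(2) by (auto simp: invertible_mat_def inverts_mat_def)
  have "dim_row B = n"
    using assms(1) B(2) by (metis carrier_matD(2) index_mult_mat(3) index_one_mat(3))
  moreover have "dim_col B = n"
    using assms(1) B(1) by (metis carrier_matD(1) index_mult_mat(3) index_one_mat(3))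
  ultimately show ?thesis
    using assms(1) B by (auto simp: Units_def ring_mat_def intro!: bexI[of _ B])
qed

text \<open>Arbitrary interchanges are conjugates of adjacent ones, every shear with coefficient 1
  is a conjugate by interchanges of the one that adds row 0 to row 1, and other coefficients arise
  by conjugation with a dilation. Gauss-Jordan elimination does the rest.\<close>

lemma general_linear_generated:
  fixes M :: "'k::field mat set"
  assumes A: "A \<in> carrier_mat n n" "invertible_mat A"
    and closed: "\<And>X Y. X \<in> M \<Longrightarrow> Y \<in> M \<Longrightarrow> X * Y \<in> M"
    and carrier: "M \<subseteq> carrier_mat n n" and one: "1\<^sub>m n \<in> M"
    and multrow: "\<And>k c. k < n \<Longrightarrow> c \<noteq> 0 \<Longrightarrow> multrow_mat n k c \<in> M"
    and swaprows: "\<And>k. Suc k < n \<Longrightarrow> swaprows_mat n k (Suc k) \<in> M"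
    and addrow: "\<And>k. Suc k < n \<Longrightarrow> addrow_mat n 1 (Suc k) k \<in> M"
  shows "A \<in> M"
proof -
  have sw: "swaprows_mat n k l * X = swaprows k l X" if "X \<in> carrier_mat n n" "k < n" "l < n"
    for X :: "'k mat" and k l
    using swaprows_mat[OF that] by simp
  have ad: "addrow_mat n c k l * X = addrow c k l X" if "X \<in> carrier_mat n n" "l < n"
    for X :: "'k mat" and c k l
    using addrow_mat[OF that] by simp
  have mu: "multrow_mat n k c * X = multrow k c X" if "X \<in> carrier_mat n n" for X :: "'k mat" and k c
    using multrow_mat[OF that] by simp
  have swap_sym: "swaprows_mat n k l = (swaprows_mat n l k :: 'k mat)" for k l
    by (rule eq_matI) auto
  have swap_less: "swaprows_mat n k l \<in> M" if "k < l" "l < n" for k l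
    using that
  proof (induction l)
    case (Suc l)
    show ?case
    proof (cases "k = l")
      case False
      have "swaprows_mat n l (Suc l) * (swaprows_mat n k l * swaprows_mat n l (Suc l)) =
          swaprows l (Suc l) (swaprows k l (swaprows_mat n l (Suc l) :: 'k mat))"
        using Suc.prems False by (simp add: sw)
      also have "\<dots> = swaprows_mat n k (Suc l)"
        using Suc.prems False by (intro eq_matI) auto
      finally show ?thesis
        using Suc swaprows[of l] closed False by (metis Suc_lessD less_antisym)
    qed (use Suc.prems swaprows in simp)
  qed simp
  have "swaprows_mat n k k = (1\<^sub>m n :: 'k mat)" for k
    by (rule eq_matI) auto
  then have swap: "swaprows_mat n k l \<in> M" if "k < n" "l < n" for k l
    using swap_less[of k l] swap_less[of l k] swap_sym[of k l] that one
    by (cases k l rule: linorder_cases) auto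
  have conj: "swaprows_mat n x y * (X * swaprows_mat n x y) \<in> M"
    if "x < n" "y < n" "X \<in> M" for x y X
    using that closed swap by blast
  have prod: "swaprows_mat n x y * (addrow_mat n c k l * swaprows_mat n x y) =
      swaprows x y (addrow c k l (swaprows_mat n x y :: 'k mat))"
    if "x < n" "y < n" "l < n" for x y c k l
    using that by (simp add: sw ad)
  \<comment> \<open>The shear from row 0 to row 1 is conjugated by the interchange of 1 and
    \<open>k\<close>. Other source rows then follow by an interchange that involves 0.\<close>
  have add0: "addrow_mat n 1 k 0 \<in> M" if "0 < k" "k < n" for k
  proof (cases "k = 1")
    case False
    have "swaprows 1 k (addrow 1 1 0 (swaprows_mat n 1 k :: 'k mat)) = addrow_mat n 1 k 0"
      using that False by (intro eq_matI) auto
    then show ?thesis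
      using conj[of 1 k "addrow_mat n 1 1 0"] prod[of 1 k 0 1 1] addrow[of 0] that False by auto
  qed (use addrow[of 0] that in simp)
  have add1: "addrow_mat n 1 k l \<in> M" if kl: "k < n" "l < n" "k \<noteq> l" for k l
  proof (cases "l = 0")
    case True
    then show ?thesis using add0[of k] kl by simp
  next
    case l: False
    show ?thesis
    proof (cases "k = 0")
      case True
      have "swaprows 0 l (addrow 1 l 0 (swaprows_mat n 0 l :: 'k mat)) = addrow_mat n 1 0 l"
        using kl l by (intro eq_matI) auto
      then show ?thesis
        using conj[of 0 l "addrow_mat n 1 l 0"] prod[of 0 l 0 1 l] add0[of l] kl l True by auto
    next
      case False
      have "swaprows 0 l (addrow 1 k 0 (swaprows_mat n 0 l :: 'k mat)) = addrow_mat n 1 k l"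
        using kl l False by (intro eq_matI) auto
      then show ?thesis
        using conj[of 0 l "addrow_mat n 1 k 0"] prod[of 0 l 0 1 k] add0[of k] kl l False by auto
    qed
  qed
  have add: "addrow_mat n c k l \<in> M" if kl: "k < n" "l < n" "k \<noteq> l" for c k l
  proof (cases "c = 0")
    case True
    have "addrow_mat n c k l = 1\<^sub>m n"
      using True by (intro eq_matI) auto
    then show ?thesis using one by simp
  next
    case False
    have "multrow_mat n l (inverse c) * (addrow_mat n 1 k l * multrow_mat n l c) =
        multrow l (inverse c) (addrow 1 k l (multrow_mat n l c))"
      using kl by (simp add: mu ad)
    also have "\<dots> = addrow_mat n c k l"
      using kl False by (intro eq_matI) auto
    finally show ?thesis
      using multrow[of l c] multrow[of l "inverse c"] kl False
        closed[OF _ closed[OF add1[OF kl]], of "multrow_mat n l (inverse c)" "multrow_mat n l c"] by simp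
  qed
  \<comment> \<open>\<open>M\<close> is only known to be closed under products, so a row operation
    \<open>Y\<close> is undone by a left inverse \<open>Z\<close> that is itself elementary.\<close>
  have inv: "X \<in> M" if "Y * X \<in> M" "Z \<in> M" "Z * Y = 1\<^sub>m n" "X \<in> carrier_mat n n" "Y \<in> carrier_mat n n" for X Y Z
  proof -
    have "Z * (Y * X) = X"
      using assoc_mult_mat[of Z n n Y n X n] that carrier by auto
    then show ?thesis
      using closed[OF that(2,1)] by simp
  qed
  have "A \<in> Units (ring_mat TYPE('k) n ())"
    by (rule invertible_mat_Units[OF A])
  then have "fst (gauss_jordan_main A (0\<^sub>m n n) 0 0) = 1\<^sub>m n"
    using gauss_jordan_inverse_other_direction[of A n "()" "0\<^sub>m n n" n] by (simp add: gauss_jordan_def)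
  then show "A \<in> M"
  proof (rule gauss_jordan_main_induct[where P = "\<lambda>A. A \<in> M", OF A(1) zero_carrier_mat _ one])
    fix X :: "'k mat" and k l
    assume "X \<in> carrier_mat n n" "k < n" "l < n" "swaprows k l X \<in> M"
    then show "X \<in> M"
      using inv[of "swaprows_mat n k l" X "swaprows_mat n k l"] swap[of k l] swaprows_mat_inv[of k n l]
        swaprows_mat[of X n n k l]
      by auto
  next
    fix X :: "'k mat" and k c
    assume "X \<in> carrier_mat n n" "k < n" "c \<noteq> 0" "multrow k c X \<in> M"
    then show "X \<in> M"
      using inv[of "multrow_mat n k c" X "multrow_mat n k (inverse c)"] multrow[of k "inverse c"]
        multrow_mat_inv[of k n "inverse c"] multrow_mat[of X n n k c] by auto
  next
    fix X :: "'k mat" and k l c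
    assume "X \<in> carrier_mat n n" "k < n" "l < n" "k \<noteq> l" "addrow c k l X \<in> M"
    then show "X \<in> M"
      using inv[of "addrow_mat n c k l" X "addrow_mat n (- c) k l"] add[of k l "- c"]
        addrow_mat_inv[of k n l "- c"] addrow_mat[of X n n l c k] by auto
  qed
qed

section \<open>Chain maps for the generators of the general linear groups\<close>

lemma chain_mapI:
  assumes "\<And>w. length w = n \<Longrightarrow> f w \<in> supp (\<lambda>u. length u = n \<and> word_degree u = word_degree w)"
    and "\<And>w. length w = n \<Longrightarrow> lin f (bd_word w) = bd (f w)"
    and "\<And>w. length w = n \<Longrightarrow> augmentation (f w) = augmentation (word w)"
    and "\<And>v w. length w = n \<Longrightarrow> length v = n \<Longrightarrow> f (translate_word v w) = translate_list (g v) (f w)"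
  shows "chain_map n g f"
  using assms by (simp add: chain_map_def)

lemma trivialize_constant [simp]: "trivialize (scalar c) = scalar c"
  by (simp add: trivialize_def lin_single)

lemma augmentation_word: "augmentation (word w) = (if word_degree w = 0 then 1 else 0)"
  by (simp add: augmentation_single)

lemma augmentation_of_degree:
  assumes "x \<in> supp (\<lambda>u. word_degree u = k)" "k \<noteq> 0"
  shows "augmentation x = 0"
  using assms by (auto simp: augmentation_def supp_def)

lemma length_1E:
  assumes "length w = 1"
  obtains x where "w = [x]"
  using assms by (cases w) auto

lemma length_2E:
  assumes "length w = 2"
  obtains x y where "w = [x, y]"
  using assms by (auto simp: numeral_2_eq_2 length_Suc_conv)

subsection \<open>Multiplication by a scalar\<close>

text \<open>The group map is t \<mapsto> t^c. As t^c - 1 = (t - 1) (1 + ... + t^(c-1)), the cell e_1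
  goes to this partial sum times e_1. The norm times the partial sum is c times the norm, so each
  further pair of degrees contributes one factor c.\<close>

definition dilation :: "'p::prime_card mod_ring \<Rightarrow> 'p cell \<Rightarrow> 'p resol" where
  "dilation c w = (case hd w of (a, k) \<Rightarrow> scalar (c ^ (k div 2)) *
     (if even k then word [(c * a, k)] else \<Sum>j<rep c. word [(c * a + of_nat j, k)]))"

lemma chain_map_dilation:
  fixes c :: "'p::prime_card mod_ring"
  assumes c: "c \<noteq> 0"
  shows "chain_map 1 (map ((*) c)) (dilation c)"
proof (rule chain_mapI)
  fix w :: "'p cell"
  assume "length w = 1"
  then obtain a k where w: "w = [(a, k)]"
    by (metis length_1E surj_pair)
  show supp: "dilation c w \<in> supp (\<lambda>u. length u = 1 \<and> word_degree u = word_degree w)"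
    by (auto simp: w dilation_def intro!: supp_scalar supp_sum supp_single)
  show "augmentation (dilation c w) = augmentation (word w)"
  proof (cases "k = 0")
    case False
    have "dilation c w \<in> supp (\<lambda>u. word_degree u = k)"
      by (rule supp_mono[OF supp]) (simp add: w)
    with False show ?thesis
      by (simp add: augmentation_of_degree augmentation_word w)
  qed (simp add: w dilation_def augmentation_word)
  show "dilation c (translate_word v w) = translate_list (map ((*) c) v) (dilation c w)" if len_v: "length v = 1" for v
  proof -
    obtain g where "v = [g]"
      using len_v by (rule length_1E)
    then show ?thesis
      by (simp add: w dilation_def translate_list_sum distrib_left add.assoc)
  qed
  show "lin (dilation c) (bd_word w) = bd (dilation c w)"
  proof (cases k)
    case (Suc i)
    show ?thesis
    proof (cases "even i")
      case True
      have "(\<Sum>j<rep c. word [(1 + (c * a + of_nat j), i)] - word [(c * a + of_nat j, i)]) =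
          (word [(c + c * a, i)] - word [(c * a, i)] :: 'p resol)"
        using sum_lessThan_telescope[of "\<lambda>j. word [(c * a + of_nat j, i)] :: 'p resol" "rep c"] by (simp add: ac_simps)
      then show ?thesis
        using True by (simp add: w Suc dilation_def bd_sum distrib_left right_diff_distrib add.assoc add.commute[of _ 1])
    next
      case False
      \<comment> \<open>As \<open>c\<close> is a unit, x \<mapsto> c x + j permutes the group. Each
        of the \<open>rep c\<close> inner sums is therefore a full norm, and together they give the
        scalar \<open>c\<close>.\<close>
      have "(\<Sum>x\<in>UNIV. word [(c * x + of_nat j, i)]) = (\<Sum>x\<in>UNIV. word [(x, i)] :: 'p resol)" for j
        by (rule sum.reindex_bij_betw[of "\<lambda>x. c * x + of_nat j" UNIV UNIV "\<lambda>x. word [(x, i)]"])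
          (rule bij_betw_byWitness[where f' = "\<lambda>x. (x - of_nat j) / c"], use c in auto)
      then have "(\<Sum>x\<in>UNIV. \<Sum>j<rep c. word [(c * x + of_nat j, i)]) = of_nat (rep c) * (\<Sum>x\<in>UNIV. word [(x, i)] :: 'p resol)"
        by (subst sum.swap) simp
      also have "\<dots> = scalar c * (\<Sum>x\<in>UNIV. word [(x, i)])"
        by (simp add: scalar_of_nat[symmetric])
      finally have *: "(\<Sum>x\<in>UNIV. \<Sum>j<rep c. word [(c * x + of_nat j, i)]) =
          (scalar c * (\<Sum>x\<in>UNIV. word [(x, i)]) :: 'p resol)" .
      have "lin (dilation c) (bd_word w) = scalar (c ^ (i div 2)) *
          (\<Sum>x\<in>UNIV. \<Sum>j<rep c. word [(c * x + of_nat j, i)])"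
        using False by (simp add: w Suc lin_sum dilation_def sum_distrib_left)
      also have "\<dots> = bd (dilation c w)"
        unfolding * using False by (simp add: w Suc dilation_def scalar_mult mult.commute)
      finally show ?thesis .
    qed
  qed (simp add: w dilation_def)
qed

lemma induced_dilation:
  "induced (dilation c) [k] = scalar (c ^ ((k + 1) div 2)) * word [k]"
proof (cases "even k")
  case False
  have "trivialize (\<Sum>j<rep c. word [(of_nat j, k)]) = scalar c * word [k]"
    by (simp add: trivialize_sum scalar_of_nat[symmetric])
  with False show ?thesis
    by (simp add: induced_def dilation_def scalar_mult mult.commute)
qed (simp add: induced_def dilation_def)

subsection \<open>Interchange of two coordinates\<close>

definition interchange :: "'p::prime_card cell \<Rightarrow> 'p resol" where
  "interchange w = (- 1) ^ (snd (w ! 0) * snd (w ! 1)) * word (rev w)"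

lemma chain_map_interchange: "chain_map 2 rev (interchange :: 'p::prime_card cell \<Rightarrow> _)"
proof (rule chain_mapI)
  fix w :: "'p cell"
  assume "length w = 2"
  then obtain x y where w: "w = [x, y]" by (rule length_2E)
  show "interchange w \<in> supp (\<lambda>u. length u = 2 \<and> word_degree u = word_degree w)"
    by (auto simp: w interchange_def intro!: supp_sign supp_single)
  show "augmentation (interchange w) = augmentation (word w)"
  proof (cases "snd x * snd y = 0")
    case False
    then show ?thesis
      by (simp add: w interchange_def scalar_minus_one_power augmentation_word)
  qed (auto simp: w interchange_def augmentation_word)
  show "interchange (translate_word v w) = translate_list (rev v) (interchange w)" if "length v = 2" for v
    using that by (elim length_2E) (simp add: w interchange_def)
  have 1: "lin interchange (z * word [y]) = (- 1) ^ (k * snd y) * (word [y] * z)"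
    if "z \<in> supp (\<lambda>u. length u = 1 \<and> word_degree u = k)" for z k
    using that
  proof (induction z rule: supp_induct)
    case (single u c)
    then obtain t where u: "u = [t]" "snd t = k" by (auto simp: length_Suc_conv)
    show ?case
      unfolding u(1) scalar_word[of c "[t]", symmetric] mult.assoc lin_scalar word_append[symmetric]
      using u by (simp add: interchange_def scalar_left_commute[of "word [y]"] word_append[symmetric] sign_left_commute[of "scalar c"])
  qed (simp_all add: algebra_simps)
  have 2: "lin interchange (word [x] * z) = (- 1) ^ (snd x * k) * (z * word [x])"
    if "z \<in> supp (\<lambda>u. length u = 1 \<and> word_degree u = k)" for z k
    using that
  proof (induction z rule: supp_induct)
    case (single u c)
    then obtain t where u: "u = [t]" "snd t = k" by (auto simp: length_Suc_conv)
    show ?case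
      unfolding u(1) scalar_word[of c "[t]", symmetric] mult.assoc lin_scalar scalar_left_commute[of "word [x]"] word_append[symmetric]
      using u by (simp add: interchange_def word_append[symmetric] sign_left_commute[of "scalar c"])
  qed (simp_all add: algebra_simps)
  \<comment> \<open>The truncated subtraction is harmless: in degree 0 the boundary is 0 and lies in
    every support.\<close>
  have deg: "bd_letter z \<in> supp (\<lambda>u. length u = 1 \<and> word_degree u = snd z - 1)" for z :: "'p mod_ring \<times> nat"
    by (rule supp_mono[OF bd_letter_supp]) auto
  have zero: "bd_letter z = 0" if "snd z = 0" for z :: "'p mod_ring \<times> nat"
    using that by (cases z) simp
  have interchange_w: "interchange w = (- 1) ^ (snd x * snd y) * word [y, x]"
    by (simp add: w interchange_def)
  have "lin interchange (bd_word w) = (- 1) ^ ((snd x - 1) * snd y) * (word [y] * bd_letter x)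
      + (- 1) ^ snd x * ((- 1) ^ (snd x * (snd y - 1)) * (bd_letter y * word [x]))"
    by (simp add: w mult.assoc 1[OF deg] 2[OF deg])
  \<comment> \<open>For k > 0 the lost degree is accounted for by (-1)^((k-1) l) = (-1)^(k l)
    (-1)^l. For k = 0 the truncated exponent is not the right one, but the boundary is 0. The same
    is done for \<open>y\<close> below.\<close>
  also have "(- 1) ^ ((snd x - 1) * snd y) * (word [y] * bd_letter x) =
      (- 1) ^ (snd x * snd y) * ((- 1) ^ snd y * (word [y] * bd_letter x))"
  proof (cases "snd x")
    case (Suc m)
    have "(- 1) ^ (snd x * snd y) * (- 1) ^ snd y = ((- 1) ^ (m * snd y) :: 'p resol)"
      by (simp add: Suc power_add minus_one_power_iff)
    then show ?thesis
      by (simp only: Suc diff_Suc_1 mult.assoc[symmetric])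
  qed (simp add: zero)
  also have "(- 1) ^ snd x * ((- 1) ^ (snd x * (snd y - 1)) * (bd_letter y * word [x])) =
      (- 1) ^ (snd x * snd y) * (bd_letter y * word [x])"
  proof (cases "snd y")
    case (Suc m)
    then show ?thesis by (simp add: power_add mult.assoc)
  qed (simp add: zero)
  finally show "lin interchange (bd_word w) = bd (interchange w)"
    unfolding interchange_w by (simp add: distrib_left mult.assoc add.commute)
qed

lemma induced_interchange: "induced interchange [k, l] = (- 1) ^ (k * l) * word [l, k]"
  by (simp add: induced_def interchange_def scalar_minus_one_power)

subsection \<open>Shear\<close>

text \<open>The resolution of \<open>\<pi>\<close> is the free algebra over the group ring on an exterior class
  \<open>e\<close> and a divided power class \<open>\<gamma>\<close>, with \<open>e_{2i + \<epsilon>} = e^\<epsilon> \<gamma>_i\<close>. On \<open>V_2\<close>, with second classes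
  \<open>f\<close> and \<open>\<delta>\<close> and group elements \<open>t\<close> and \<open>u\<close>, the shear \<open>t \<mapsto> t u\<close> lifts to the map of divided
  power algebras \<open>e \<mapsto> e + t f\<close>, \<open>\<gamma> \<mapsto> \<gamma> + \<delta> + c e f\<close>, where
  \<open>c = - (\<Sum>r<p. \<Sum>m<r. t^r u^m)\<close>. The following sum is \<open>e^\<epsilon> (\<gamma> + \<delta>)_i f^\<eta> \<delta>_l\<close>, translated by
  \<open>(a, b)\<close>.\<close>

definition shear_sum :: "nat \<Rightarrow> nat \<Rightarrow> nat \<Rightarrow> nat \<Rightarrow> 'p::prime_card mod_ring \<Rightarrow> 'p mod_ring \<Rightarrow> 'p resol" where
  "shear_sum \<epsilon> \<eta> i l a b = (\<Sum>j\<le>i. of_nat ((i - j + l) choose l) *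
     word [(a, 2 * j + \<epsilon>), (b, 2 * (i - j + l) + \<eta>)])"

text \<open>Since e^2 = f^2 = 0, the correction c e f is killed by every exterior factor and occurs
  only on \<gamma>_i \<delta>_l. There it enters just once, as c e f (\<gamma> + \<delta>)_{i-1}
  \<delta>_l, because (e f)^2 = 0. In the case of e \<gamma>_i \<delta>_l the shifted summand is the
  part t f of the image of e.\<close>

definition shear :: "'p::prime_card cell \<Rightarrow> 'p resol" where
  "shear w = (let a = fst (w ! 0); b = a + fst (w ! 1); i = snd (w ! 0) div 2; l = snd (w ! 1) div 2 in
     if even (snd (w ! 0)) then
       if even (snd (w ! 1)) then shear_sum 0 0 i l a b -
         (case i of 0 \<Rightarrow> 0 | Suc i' \<Rightarrow> \<Sum>r<CARD('p). \<Sum>m<r. shear_sum 1 1 i' l (a + of_nat r) (b + of_nat m))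
       else shear_sum 0 1 i l a b
     else
       if even (snd (w ! 1)) then shear_sum 1 0 i l a b + shear_sum 0 1 i l (a + 1) b
       else shear_sum 1 1 i l a b)"

lemma shear_simps:
  fixes a b :: "'p::prime_card mod_ring"
  shows "shear [(a, 2 * i), (b, 2 * l)] = shear_sum 0 0 i l a (a + b) -
      (case i of 0 \<Rightarrow> 0 | Suc i' \<Rightarrow> \<Sum>r<CARD('p). \<Sum>m<r. shear_sum 1 1 i' l (a + of_nat r) (a + b + of_nat m))"
    and "shear [(a, 2 * i), (b, Suc (2 * l))] = shear_sum 0 1 i l a (a + b)"
    and "shear [(a, Suc (2 * i)), (b, 2 * l)] = shear_sum 1 0 i l a (a + b) + shear_sum 0 1 i l (a + 1) (a + b)"
    and "shear [(a, Suc (2 * i)), (b, Suc (2 * l))] = shear_sum 1 1 i l a (a + b)"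
  by (simp_all add: shear_def Let_def)

lemma translate_shear_sum: "translate_list [g, h] (shear_sum \<epsilon> \<eta> i l a b) = shear_sum \<epsilon> \<eta> i l (g + a) (h + b)"
  by (simp add: shear_sum_def translate_list_sum scalar_of_nat[symmetric])

lemma shear_sum_supp:
  assumes "2 * (i + l) + \<epsilon> + \<eta> = k"
  shows "shear_sum \<epsilon> \<eta> i l a b \<in> supp (\<lambda>u. length u = 2 \<and> word_degree u = k)"
  unfolding shear_sum_def using assms by (intro supp_sum supp_of_nat supp_single) auto

lemma bd_of_nat [simp]: "bd (of_nat m * x) = of_nat m * bd x"
  unfolding scalar_of_nat[symmetric] by (rule bd_scalar)

lemma shear_sum_bd_left:
  "(\<Sum>j\<le>i. of_nat ((i - j + l) choose l) * (bd_letter (a, 2 * j) * word [(b, 2 * (i - j + l) + \<eta>)])) =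
    (case i of 0 \<Rightarrow> 0 | Suc i' \<Rightarrow> \<Sum>x\<in>UNIV. shear_sum 1 \<eta> i' l x b)"
proof (cases i)
  case (Suc i')
  have "(\<Sum>j\<le>i. of_nat ((i - j + l) choose l) * (bd_letter (a, 2 * j) * word [(b, 2 * (i - j + l) + \<eta>)])) =
      (\<Sum>j\<le>i'. of_nat ((i' - j + l) choose l) * (bd_letter (a, 2 * Suc j) * word [(b, 2 * (i' - j + l) + \<eta>)]))"
    unfolding Suc by (subst sum.atMost_Suc_shift) simp
  also have "\<dots> = (\<Sum>j\<le>i'. \<Sum>x\<in>UNIV. of_nat ((i' - j + l) choose l) * word [(x, 2 * j + 1), (b, 2 * (i' - j + l) + \<eta>)])"
    by (simp add: sum_distrib_left sum_distrib_right word_append[symmetric])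
  finally show ?thesis
    unfolding Suc by (subst (asm) sum.swap) (simp add: shear_sum_def)
qed simp

text \<open>The power of \<delta> on the right combines a part of (\<gamma> + \<delta>)_i with
  \<delta>_l. The differential hits one or the other, and Pascal's rule for the binomial coefficient
  separates the two contributions.\<close>

lemma shear_sum_bd_right:
  "(\<Sum>j\<le>i. of_nat ((i - j + l) choose l) * (word [(a, 2 * j + \<epsilon>)] * bd_letter (b, 2 * (i - j + l)))) =
    (case i of 0 \<Rightarrow> 0 | Suc i' \<Rightarrow> \<Sum>y\<in>UNIV. shear_sum \<epsilon> 1 i' l a y) +
    (case l of 0 \<Rightarrow> 0 | Suc l' \<Rightarrow> \<Sum>y\<in>UNIV. shear_sum \<epsilon> 1 i l' a y)"
proof (cases l)
  case 0
  show ?thesis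
  proof (cases i)
    case (Suc i')
    have "(\<Sum>j\<le>i. word [(a, 2 * j + \<epsilon>)] * bd_letter (b, 2 * (i - j))) =
        (\<Sum>j\<le>i'. word [(a, 2 * j + \<epsilon>)] * bd_letter (b, Suc (Suc (2 * (i' - j)))))"
      unfolding Suc by (simp add: Suc_diff_le)
    also have "\<dots> = (\<Sum>j\<le>i'. \<Sum>y\<in>UNIV. word [(a, 2 * j + \<epsilon>), (y, 2 * (i' - j) + 1)])"
      by (simp add: sum_distrib_left word_append[symmetric])
    finally show ?thesis
      unfolding 0 Suc by (subst (asm) sum.swap) (simp add: shear_sum_def)
  qed (simp add: 0)
next
  case (Suc l')
  have eq: "word [(a, 2 * j + \<epsilon>)] * bd_letter (b, 2 * (i - j + l)) =
      (\<Sum>y\<in>UNIV. word [(a, 2 * j + \<epsilon>), (y, 2 * (i - j + l') + 1)])" for j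
    by (simp add: Suc sum_distrib_left word_append[symmetric])
  have "(\<Sum>j\<le>i. of_nat ((i - j + l) choose l) * (word [(a, 2 * j + \<epsilon>)] * bd_letter (b, 2 * (i - j + l)))) =
      (\<Sum>j\<le>i. \<Sum>y\<in>UNIV. of_nat ((i - j + l') choose l') * word [(a, 2 * j + \<epsilon>), (y, 2 * (i - j + l') + 1)]) +
      (\<Sum>j\<le>i. \<Sum>y\<in>UNIV. of_nat ((i - j + l') choose l) * word [(a, 2 * j + \<epsilon>), (y, 2 * (i - j + l') + 1)])"
    unfolding eq sum.distrib[symmetric] sum_distrib_left
    by (simp add: Suc distrib_right)
  also have "(\<Sum>j\<le>i. \<Sum>y\<in>UNIV. of_nat ((i - j + l') choose l') * word [(a, 2 * j + \<epsilon>), (y, 2 * (i - j + l') + 1)]) =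
      (\<Sum>y\<in>UNIV. shear_sum \<epsilon> 1 i l' a y)"
    by (subst sum.swap) (simp add: shear_sum_def)
  also have "(\<Sum>j\<le>i. \<Sum>y\<in>UNIV. of_nat ((i - j + l') choose l) * word [(a, 2 * j + \<epsilon>), (y, 2 * (i - j + l') + 1)]) =
      (case i of 0 \<Rightarrow> 0 | Suc i' \<Rightarrow> \<Sum>y\<in>UNIV. shear_sum \<epsilon> 1 i' l a y)"
  proof (cases i)
    case (Suc i')
    \<comment> \<open>The summand \<open>j = i\<close> drops out because
      \<open>l' choose Suc l'\<close> is 0.\<close>
    have "(\<Sum>j\<le>i. \<Sum>y\<in>UNIV. of_nat ((i - j + l') choose l) * word [(a, 2 * j + \<epsilon>), (y, 2 * (i - j + l') + 1)]) =
        (\<Sum>j\<le>i'. \<Sum>y\<in>UNIV. of_nat ((i' - j + l) choose l) * word [(a, 2 * j + \<epsilon>), (y, 2 * (i' - j + l) + 1)])"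
      unfolding Suc \<open>l = Suc l'\<close> by (simp add: Suc_diff_le binomial_eq_0)
    then show ?thesis
      unfolding Suc by (subst (asm) (2) sum.swap) (simp add: shear_sum_def)
  qed (simp add: Suc binomial_eq_0)
  finally show ?thesis
    by (simp add: Suc)
qed

lemma bd_shear_sum_generic:
  "bd (shear_sum \<epsilon> \<eta> i l a b) =
    (\<Sum>j\<le>i. of_nat ((i - j + l) choose l) * (bd_letter (a, 2 * j + \<epsilon>) * word [(b, 2 * (i - j + l) + \<eta>)])) +
    (- 1) ^ \<epsilon> * (\<Sum>j\<le>i. of_nat ((i - j + l) choose l) * (word [(a, 2 * j + \<epsilon>)] * bd_letter (b, 2 * (i - j + l) + \<eta>)))"
  by (simp add: shear_sum_def bd_sum distrib_left sum.distrib sum_distrib_left power_add mult.assoc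
      sign_left_commute[of "of_nat _"])

lemma shear_sum_letter_left:
  "(\<Sum>j\<le>i. of_nat ((i - j + l) choose l) * (bd_letter (a, 2 * j + 1) * word [(b, 2 * (i - j + l) + \<eta>)])) =
    shear_sum 0 \<eta> i l (a + 1) b - shear_sum 0 \<eta> i l a b"
  by (simp add: shear_sum_def sum_subtractf[symmetric] left_diff_distrib right_diff_distrib word_append[symmetric])

lemma shear_sum_letter_right:
  "(\<Sum>j\<le>i. of_nat ((i - j + l) choose l) * (word [(a, 2 * j + \<epsilon>)] * bd_letter (b, 2 * (i - j + l) + 1))) =
    shear_sum \<epsilon> 0 i l a (b + 1) - shear_sum \<epsilon> 0 i l a b"
  by (simp add: shear_sum_def sum_subtractf[symmetric] right_diff_distrib word_append[symmetric])

lemma bd_shear_sum: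
  "bd (shear_sum 1 1 i l a b) = shear_sum 0 1 i l (a + 1) b - shear_sum 0 1 i l a b -
     shear_sum 1 0 i l a (b + 1) + shear_sum 1 0 i l a b"
  "bd (shear_sum 0 1 i l a b) = (case i of 0 \<Rightarrow> 0 | Suc i' \<Rightarrow> \<Sum>x\<in>UNIV. shear_sum 1 1 i' l x b) +
     shear_sum 0 0 i l a (b + 1) - shear_sum 0 0 i l a b"
  "bd (shear_sum 1 0 i l a b) = shear_sum 0 0 i l (a + 1) b - shear_sum 0 0 i l a b -
     (case i of 0 \<Rightarrow> 0 | Suc i' \<Rightarrow> \<Sum>y\<in>UNIV. shear_sum 1 1 i' l a y) -
     (case l of 0 \<Rightarrow> 0 | Suc l' \<Rightarrow> \<Sum>y\<in>UNIV. shear_sum 1 1 i l' a y)"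
  "bd (shear_sum 0 0 i l a b) = (case i of 0 \<Rightarrow> 0 | Suc i' \<Rightarrow> \<Sum>x\<in>UNIV. shear_sum 1 0 i' l x b) +
     (case i of 0 \<Rightarrow> 0 | Suc i' \<Rightarrow> \<Sum>y\<in>UNIV. shear_sum 0 1 i' l a y) +
     (case l of 0 \<Rightarrow> 0 | Suc l' \<Rightarrow> \<Sum>y\<in>UNIV. shear_sum 0 1 i l' a y)"
  by (simp_all only: bd_shear_sum_generic add_0_right power_0 power_one_right mult_1_left mult_minus_left
      shear_sum_letter_left[where \<eta> = 1]
      shear_sum_letter_left[where \<eta> = 0, unfolded add_0_right]
      shear_sum_letter_right[where \<epsilon> = 1]
      shear_sum_letter_right[where \<epsilon> = 0, unfolded add_0_right]
      shear_sum_bd_left[where \<eta> = 1]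
      shear_sum_bd_left[where \<eta> = 0, unfolded add_0_right]
      shear_sum_bd_right[where \<epsilon> = 1]
      shear_sum_bd_right[where \<epsilon> = 0, unfolded add_0_right])
    (simp_all only: diff_conv_add_uminus minus_add_distrib minus_minus add_ac)

text \<open>With T the sum of all t^r u^m for m < r < n, these are (u - 1) T, (t u - 1) T and (t -
  1) T: everything inside the triangle telescopes and only its edges remain. For n = p the edges are
  the norms of t and u and the diagonal norm of t u.\<close>

lemma sum_triangle:
  fixes F :: "nat \<Rightarrow> nat \<Rightarrow> 'a::ab_group_add"
  shows "(\<Sum>r<n. \<Sum>m<r. F r (Suc m) - F r m) = (\<Sum>r<n. F r r) - (\<Sum>r<n. F r 0)"
    and "(\<Sum>r<n. \<Sum>m<r. F (Suc r) (Suc m) - F r m) = ((\<Sum>m<n. F n m) - F n 0) - ((\<Sum>r<n. F r 0) - F 0 0)"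
    and "(\<Sum>r<n. \<Sum>m<r. F (Suc r) m - F r m) = (\<Sum>m<n. F n m) - (\<Sum>m<n. F (Suc m) m)"
proof -
  show "(\<Sum>r<n. \<Sum>m<r. F r (Suc m) - F r m) = (\<Sum>r<n. F r r) - (\<Sum>r<n. F r 0)"
    unfolding sum_lessThan_telescope by (rule sum_subtractf)
  show "(\<Sum>r<n. \<Sum>m<r. F (Suc r) (Suc m) - F r m) = ((\<Sum>m<n. F n m) - F n 0) - ((\<Sum>r<n. F r 0) - F 0 0)"
  proof (induction n)
    case (Suc n)
    have e: "(\<Sum>m<n. F (Suc n) (Suc m)) = (\<Sum>m<Suc n. F (Suc n) m) - F (Suc n) 0"
      by (subst sum.lessThan_Suc_shift) simp
    have "(\<Sum>r<Suc n. \<Sum>m<r. F (Suc r) (Suc m) - F r m) = (\<Sum>r<n. \<Sum>m<r. F (Suc r) (Suc m) - F r m)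
        + ((\<Sum>m<n. F (Suc n) (Suc m)) - (\<Sum>m<n. F n m))"
      unfolding sum.lessThan_Suc unfolding sum_subtractf ..
    then show ?case
      unfolding Suc e by (simp del: sum.lessThan_Suc add: sum.lessThan_Suc[of "\<lambda>r. F r 0"] algebra_simps)
  qed simp
  show "(\<Sum>r<n. \<Sum>m<r. F (Suc r) m - F r m) = (\<Sum>m<n. F n m) - (\<Sum>m<n. F (Suc m) m)"
    by (induction n) (simp_all add: sum_subtractf algebra_simps)
qed

lemma sum_translate_UNIV': "(\<Sum>x\<in>UNIV. f (a + x)) = (\<Sum>x\<in>(UNIV :: 'p::prime_card mod_ring set). f x)"
  using sum_translate_UNIV[of f a] by (simp add: add.commute)

abbreviation triangle_sum :: "('p::prime_card mod_ring \<Rightarrow> 'p mod_ring \<Rightarrow> 'a::ab_group_add) \<Rightarrow> 'p mod_ring \<Rightarrow> 'p mod_ring \<Rightarrow> 'a" where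
  "triangle_sum G a b \<equiv> (\<Sum>r<CARD('p). \<Sum>m<r. G (a + of_nat r) (b + of_nat m))"

text \<open>Both coordinates live modulo p. Hence every edge of the triangle runs through a complete
  orbit and becomes a sum over the group, and the two corner terms of the second formula
  cancel.\<close>

lemma triangle_sum_shift:
  fixes G :: "'p::prime_card mod_ring \<Rightarrow> 'p mod_ring \<Rightarrow> 'a::ab_group_add"
  shows "triangle_sum G a (a + b + 1) = triangle_sum G a (a + b) + (\<Sum>x\<in>UNIV. G x (x + b)) - (\<Sum>x\<in>UNIV. G x (a + b))"
    and "triangle_sum G (a + 1) (a + b + 1) = triangle_sum G a (a + b) + (\<Sum>y\<in>UNIV. G a y) - (\<Sum>x\<in>UNIV. G x (a + b))"
    and "triangle_sum G (a + 1) (a + b) = triangle_sum G a (a + b) + (\<Sum>y\<in>UNIV. G a y) - (\<Sum>x\<in>UNIV. G (x + 1) (x + b))"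
proof -
  let ?F = "\<lambda>r m. G (a + of_nat r) (a + b + of_nat m)"
  have d: "(\<Sum>r<CARD('p). ?F r r) = (\<Sum>x\<in>UNIV. G x (x + b))"
    using sum_translates[of "\<lambda>x. G x (x + b)" a] by (simp add: add_ac)
  have d1: "(\<Sum>r<CARD('p). ?F (Suc r) r) = (\<Sum>x\<in>UNIV. G (x + 1) (x + b))"
    using sum_translates[of "\<lambda>x. G (x + 1) (x + b)" a] by (simp add: add_ac)
  have h: "(\<Sum>r<CARD('p). ?F r 0) = (\<Sum>x\<in>UNIV. G x (a + b))"
    using sum_translates[of "\<lambda>x. G x (a + b)" a] by simp
  have v: "(\<Sum>m<CARD('p). ?F CARD('p) m) = (\<Sum>y\<in>UNIV. G a y)"
    using sum_translates[of "\<lambda>y. G a y" "a + b"] by simp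
  note triangle = sum_triangle[where F = ?F and n = "CARD('p)", unfolded sum_subtractf d d1 h v]
  show "triangle_sum G a (a + b + 1) = triangle_sum G a (a + b) + (\<Sum>x\<in>UNIV. G x (x + b)) - (\<Sum>x\<in>UNIV. G x (a + b))"
    using triangle(1) by (simp add: add_ac algebra_simps)
  show "triangle_sum G (a + 1) (a + b + 1) = triangle_sum G a (a + b) + (\<Sum>y\<in>UNIV. G a y) - (\<Sum>x\<in>UNIV. G x (a + b))"
    using triangle(2) by (simp add: add_ac algebra_simps)
  show "triangle_sum G (a + 1) (a + b) = triangle_sum G a (a + b) + (\<Sum>y\<in>UNIV. G a y) - (\<Sum>x\<in>UNIV. G (x + 1) (x + b))"
    using triangle(3) by (simp add: add_ac algebra_simps)
qed

text \<open>The right-hand side is the defect of the candidate \<gamma> \<mapsto> \<gamma> +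
  \<delta>: the norms of t and u, applied to e and f, minus the norm of t u applied to e + t f. This
  is the equation from which c is determined.\<close>

lemma bd_triangle_sum:
  "bd (triangle_sum (shear_sum 1 1 i l) a (a + b)) =
    (\<Sum>y\<in>UNIV. shear_sum 0 1 i l a y) - (\<Sum>x\<in>UNIV. shear_sum 0 1 i l (x + 1) (x + b)) -
    (\<Sum>x\<in>UNIV. shear_sum 1 0 i l x (x + b)) + (\<Sum>x\<in>UNIV. shear_sum 1 0 i l x (a + b))"
proof -
  have "bd (triangle_sum (shear_sum 1 1 i l) a (a + b)) =
      triangle_sum (shear_sum 0 1 i l) (a + 1) (a + b) - triangle_sum (shear_sum 0 1 i l) a (a + b) -
      triangle_sum (shear_sum 1 0 i l) a (a + b + 1) + triangle_sum (shear_sum 1 0 i l) a (a + b)"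
    unfolding bd_sum bd_shear_sum sum_subtractf sum.distrib by (simp add: add_ac)
  then show ?thesis
    unfolding triangle_sum_shift by simp
qed

lemma lin_shear_letter:
  "lin shear (bd_letter (a, Suc (2 * i)) * word [y]) = shear [(a + 1, 2 * i), y] - shear [(a, 2 * i), y]"
  "lin shear (bd_letter (a, 2 * i) * word [y]) =
    (case i of 0 \<Rightarrow> 0 | Suc i' \<Rightarrow> \<Sum>x\<in>UNIV. shear [(x, Suc (2 * i')), y])"
  "lin shear (word [z] * bd_letter (b, Suc (2 * l))) = shear [z, (b + 1, 2 * l)] - shear [z, (b, 2 * l)]"
  "lin shear (word [z] * bd_letter (b, 2 * l)) =
    (case l of 0 \<Rightarrow> 0 | Suc l' \<Rightarrow> \<Sum>y\<in>UNIV. shear [z, (y, Suc (2 * l'))])"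
  by (simp_all add: left_diff_distrib right_diff_distrib sum_distrib_left sum_distrib_right lin_sum
      word_append[symmetric] split: nat.split)

lemma chain_map_shear:
  "chain_map 2 (\<lambda>v. [v ! 0, v ! 0 + v ! 1]) (shear :: 'p::prime_card cell \<Rightarrow> _)"
proof (rule chain_mapI)
  fix w :: "'p cell"
  assume "length w = 2"
  then obtain a k b q where w: "w = [(a, k), (b, q)]"
    by (elim length_2E) (metis surj_pair)
  obtain i where i: "k = 2 * i \<or> k = Suc (2 * i)"
    by (metis evenE oddE Suc_eq_plus1)
  obtain l where l: "q = 2 * l \<or> q = Suc (2 * l)"
    by (metis evenE oddE Suc_eq_plus1)
  show supp: "shear w \<in> supp (\<lambda>u. length u = 2 \<and> word_degree u = word_degree w)"
    using i l unfolding w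
    by (elim disjE; hypsubst; unfold shear_simps)
      (auto intro!: supp_diff supp_add supp_sum shear_sum_supp split: nat.split)
  show "augmentation (shear w) = augmentation (word w)"
  proof (cases "k + q = 0")
    case True
    then show ?thesis
      by (simp add: w shear_def Let_def shear_sum_def augmentation_word)
  next
    case False
    have "shear w \<in> supp (\<lambda>u. word_degree u = k + q)"
      by (rule supp_mono[OF supp]) (simp add: w)
    with False show ?thesis
      by (subst augmentation_of_degree) (auto simp: w augmentation_word)
  qed
  show "shear (translate_word v w) = translate_list [v ! 0, v ! 0 + v ! 1] (shear w)" if len_v: "length v = 2" for v
  proof -
    obtain g h where v: "v = [g, h]"
      using len_v by (rule length_2E)
    show ?thesis
      using i l unfolding w v
      by (elim disjE; hypsubst)
        (simp_all add: shear_simps translate_shear_sum translate_list_sum add_ac split: nat.split)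
  qed
  have bd_w: "lin shear (bd_word w) = lin shear (bd_letter (a, k) * word [(b, q)]) +
      (- 1) ^ k * lin shear (word [(a, k)] * bd_letter (b, q))"
    by (simp add: w mult.assoc)
  show "lin shear (bd_word w) = bd (shear w)"
    using i
  proof
    assume k: "k = 2 * i"
    show ?thesis
      using l
    proof
      assume q: "q = 2 * l"
      show ?thesis
        unfolding bd_w unfolding w k q lin_shear_letter shear_simps bd_diff bd_shear_sum
        using sum_translate_UNIV'[of _ a]
        by (simp add: bd_triangle_sum[unfolded One_nat_def] sum.distrib sum_translate_UNIV' split: nat.split)
    next
      assume q: "q = Suc (2 * l)"
      show ?thesis
        unfolding bd_w unfolding w k q lin_shear_letter shear_simps bd_diff bd_shear_sum
        \<comment> \<open>The boundary of f is u - 1, so the corrections at \<open>b + 1\<close> and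
          \<open>b\<close> are subtracted. Here \<open>i - 1\<close> stands for the predecessor that
          the case distinction on \<open>i\<close> provides.\<close>
        using triangle_sum_shift(1)[of "shear_sum 1 1 (i - 1) l" a b]
        by (auto simp: add.assoc[symmetric] split: nat.split)
    qed
  next
    assume k: "k = Suc (2 * i)"
    show ?thesis
      using l
    proof
      assume q: "q = 2 * l"
      show ?thesis
        unfolding bd_w unfolding w k q lin_shear_letter shear_simps bd_add bd_shear_sum
        \<comment> \<open>The boundary of e is t - 1 and the shear sends t to t u, so both
          coordinates of the correction move.\<close>
        using triangle_sum_shift(2)[of "shear_sum 1 1 (i - 1) l" a b]
        by (auto simp: sum_translate_UNIV sum_translate_UNIV' algebra_simps split: nat.split)
    next
      assume q: "q = Suc (2 * l)"
      show ?thesis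
        unfolding bd_w unfolding w k q lin_shear_letter shear_simps bd_shear_sum
        by (simp add: add_ac)
    qed
  qed
qed

text \<open>The coefficient of s^i t^l in A(s) B(s + t), where A(s) is the sum of all
  e_{2j+\<epsilon>} s^j and B(s) the sum of all e_{2j+\<eta>} s^j.\<close>

definition shear_chain :: "nat \<Rightarrow> nat \<Rightarrow> nat \<Rightarrow> nat \<Rightarrow> 'p::prime_card chains" where
  "shear_chain \<epsilon> \<eta> i l = (\<Sum>j\<le>i. of_nat ((i - j + l) choose l) * word [2 * j + \<epsilon>, 2 * (i - j + l) + \<eta>])"

lemma trivialize_shear_sum: "trivialize (shear_sum \<epsilon> \<eta> i l a b) = shear_chain \<epsilon> \<eta> i l"
  by (simp add: shear_sum_def shear_chain_def trivialize_sum scalar_of_nat[symmetric])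

text \<open>The correction term is a multiple of \<open>p (p - 1) / 2\<close> after trivialization.\<close>

lemma induced_shear:
  assumes "odd CARD('p)"
  shows "induced shear [2 * i, 2 * l] = (shear_chain 0 0 i l :: 'p::prime_card chains)"
    and "induced shear [2 * i, Suc (2 * l)] = (shear_chain 0 1 i l :: 'p chains)"
    and "induced shear [Suc (2 * i), 2 * l] = (shear_chain 1 0 i l + shear_chain 0 1 i l :: 'p chains)"
    and "induced shear [Suc (2 * i), Suc (2 * l)] = (shear_chain 1 1 i l :: 'p chains)"
proof -
  obtain h where h: "CARD('p) = Suc (2 * h)"
    using assms by (auto elim: oddE)
  have "(\<Sum>r<Suc (2 * h). r) = Suc (2 * h) * h"
    by (induction h) auto
  then have "(\<Sum>r<CARD('p). r) = CARD('p) * h"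
    by (simp only: h)
  then have "of_nat (\<Sum>r<CARD('p). r) = (of_nat (CARD('p) * h) :: 'p chains)"
    by (rule arg_cong)
  then have "(\<Sum>r<CARD('p). of_nat r) = (0 :: 'p chains)"
    by (simp only: of_nat_sum of_nat_mult of_nat_CARD_free_algebra mult_zero_left)
  then have "(\<Sum>r<CARD('p). of_nat r * z) = 0" for z :: "'p chains"
    by (simp add: sum_distrib_right[symmetric])
  then show "induced shear [2 * i, 2 * l] = (shear_chain 0 0 i l :: 'p chains)"
    by (simp add: induced_def shear_simps trivialize_shear_sum trivialize_sum split: nat.split)
qed (simp_all add: induced_def shear_simps trivialize_shear_sum)

section \<open>Two-sided ideals of relations\<close>

text \<open>The two-sided ideal, built one summand \<open>a * r * b\<close> at a time, so that an
  induction meets only the relations themselves, their multiples and sums.\<close>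

inductive_set ideal_span :: "('x list \<Rightarrow>\<^sub>0 'k::comm_ring_1) set \<Rightarrow> ('x list \<Rightarrow>\<^sub>0 'k) set" for R where
  zero: "0 \<in> ideal_span R"
| add: "r \<in> R \<Longrightarrow> x \<in> ideal_span R \<Longrightarrow> a * r * b + x \<in> ideal_span R"

lemma ideal_span_base: "r \<in> R \<Longrightarrow> r \<in> ideal_span R"
  using ideal_span.add[OF _ ideal_span.zero, of r R 1 1] by simp

lemma ideal_span_add: "x \<in> ideal_span R \<Longrightarrow> y \<in> ideal_span R \<Longrightarrow> x + y \<in> ideal_span R"
  by (induction x rule: ideal_span.induct) (auto simp: add.assoc intro: ideal_span.intros)

lemma ideal_span_times: "x \<in> ideal_span R \<Longrightarrow> c * x * d \<in> ideal_span R"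
proof (induction x rule: ideal_span.induct)
  case (add r x a b)
  have "c * (a * r * b + x) * d = (c * a) * r * (b * d) + c * x * d"
    by (simp add: distrib_left distrib_right mult.assoc)
  then show ?case
    using ideal_span.add[OF add.hyps(1) add.IH] by simp
qed (simp add: ideal_span.zero)

lemma ideal_span_left: "x \<in> ideal_span R \<Longrightarrow> c * x \<in> ideal_span R"
  using ideal_span_times[of x R c 1] by simp

lemma ideal_span_right: "x \<in> ideal_span R \<Longrightarrow> x * d \<in> ideal_span R"
  using ideal_span_times[of x R 1 d] by simp

lemma ideal_span_uminus: "x \<in> ideal_span R \<Longrightarrow> - x \<in> ideal_span R"
  using ideal_span_left[of x R "- 1"] by simp

lemma ideal_span_diff: "x \<in> ideal_span R \<Longrightarrow> y \<in> ideal_span R \<Longrightarrow> x - y \<in> ideal_span R"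
  using ideal_span_add[OF _ ideal_span_uminus] by fastforce

lemma ideal_span_lin:
  fixes h :: "'y list \<Rightarrow> ('x list \<Rightarrow>\<^sub>0 'k::comm_ring_1)"
  assumes "x \<in> supp P" "\<And>w. P w \<Longrightarrow> h w \<in> ideal_span R"
  shows "lin h x \<in> ideal_span R"
  using assms(1)
  by (induction x rule: supp_induct)
    (auto simp: lin_single intro: ideal_span.zero ideal_span_add ideal_span_left assms(2))

definition dilation_relations :: "'p::prime_card chains set" where
  "dilation_relations = {induced (dilation c) \<alpha> - word \<alpha> | c \<alpha>. c \<noteq> 0 \<and> length \<alpha> = 1}"

definition interchange_relations :: "'p::prime_card chains set" where
  "interchange_relations = {induced interchange \<alpha> - word \<alpha> | \<alpha>. length \<alpha> = 2}"

definition shear_relations :: "'p::prime_card chains set" where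
  "shear_relations = {induced shear \<alpha> - word \<alpha> | \<alpha>. length \<alpha> = 2}"

definition elementary_relations :: "'p::prime_card chains set" where
  "elementary_relations = dilation_relations \<union> interchange_relations \<union> shear_relations"

abbreviation elementary_ideal :: "'p::prime_card chains set" where
  "elementary_ideal \<equiv> ideal_span elementary_relations"

section \<open>Lifts of all invertible matrices\<close>

lemma length_mat_fun: "A \<in> carrier_mat n n \<Longrightarrow> length (mat_fun A v) = n"
  by (simp add: mat_fun_def)

lemma mat_fun_nth: "A \<in> carrier_mat n n \<Longrightarrow> i < n \<Longrightarrow> mat_fun A v ! i = row A i \<bullet> vec_of_list v"
  by (simp add: mat_fun_def list_of_vec_index)

lemma mat_fun_mult: "A \<in> carrier_mat n n \<Longrightarrow> B \<in> carrier_mat n n \<Longrightarrow> length v = n \<Longrightarrow>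
    mat_fun (A * B) v = mat_fun A (mat_fun B v)"
  by (simp add: mat_fun_def vec_list assoc_mult_mat_vec[of A n n B n] carrier_vecI)

lemma mat_fun_one: "length v = n \<Longrightarrow> mat_fun (1\<^sub>m n) v = v" for v :: "'k::semiring_1 list"
  by (simp add: mat_fun_def list_vec carrier_vecI one_mult_mat_vec[of "vec_of_list v" n])

lemma take_1_drop: "k < length v \<Longrightarrow> take 1 (drop k v) = [v ! k]"
  by (simp add: take_Suc hd_drop_conv_nth)

lemma take_2_drop: "Suc k < length v \<Longrightarrow> take 2 (drop k v) = [v ! k, v ! Suc k]"
  by (simp add: numeral_2_eq_2 take_Suc hd_drop_conv_nth drop_Suc[symmetric] tl_drop)

lemma mat_fun_multrow:
  fixes c :: "'k::field"
  assumes "length v = n" "k < n"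
  shows "mat_fun (multrow_mat n k c) v = extend_map k 1 (map ((*) c)) v"
proof (rule nth_equalityI)
  fix i assume "i < length (mat_fun (multrow_mat n k c) v)"
  then have i: "i < n" by (simp add: length_mat_fun[of _ n])
  have v: "vec_of_list v \<in> carrier_vec n"
    using assms by (simp add: carrier_vecI)
  show "mat_fun (multrow_mat n k c) v ! i = extend_map k 1 (map ((*) c)) v ! i"
    using i assms v
    by (cases i k rule: linorder_cases)
      (simp_all add: mat_fun_nth[of _ n] row_multrow extend_map_def take_1_drop[unfolded One_nat_def] nth_append vec_of_list_index)
qed (use assms in \<open>simp add: length_mat_fun[of _ n] extend_map_def\<close>)

lemma mat_fun_swaprows:
  fixes v :: "'k::field list"
  assumes "length v = n" "Suc k < n"
  shows "mat_fun (swaprows_mat n k (Suc k)) v = extend_map k 2 rev v"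
proof (rule nth_equalityI)
  fix i assume "i < length (mat_fun (swaprows_mat n k (Suc k)) v)"
  then have i: "i < n" by (simp add: length_mat_fun[of _ n])
  have v: "vec_of_list v \<in> carrier_vec n"
    using assms by (simp add: carrier_vecI)
  \<comment> \<open>Behind the block, positions are shifted by 2; the equation
    \<open>Suc (Suc (i - 2)) = i\<close> records that nothing is truncated.\<close>
  consider "i < k" | "i = k" | "i = Suc k" | "i > Suc k" "Suc (Suc (i - 2)) = i" by linarith
  then show "mat_fun (swaprows_mat n k (Suc k)) v ! i = extend_map k 2 rev v ! i"
    using i assms v
    by cases
      (simp_all add: mat_fun_nth[of _ n] row_swaprows extend_map_def take_2_drop nth_append vec_of_list_index nth_Cons')
qed (use assms in \<open>simp add: length_mat_fun[of _ n] extend_map_def\<close>)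

lemma mat_fun_addrow:
  fixes v :: "'k::field list"
  assumes "length v = n" "Suc k < n"
  shows "mat_fun (addrow_mat n 1 (Suc k) k) v = extend_map k 2 (\<lambda>v. [v ! 0, v ! 0 + v ! 1]) v"
proof (rule nth_equalityI)
  fix i assume "i < length (mat_fun (addrow_mat n 1 (Suc k) k) v)"
  then have i: "i < n" by (simp add: length_mat_fun[of _ n])
  have v: "vec_of_list v \<in> carrier_vec n"
    using assms by (simp add: carrier_vecI)
  consider "i < k" | "i = k" | "i = Suc k" | "i > Suc k" "Suc (Suc (i - 2)) = i" by linarith
  then show "mat_fun (addrow_mat n 1 (Suc k) k) v ! i = extend_map k 2 (\<lambda>v. [v ! 0, v ! 0 + v ! 1]) v ! i"
    using i assms v
    by cases
      (simp_all add: mat_fun_nth[of _ n] row_addrow extend_map_def take_2_drop nth_append vec_of_list_index nth_Cons'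
        add_scalar_prod_distrib[of _ n])
qed (use assms in \<open>simp add: length_mat_fun[of _ n] extend_map_def\<close>)

lemma chain_map_multrow:
  assumes "c \<noteq> 0" "k + 1 \<le> n"
  shows "chain_map n (mat_fun (multrow_mat n k c)) (extend_chain_map k 1 (dilation c))"
  by (rule chain_map_cong[OF chain_map_extend[OF chain_map_dilation[OF assms(1)] _ assms(2)]])
    (use assms in \<open>auto simp: mat_fun_multrow\<close>)

lemma chain_map_swaprows:
  assumes "k + 2 \<le> n"
  shows "chain_map n (mat_fun (swaprows_mat n k (Suc k))) (extend_chain_map k 2 interchange)"
  by (rule chain_map_cong[OF chain_map_extend[OF chain_map_interchange _ assms]])
    (use assms in \<open>auto simp: mat_fun_swaprows\<close>)

lemma chain_map_addrow:
  assumes "k + 2 \<le> n"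
  shows "chain_map n (mat_fun (addrow_mat n 1 (Suc k) k)) (extend_chain_map k 2 shear)"
  by (rule chain_map_cong[OF chain_map_extend[OF chain_map_shear _ assms]])
    (use assms in \<open>auto simp: mat_fun_addrow\<close>)

lemma invertible_matI:
  assumes "A \<in> carrier_mat n n" "B \<in> carrier_mat n n" "A * B = 1\<^sub>m n" "B * A = 1\<^sub>m n"
  shows "invertible_mat A"
  using assms unfolding invertible_mat_def inverts_mat_def by auto

text \<open>Serves to find the ideal inside the coinvariant relations: at each position of a word of
  any length the relation is realized by one invertible matrix, acting on a block of
  coordinates.\<close>

lemma elementary_lift:
  assumes "r \<in> (elementary_relations :: 'p::prime_card chains set)"
  obtains m f \<alpha> where "length \<alpha> = m" "r = induced f \<alpha> - word \<alpha>"
    "\<And>i n. i + m \<le> n \<Longrightarrow> \<exists>A \<in> GL n. chain_map n (mat_fun A) (extend_chain_map i m f)"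
proof -
  consider "r \<in> dilation_relations" | "r \<in> interchange_relations" | "r \<in> shear_relations"
    using assms by (auto simp: elementary_relations_def)
  then show thesis
  proof cases
    case 1
    then obtain c \<alpha> where c: "c \<noteq> 0" and \<alpha>: "length \<alpha> = 1" "r = induced (dilation c) \<alpha> - word \<alpha>"
      by (auto simp: dilation_relations_def)
    show thesis
    proof (rule that[OF \<alpha>])
      fix i n :: nat
      assume i: "i + 1 \<le> n"
      have "multrow_mat n i c \<in> GL n"
        unfolding GL_def using c i multrow_mat_inv[of i n c] multrow_mat_inv[of i n "inverse c"]
        by (auto intro: invertible_matI[of _ n "multrow_mat n i (inverse c)"])
      then show "\<exists>A\<in>GL n. chain_map n (mat_fun A) (extend_chain_map i 1 (dilation c))"
        using chain_map_multrow[OF c i] by blast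
    qed
  next
    case 2
    then obtain \<alpha> where \<alpha>: "length \<alpha> = 2" "r = induced interchange \<alpha> - word \<alpha>"
      by (auto simp: interchange_relations_def)
    show thesis
    proof (rule that[OF \<alpha>])
      fix i n :: nat
      assume i: "i + 2 \<le> n"
      have "swaprows_mat n i (Suc i) \<in> (GL n :: 'p mod_ring mat set)"
        unfolding GL_def using i swaprows_mat_inv[of i n "Suc i"]
        by (auto intro: invertible_matI[of _ n "swaprows_mat n i (Suc i)"])
      then show "\<exists>A\<in>GL n. chain_map n (mat_fun A) (extend_chain_map i 2 (interchange :: 'p cell \<Rightarrow> 'p resol))"
        using chain_map_swaprows[OF i] by blast
    qed
  next
    case 3
    then obtain \<alpha> where \<alpha>: "length \<alpha> = 2" "r = induced shear \<alpha> - word \<alpha>"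
      by (auto simp: shear_relations_def)
    show thesis
    proof (rule that[OF \<alpha>])
      fix i n :: nat
      assume i: "i + 2 \<le> n"
      have "addrow_mat n 1 (Suc i) i \<in> (GL n :: 'p mod_ring mat set)"
        unfolding GL_def using i addrow_mat_inv[of "Suc i" n i 1] addrow_mat_inv[of "Suc i" n i "- 1"]
        by (auto intro: invertible_matI[of _ n "addrow_mat n (- 1) (Suc i) i"])
      then show "\<exists>A\<in>GL n. chain_map n (mat_fun A) (extend_chain_map i 2 (shear :: 'p cell \<Rightarrow> 'p resol))"
        using chain_map_addrow[OF i] by blast
    qed
  qed
qed

lemma induced_extend_relation:
  assumes "\<And>\<alpha>. length \<alpha> = m \<Longrightarrow> induced f \<alpha> - word \<alpha> \<in> ideal_span R" "i + m \<le> n" "length \<alpha> = n"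
  shows "induced (extend_chain_map i m f) \<alpha> - word \<alpha> \<in> ideal_span R"
proof -
  define u v w where "u = take i \<alpha>" and "v = take m (drop i \<alpha>)" and "w = drop (i + m) \<alpha>"
  have \<alpha>: "\<alpha> = u @ v @ w"
    by (simp add: u_def v_def w_def) (metis add.commute append_take_drop_id drop_drop)
  have len: "length u = i" "length v = m"
    using assms(2,3) by (auto simp: u_def v_def)
  have "induced (extend_chain_map i m f) \<alpha> - word \<alpha> = word u * (induced f v - word v) * word w"
    unfolding \<alpha> induced_extend[OF len] word_append by (simp add: algebra_simps)
  then show ?thesis
    using ideal_span_times[OF assms(1)[OF len(2)]] by simp
qed

lemma chain_map_word: "chain_map n (\<lambda>v. v) word"
  by (auto simp: chain_map_def intro: supp_single)

text \<open>Matrices with a lift that acts as the identity modulo the ideal are closed under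
  products because X Y - 1 = (X - 1) Y + (Y - 1), where X - 1 maps everything of length
  \<open>n\<close> into the ideal. So only the generators have to be examined.\<close>

lemma general_linear_lift:
  assumes "A \<in> (GL n :: 'p::prime_card mod_ring mat set)"
  obtains f where "chain_map n (mat_fun A) f"
    "\<And>\<alpha>. length \<alpha> = n \<Longrightarrow> induced f \<alpha> - word \<alpha> \<in> elementary_ideal"
proof -
  define good where "good f \<longleftrightarrow> (\<forall>\<alpha>. length \<alpha> = n \<longrightarrow> induced f \<alpha> - word \<alpha> \<in> elementary_ideal)"
    for f :: "'p cell \<Rightarrow> 'p resol"
  define M where "M = {A \<in> carrier_mat n n. \<exists>f. chain_map n (mat_fun A) f \<and> good f}"
  have extend: "good (extend_chain_map i m f)"
    if "\<And>\<alpha>. length \<alpha> = m \<Longrightarrow> induced f \<alpha> - word \<alpha> \<in> elementary_relations" "i + m \<le> n" for i m f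
    unfolding good_def using that by (auto intro: induced_extend_relation ideal_span_base)
  have "A \<in> M"
  proof (rule general_linear_generated[where n = n])
    show "A \<in> carrier_mat n n" "invertible_mat A"
      using assms by (auto simp: GL_def)
    show "M \<subseteq> carrier_mat n n"
      by (auto simp: M_def)
    have "chain_map n (mat_fun (1\<^sub>m n)) word"
      by (rule chain_map_cong[OF chain_map_word]) (simp add: mat_fun_one)
    moreover have "good word"
      by (simp add: good_def induced_def ideal_span.zero o_def)
    ultimately show "1\<^sub>m n \<in> M"
      by (auto simp: M_def)
  next
    fix X Y
    assume "X \<in> M" "Y \<in> M"
    then obtain fX fY where X: "X \<in> carrier_mat n n" "chain_map n (mat_fun X) fX" "good fX"
      and Y: "Y \<in> carrier_mat n n" "chain_map n (mat_fun Y) fY" "good fY"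
      by (auto simp: M_def)
    let ?f = "\<lambda>w. lin fX (fY w)"
    have "chain_map n (mat_fun (X * Y)) ?f"
      by (rule chain_map_cong[OF chain_map_compose[OF X(2) Y(2)]])
        (simp_all add: length_mat_fun[OF Y(1)] mat_fun_mult[OF X(1) Y(1)])
    moreover have "good ?f"
      unfolding good_def
    proof (intro allI impI)
      fix \<alpha> :: "nat list"
      assume \<alpha>: "length \<alpha> = n"
      let ?e = "map (Pair 0) \<alpha> :: 'p cell"
      have fe: "fY ?e \<in> supp (\<lambda>w. length w = n)"
        using chain_mapD(1)[OF Y(2), of ?e] \<alpha> by (simp add: supp_conjD)
      have ind: "induced fY \<alpha> \<in> supp (\<lambda>\<beta>. length \<beta> = n)"
        unfolding induced_def trivialize_def by (rule supp_lin[OF fe]) (simp add: supp_single)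
      have "induced ?f \<alpha> = lin (induced fX) (induced fY \<alpha>)"
        unfolding induced_def[of ?f] induced_def[of fY]
        by (rule trivialize_lin[OF X(2) length_mat_fun[OF X(1)] fe])
      then have eq: "induced ?f \<alpha> - word \<alpha> =
          lin (\<lambda>\<beta>. induced fX \<beta> - word \<beta>) (induced fY \<alpha>) + (induced fY \<alpha> - word \<alpha>)"
        by (simp add: lin_fun_diff)
      have "lin (\<lambda>\<beta>. induced fX \<beta> - word \<beta>) (induced fY \<alpha>) \<in> elementary_ideal"
        by (rule ideal_span_lin[OF ind]) (use X(3) in \<open>simp add: good_def\<close>)
      then show "induced ?f \<alpha> - word \<alpha> \<in> elementary_ideal"
        unfolding eq using Y(3) \<alpha> by (intro ideal_span_add) (simp_all add: good_def)
    qed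
    ultimately show "X * Y \<in> M"
      using X(1) Y(1) by (auto simp: M_def)
  next
    fix k and c :: "'p mod_ring"
    assume k: "k < n" and c: "c \<noteq> 0"
    have "good (extend_chain_map k 1 (dilation c))"
      by (rule extend) (use k c in \<open>auto simp: elementary_relations_def dilation_relations_def\<close>)
    then show "multrow_mat n k c \<in> M"
      using chain_map_multrow[OF c, of k n] k by (auto simp: M_def)
  next
    fix k
    assume k: "Suc k < n"
    have "good (extend_chain_map k 2 (interchange :: 'p cell \<Rightarrow> 'p resol))"
      by (rule extend) (use k in \<open>auto simp: elementary_relations_def interchange_relations_def\<close>)
    then show "swaprows_mat n k (Suc k) \<in> M"
      using chain_map_swaprows[of k n] k by (auto simp: M_def)
    have "good (extend_chain_map k 2 (shear :: 'p cell \<Rightarrow> 'p resol))"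
      by (rule extend) (use k in \<open>auto simp: elementary_relations_def shear_relations_def\<close>)
    then show "addrow_mat n 1 (Suc k) k \<in> M"
      using chain_map_addrow[of k n] k by (auto simp: M_def)
  qed
  then show thesis
    using that by (auto simp: M_def good_def)
qed

section \<open>The ring of coinvariants\<close>

lemma ring_cycles: "ring (cycles :: 'p::prime_card chains ring)"
  by (unfold_locales)
    (auto simp: cycles_def bd_triv_zero algebra_simps Units_def add_eq_0_iff2 intro: exI[of _ "- _"])

lemma carrier_cycles: "carrier (cycles :: 'p::prime_card chains ring) = UNIV"
  by (simp add: cycles_def bd_triv_zero)

lemma ideal_range_bd_triv: "ideal (range bd_triv) (cycles :: 'p::prime_card chains ring)"
  using ring.zeroideal[OF ring_cycles] by (simp add: range_bd_triv cycles_def)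

lemma hclass_coset: "hclass = (+>\<^bsub>cycles\<^esub>) (range bd_triv :: 'p::prime_card chains set)"
  by (rule ext) (simp add: hclass_def)

lemma hclass_ring_hom: "ring_hom_ring cycles (TH :: 'p::prime_card chains set ring) hclass"
  and ring_TH: "ring (TH :: 'p::prime_card chains set ring)"
  and carrier_TH: "carrier (TH :: 'p::prime_card chains set ring) = range hclass"
proof -
  show "ring_hom_ring cycles (TH :: 'p chains set ring) hclass"
    unfolding hclass_coset TH_def by (rule ideal.rcos_ring_hom_ring[OF ideal_range_bd_triv])
  show "ring (TH :: 'p chains set ring)"
    unfolding TH_def by (rule ideal.quotient_is_ring[OF ideal_range_bd_triv])
  show "carrier (TH :: 'p chains set ring) = range hclass"
    unfolding TH_def hclass_coset FactRing_def A_RCOSETS_def' by (auto simp: carrier_cycles)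
qed

lemma hclass_simps:
  "hclass x \<oplus>\<^bsub>TH\<^esub> hclass y = hclass (x + y)" "hclass x \<otimes>\<^bsub>TH\<^esub> hclass y = hclass (x * y)"
  "\<zero>\<^bsub>TH\<^esub> = (hclass 0 :: 'p chains set)" "\<one>\<^bsub>TH\<^esub> = (hclass 1 :: 'p chains set)" "\<ominus>\<^bsub>TH\<^esub> hclass x = hclass (- x)"
  "hclass x \<ominus>\<^bsub>TH\<^esub> hclass y = hclass (x - y)"
  for x y :: "'p::prime_card chains"
proof -
  interpret h: ring_hom_ring cycles "TH :: 'p chains set ring" hclass
    by (rule hclass_ring_hom)
  have ops: "x \<oplus>\<^bsub>cycles\<^esub> y = x + y" "x \<otimes>\<^bsub>cycles\<^esub> y = x * y" "\<zero>\<^bsub>cycles\<^esub> = (0 :: 'p chains)"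
    "\<one>\<^bsub>cycles\<^esub> = (1 :: 'p chains)" for x y :: "'p chains"
    by (simp_all add: cycles_def)
  have neg: "\<ominus>\<^bsub>cycles\<^esub> x = - x" for x :: "'p chains"
    by (rule h.R.minus_equality) (simp_all add: ops carrier_cycles)
  show "hclass x \<oplus>\<^bsub>TH\<^esub> hclass y = hclass (x + y)" "hclass x \<otimes>\<^bsub>TH\<^esub> hclass y = hclass (x * y)"
    "\<zero>\<^bsub>TH\<^esub> = (hclass 0 :: 'p chains set)" "\<one>\<^bsub>TH\<^esub> = (hclass 1 :: 'p chains set)"
    using h.hom_add[of x y] h.hom_mult[of x y] h.hom_zero h.hom_one by (simp_all add: carrier_cycles ops)
  have m: "\<ominus>\<^bsub>TH\<^esub> hclass x = hclass (- x)" for x :: "'p chains"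
    using h.hom_a_inv[of x] by (simp add: carrier_cycles neg)
  then show "\<ominus>\<^bsub>TH\<^esub> hclass x = hclass (- x)" .
  show "hclass x \<ominus>\<^bsub>TH\<^esub> hclass y = hclass (x - y)"
    using h.hom_add[of x "- y"] by (simp add: a_minus_def m carrier_cycles ops)
qed

lemma hclass_inject: "hclass x = hclass y \<longleftrightarrow> x = y"
  by (simp add: hclass_eq)

lemma homology_eq: "homology n = hclass ` supp (\<lambda>\<alpha>. length \<alpha> = n)"
  by (auto simp: homology_def supp_def carrier_cycles)

text \<open>The coinvariant relations are defined as an additive span, and that they form a
  two-sided ideal is part of the claim. Multiplying a relation by words on both sides amounts to
  enlarging its matrix by identity blocks. Conversely, \<open>general_linear_lift\<close> bounds the
  relations of an arbitrary matrix.\<close>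

lemma coinv_relations_eq: "coinv_relations = hclass ` (elementary_ideal :: 'p::prime_card chains set)"
proof
  let ?S = "{gl_act n A c \<ominus>\<^bsub>TH\<^esub> c | n A c. A \<in> GL n \<and> c \<in> homology n} :: 'p chains set set"
  have S: "h \<in> hclass ` elementary_ideal" if hS: "h \<in> ?S" for h
  proof -
    obtain n A z where A: "A \<in> GL n" and z: "z \<in> supp (\<lambda>\<alpha>. length \<alpha> = n)"
      and h: "h = gl_act n A (hclass z) \<ominus>\<^bsub>TH\<^esub> hclass z"
      using hS by (auto simp: homology_eq)
    obtain f where f: "chain_map n (mat_fun A) f"
      "\<And>\<alpha>. length \<alpha> = n \<Longrightarrow> induced f \<alpha> - word \<alpha> \<in> elementary_ideal"
      using general_linear_lift[OF A] by blast
    have "h = hclass (lin (\<lambda>\<alpha>. induced f \<alpha> - word \<alpha>) z)"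
      using A by (simp add: h gl_act_eq[OF _ f(1) z] GL_def hclass_simps lin_fun_diff)
    moreover have "lin (\<lambda>\<alpha>. induced f \<alpha> - word \<alpha>) z \<in> elementary_ideal"
      by (rule ideal_span_lin[OF z f(2)])
    ultimately show ?thesis by blast
  qed
  show "coinv_relations \<subseteq> hclass ` (elementary_ideal :: 'p chains set)"
  proof
    fix h :: "'p chains set"
    assume "h \<in> coinv_relations"
    then show "h \<in> hclass ` elementary_ideal"
      unfolding coinv_relations_def
    proof (induction h rule: generate.induct)
      case one
      then show ?case by (auto simp: hclass_simps intro: ideal_span.zero)
    next
      case (incl h)
      then show ?case using S by blast
    next
      case (inv h)
      then obtain z where "z \<in> elementary_ideal" "h = hclass z" using S by blast
      then have "inv\<^bsub>add_monoid TH\<^esub> h = hclass (- z)"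
        using hclass_simps(5)[of z] by (simp only: a_inv_def)
      then show ?case
        using ideal_span_uminus[OF \<open>z \<in> elementary_ideal\<close>] by (simp only: imageI)
    next
      case (eng h1 h2)
      then show ?case by (auto simp: hclass_simps intro: ideal_span_add)
    qed
  qed
  have add: "hclass (x + y) \<in> coinv_relations" if "hclass x \<in> coinv_relations" "hclass y \<in> coinv_relations"
    for x y :: "'p chains"
    using generate.eng[OF that[unfolded coinv_relations_def]] by (simp add: hclass_simps coinv_relations_def)
  have zero: "hclass (0 :: 'p chains) \<in> coinv_relations"
    using generate.one[of "add_monoid (TH :: 'p chains set ring)"] by (simp add: hclass_simps coinv_relations_def)
  have rel: "hclass (Poly_Mapping.single u c * r * word v) \<in> coinv_relations"
    if rel_r: "r \<in> elementary_relations" for u v c and r :: "'p chains"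
  proof -
    obtain m f \<alpha> where \<alpha>: "length \<alpha> = m" and r: "r = induced f \<alpha> - word \<alpha>"
      and lift: "\<And>i n. i + m \<le> n \<Longrightarrow> \<exists>A \<in> GL n. chain_map n (mat_fun A) (extend_chain_map i m f)"
      by (rule elementary_lift[OF rel_r]) (rule that)
    define n where "n = length u + m + length v"
    \<comment> \<open>The block matrix changes the middle word only, so subtracting \<open>z\<close>
      from its image leaves the relation between \<open>u\<close> and \<open>v\<close>, with the
      scalar \<open>c\<close>.\<close>
    define z where "z = Poly_Mapping.single (u @ \<alpha> @ v) c"
    have z: "z \<in> supp (\<lambda>\<alpha>. length \<alpha> = n)"
      by (simp add: z_def n_def \<alpha> supp_single)
    let ?f = "extend_chain_map (length u) m f"
    obtain A where A: "A \<in> GL n" and ch: "chain_map n (mat_fun A) ?f"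
      using lift[of "length u" n] by (auto simp: n_def)
    have "lin (induced ?f) z - z = Poly_Mapping.single u c * r * word v"
      unfolding z_def lin_single induced_extend[OF refl \<alpha>] r
      by (simp add: scalar_word[of c "u @ \<alpha> @ v", symmetric] scalar_word[of c u, symmetric] word_append
          algebra_simps del: mult_single)
    moreover have "gl_act n A (hclass z) \<ominus>\<^bsub>TH\<^esub> hclass z \<in> coinv_relations"
      unfolding coinv_relations_def using A z by (intro generate.incl) (auto simp: homology_eq)
    ultimately show ?thesis
      using A by (simp add: gl_act_eq[OF _ ch z] GL_def hclass_simps)
  qed
  have arb: "hclass (a * r * b) \<in> coinv_relations" if r: "r \<in> elementary_relations" for a b r :: "'p chains"
  proof (induction a rule: free_algebra_induct)
    case (single u c)
    show ?case
    proof (induction b rule: free_algebra_induct)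
      case (single v d)
      have "Poly_Mapping.single u c * r * Poly_Mapping.single v d = Poly_Mapping.single u (c * d) * r * word v"
        unfolding scalar_word[of d v, symmetric] scalar_word[of c u, symmetric] scalar_word[of "c * d" u, symmetric]
        by (simp add: mult.assoc scalar_left_commute[of "r"] scalar_left_commute[of "word u"] scalar_mult del: mult_single)
      then show ?case
        using rel[OF r] by simp
    qed (use add zero in \<open>auto simp: distrib_left\<close>)
  qed (use add zero in \<open>auto simp: distrib_right\<close>)
  have "hclass x \<in> coinv_relations" if "x \<in> elementary_ideal" for x :: "'p chains"
    using that by (induction x rule: ideal_span.induct) (auto intro: add zero arb)
  then show "hclass ` (elementary_ideal :: 'p chains set) \<subseteq> coinv_relations"
    by blast
qed

definition coinvariant_class :: "'p::prime_card chains \<Rightarrow> 'p chains set set" where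
  "coinvariant_class z = coinv_relations +>\<^bsub>TH\<^esub> hclass z"

lemma ideal_elementary: "ideal elementary_ideal (cycles :: 'p::prime_card chains ring)"
proof (rule idealI[OF ring_cycles])
  have neg: "inv\<^bsub>add_monoid cycles\<^esub> x = - x" for x :: "'p chains"
  proof -
    interpret ring "cycles :: 'p chains ring" by (rule ring_cycles)
    have "\<ominus>\<^bsub>cycles\<^esub> x = - x"
      by (rule minus_equality) (simp_all add: carrier_cycles, simp_all add: cycles_def)
    then show ?thesis by (simp add: a_inv_def)
  qed
  show "subgroup elementary_ideal (add_monoid (cycles :: 'p chains ring))"
  proof
    fix x :: "'p chains"
    assume "x \<in> elementary_ideal"
    then show "inv\<^bsub>add_monoid cycles\<^esub> x \<in> elementary_ideal"
      unfolding neg by (rule ideal_span_uminus)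
  qed (auto simp: carrier_cycles, auto simp: cycles_def intro: ideal_span_add ideal_span.zero)
qed (auto simp: cycles_def intro: ideal_span_left ideal_span_right)

lemma ideal_coinv_relations: "ideal coinv_relations (TH :: 'p::prime_card chains set ring)"
  unfolding coinv_relations_eq TH_def hclass_coset
  by (rule ring.ring_ideal_imp_quot_ideal[OF ring_cycles ideal_range_bd_triv ideal_elementary])

lemma coinvariant_class_ring_hom: "ring_hom_ring cycles (Ehat :: 'p::prime_card chains set set ring) coinvariant_class"
proof -
  have "(+>\<^bsub>TH\<^esub>) coinv_relations \<circ> hclass \<in> Ring.ring_hom cycles (Ehat :: 'p chains set set ring)"
    unfolding Ehat_def
    by (rule ring_hom_trans[OF ring_hom_ring.homh[OF hclass_ring_hom] ideal.rcos_ring_hom[OF ideal_coinv_relations]])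
  moreover have "(+>\<^bsub>TH\<^esub>) coinv_relations \<circ> hclass = (coinvariant_class :: 'p chains \<Rightarrow> _)"
    by (rule ext) (simp add: coinvariant_class_def)
  ultimately show ?thesis
    using ring_hom_ringI2[OF ring_cycles ideal.quotient_is_ring[OF ideal_coinv_relations]]
    by (simp add: Ehat_def)
qed

lemma carrier_Ehat: "carrier (Ehat :: 'p::prime_card chains set set ring) = range coinvariant_class"
  unfolding Ehat_def FactRing_def A_RCOSETS_def' by (auto simp: carrier_TH coinvariant_class_def)

lemma coinvariant_class_zero_iff: "coinvariant_class z = \<zero>\<^bsub>Ehat\<^esub> \<longleftrightarrow> z \<in> elementary_ideal"
  for z :: "'p::prime_card chains"
proof -
  interpret ring "TH :: 'p chains set ring" by (rule ring_TH)
  interpret ideal coinv_relations "TH :: 'p chains set ring" by (rule ideal_coinv_relations)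
  have zero: "\<zero>\<^bsub>Ehat\<^esub> = coinv_relations"
    by (simp add: Ehat_def FactRing_def)
  have car: "hclass z \<in> carrier TH"
    by (simp add: carrier_TH)
  have "coinvariant_class z = coinv_relations \<longleftrightarrow> hclass z \<in> coinv_relations"
    unfolding coinvariant_class_def
    using a_coset_join1[OF _ car a_subgroup] a_coset_join2[OF car a_subgroup] by blast
  then show ?thesis
    unfolding zero coinv_relations_eq by (auto simp: hclass_inject)
qed

section \<open>The presented algebra\<close>

text \<open>Intended for two surjections from the free algebra, so that no map out of a nested
  quotient has to be checked against cosets: \<open>h\<close> takes any preimage, and equality of
  the kernels makes the choice immaterial.\<close>

lemma ring_iso_of_same_kernel:
  assumes f: "ring_hom_ring R A f" and g: "ring_hom_ring R B g"
    and surj: "f ` carrier R = carrier A" "g ` carrier R = carrier B"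
    and ker: "\<And>x. x \<in> carrier R \<Longrightarrow> f x = \<zero>\<^bsub>A\<^esub> \<longleftrightarrow> g x = \<zero>\<^bsub>B\<^esub>"
  shows "\<exists>h \<in> ring_iso A B. \<forall>x \<in> carrier R. h (f x) = g x"
proof -
  interpret f: ring_hom_ring R A f by (rule f)
  interpret g: ring_hom_ring R B g by (rule g)
  have eq: "f x = f y \<longleftrightarrow> g x = g y" if "x \<in> carrier R" "y \<in> carrier R" for x y
  proof -
    have "f (x \<ominus>\<^bsub>R\<^esub> y) = f x \<ominus>\<^bsub>A\<^esub> f y" "g (x \<ominus>\<^bsub>R\<^esub> y) = g x \<ominus>\<^bsub>B\<^esub> g y"
      using that by (simp_all add: a_minus_def)
    then show ?thesis
      using ker[of "x \<ominus>\<^bsub>R\<^esub> y"] that f.S.r_right_minus_eq[of "f x" "f y"] g.S.r_right_minus_eq[of "g x" "g y"]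
      by simp
  qed
  define h where "h a = g (SOME x. x \<in> carrier R \<and> f x = a)" for a
  have hf: "h (f x) = g x" if "x \<in> carrier R" for x
  proof -
    have "\<exists>y. y \<in> carrier R \<and> f y = f x"
      using that by blast
    from someI_ex[OF this] show ?thesis
      unfolding h_def using eq that by blast
  qed
  have "h \<in> ring_iso A B"
  proof (rule ring_iso_memI)
    fix a b
    assume "a \<in> carrier A" "b \<in> carrier A"
    then obtain x y where x: "x \<in> carrier R" "a = f x" and y: "y \<in> carrier R" "b = f y"
      using surj(1) by blast
    show "h a \<in> carrier B"
      using x hf by simp
    show "h (a \<otimes>\<^bsub>A\<^esub> b) = h a \<otimes>\<^bsub>B\<^esub> h b" "h (a \<oplus>\<^bsub>A\<^esub> b) = h a \<oplus>\<^bsub>B\<^esub> h b"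
      using x y hf[of "x \<otimes>\<^bsub>R\<^esub> y"] hf[of "x \<oplus>\<^bsub>R\<^esub> y"] hf[of x] hf[of y] by simp_all
  next
    show "h \<one>\<^bsub>A\<^esub> = \<one>\<^bsub>B\<^esub>"
      using hf[of "\<one>\<^bsub>R\<^esub>"] by simp
    show "bij_betw h (carrier A) (carrier B)"
      unfolding bij_betw_def inj_on_def surj(1)[symmetric] surj(2)[symmetric] image_image
      using hf eq by (auto simp: image_iff)
  qed
  then show ?thesis
    using hf by blast
qed

section \<open>The free algebra on a set of letters as a ring with carrier\<close>

lemma free_alg_simps [simp]:
  "x \<oplus>\<^bsub>free_alg X\<^esub> y = x + y" "x \<otimes>\<^bsub>free_alg X\<^esub> y = x * y" "\<zero>\<^bsub>free_alg X\<^esub> = 0" "\<one>\<^bsub>free_alg X\<^esub> = 1"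
  by (simp_all add: free_alg_def)

lemma carrier_free_alg: "carrier (free_alg X) = supp (\<lambda>w. set w \<subseteq> X)"
  by (simp add: free_alg_def supp_def)

lemma supp_one: "P [] \<Longrightarrow> (1 :: 'x list \<Rightarrow>\<^sub>0 'k::comm_ring_1) \<in> supp P"
  using supp_single[of P "[]" "1 :: 'k"] by simp

lemma free_alg_times_closed:
  "x \<in> carrier (free_alg X) \<Longrightarrow> y \<in> carrier (free_alg X) \<Longrightarrow> x * y \<in> carrier (free_alg X)"
  unfolding carrier_free_alg by (erule (1) supp_times) auto

lemma ring_free_alg: "ring (free_alg X :: ('x list \<Rightarrow>\<^sub>0 'k::field) ring)"
proof (rule ringI)
  show "abelian_group (free_alg X :: ('x list \<Rightarrow>\<^sub>0 'k) ring)"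
  proof (rule abelian_groupI)
    fix x :: "'x list \<Rightarrow>\<^sub>0 'k"
    assume "x \<in> carrier (free_alg X)"
    then show "\<exists>y\<in>carrier (free_alg X). y \<oplus>\<^bsub>free_alg X\<^esub> x = \<zero>\<^bsub>free_alg X\<^esub>"
      by (intro bexI[of _ "- x"]) (simp_all add: carrier_free_alg supp_uminus)
  qed (auto simp: carrier_free_alg supp_add add_ac)
  show "monoid (free_alg X :: ('x list \<Rightarrow>\<^sub>0 'k) ring)"
    by (rule monoidI) (auto simp: free_alg_times_closed mult.assoc, simp add: carrier_free_alg supp_one)
qed (auto simp: algebra_simps)

lemma a_inv_free_alg:
  assumes "x \<in> carrier (free_alg X)"
  shows "\<ominus>\<^bsub>free_alg X\<^esub> x = - (x :: 'x list \<Rightarrow>\<^sub>0 'k::field)"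
proof -
  interpret ring "free_alg X :: ('x list \<Rightarrow>\<^sub>0 'k) ring" by (rule ring_free_alg)
  show ?thesis
    by (rule minus_equality) (use assms in \<open>auto simp: carrier_free_alg supp_uminus\<close>)
qed

lemma ideal_free_algI:
  fixes I :: "('x list \<Rightarrow>\<^sub>0 'k::field) set"
  assumes "I \<subseteq> carrier (free_alg X)" "0 \<in> I" "\<And>x y. x \<in> I \<Longrightarrow> y \<in> I \<Longrightarrow> x + y \<in> I"
    and mult: "\<And>a x. x \<in> I \<Longrightarrow> a \<in> carrier (free_alg X) \<Longrightarrow> a * x \<in> I"
      "\<And>a x. x \<in> I \<Longrightarrow> a \<in> carrier (free_alg X) \<Longrightarrow> x * a \<in> I"
  shows "ideal I (free_alg X)"
proof (rule idealI[OF ring_free_alg])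
  show "subgroup I (add_monoid (free_alg X))"
  proof
    fix x
    assume x: "x \<in> I"
    have "(- 1) * x \<in> I"
      by (rule mult(1)[OF x]) (simp add: carrier_free_alg supp_uminus supp_one)
    then show "inv\<^bsub>add_monoid (free_alg X)\<^esub> x \<in> I"
      using a_inv_free_alg[of x X] x assms(1) by (auto simp: a_inv_def)
  qed (use assms in auto)
qed (use mult in auto)

text \<open>\<open>coeff_letter\<close> is the class of \<open>e_k\<close> in coinvariants: \<open>e_k\<close> survives exactly when
  \<open>k\<close> or \<open>k + 1\<close> is divisible by \<open>2 (p - 1)\<close>.\<close>

definition coeff_letter :: "nat \<Rightarrow> 'p::prime_card E_free" where
  "coeff_letter k = (if 2 * (CARD('p) - 1) dvd k then word [(0, k div (2 * (CARD('p) - 1)))]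
     else if 2 * (CARD('p) - 1) dvd Suc k then word [(1, Suc k div (2 * (CARD('p) - 1)))] else 0)"

text \<open>An algebra map that undoes \<open>from_generators\<close> exactly on the free algebra
  over \<open>E_gens\<close>, and is undone by it modulo \<open>elementary_ideal\<close>.\<close>

definition to_generators :: "'p::prime_card chains \<Rightarrow> 'p E_free" where
  "to_generators = lin (\<lambda>\<alpha>. prod_list (map coeff_letter \<alpha>))"

definition from_generators :: "'p::prime_card E_free \<Rightarrow> 'p chains" where
  "from_generators = lin (\<lambda>w. word (map (E_degree CARD('p)) w))"

lemma CARD_minus_1_pos: "0 < CARD('p::prime_card) - 1"
  using prime_gt_1_nat[OF prime_card[where 'a = 'p]] by simp

lemma additive_to_generators: "Modules.additive to_generators"
  by standard (simp add: to_generators_def)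

lemmas to_generators_add [simp] = additive.add[OF additive_to_generators]
  and to_generators_zero [simp] = additive.zero[OF additive_to_generators]
  and to_generators_uminus [simp] = additive.minus[OF additive_to_generators]
  and to_generators_diff [simp] = additive.diff[OF additive_to_generators]
  and to_generators_sum = additive.sum[OF additive_to_generators]

lemma to_generators_times [simp]: "to_generators (x * y) = to_generators x * to_generators y"
  unfolding to_generators_def by (rule lin_times) simp

lemma to_generators_word [simp]: "to_generators (word \<alpha>) = prod_list (map coeff_letter \<alpha>)"
  by (simp add: to_generators_def)

lemma to_generators_one [simp]: "to_generators 1 = 1"
  by (simp add: to_generators_def)

lemma to_generators_scalar [simp]: "to_generators (scalar c) = scalar c"
  by (simp add: to_generators_def lin_single)

lemma to_generators_of_nat [simp]: "to_generators (of_nat m) = of_nat m"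
  unfolding scalar_of_nat[symmetric] by (rule to_generators_scalar)

lemma additive_from_generators: "Modules.additive from_generators"
  by standard (simp add: from_generators_def)

lemmas from_generators_add [simp] = additive.add[OF additive_from_generators]
  and from_generators_zero [simp] = additive.zero[OF additive_from_generators]
  and from_generators_uminus [simp] = additive.minus[OF additive_from_generators]
  and from_generators_diff [simp] = additive.diff[OF additive_from_generators]

lemma from_generators_times [simp]: "from_generators (x * y) = from_generators x * from_generators y"
  unfolding from_generators_def by (rule lin_word_map)

lemma from_generators_word [simp]:
  "from_generators (word w :: 'p::prime_card E_free) = word (map (E_degree CARD('p)) w)"
  by (simp add: from_generators_def)

lemma from_generators_one [simp]: "from_generators 1 = 1"
  by (simp add: from_generators_def)

lemma from_generators_scalar [simp]: "from_generators (scalar c) = scalar c"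
  by (simp add: from_generators_def lin_single)

lemma coeff_letter_carrier: "coeff_letter k \<in> carrier (free_alg E_gens :: 'p::prime_card E_free ring)"
proof -
  \<comment> \<open>The generators E^1_n start at n = 1, so the index must be positive.\<close>
  have "1 \<le> Suc k div (2 * (CARD('p) - 1))" if "2 * (CARD('p) - 1) dvd Suc k"
    using that CARD_minus_1_pos[where 'p = 'p]
    by (metis Suc_leI One_nat_def dvd_div_eq_0_iff nat.distinct(1) neq0_conv)
  then show ?thesis
    by (auto simp: coeff_letter_def carrier_free_alg E_gens_def intro!: supp_single)
qed

lemma to_generators_carrier: "to_generators z \<in> carrier (free_alg E_gens :: 'p::prime_card E_free ring)"
proof -
  interpret ring "free_alg E_gens :: 'p E_free ring" by (rule ring_free_alg)
  have "prod_list (map coeff_letter \<alpha>) \<in> carrier (free_alg E_gens :: 'p E_free ring)" for \<alpha>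
    by (induction \<alpha>) (use one_closed coeff_letter_carrier in \<open>auto intro: free_alg_times_closed\<close>)
  then have "lin (\<lambda>\<alpha>. prod_list (map coeff_letter \<alpha>)) z \<in> supp (\<lambda>w. set w \<subseteq> E_gens)"
    by (intro supp_lin[of z "\<lambda>_. True"]) (auto simp: carrier_free_alg supp_def)
  then show ?thesis
    by (simp add: to_generators_def carrier_free_alg)
qed

lemma coeff_letter_E_degree:
  assumes "odd CARD('p)" "x \<in> E_gens"
  shows "coeff_letter (E_degree CARD('p) x) = (word [x] :: 'p::prime_card E_free)"
proof -
  define q where "q = CARD('p) - 1"
  have q': "CARD('p) - Suc 0 = q" by (simp add: q_def)
  have q: "0 < q" using CARD_minus_1_pos[where 'p = 'p] by (simp add: q_def)
  consider n where "x = (0, n)" | n where "x = (1, n)" "1 \<le> n"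
    using assms(2) by (auto simp: E_gens_def)
  then show ?thesis
  proof cases
    case 1
    then have "E_degree CARD('p) x = n * (2 * q)"
      by (simp add: E_degree_def q_def)
    then show ?thesis
      using 1 q by (simp add: coeff_letter_def q')
  next
    case 2
    then have "Suc (2 * n * q - 1) = n * (2 * q)"
      using q by (simp add: mult.commute mult.left_commute)
    moreover have "\<not> 2 * q dvd 2 * n * q - 1"
    proof
      assume "2 * q dvd 2 * n * q - 1"
      then have "even (2 * n * q - 1)" by (rule dvd_mult_left)
      moreover have "0 < 2 * n * q" using 2 q by simp
      ultimately show False by (metis Suc_pred' even_Suc dvd_triv_left mult.assoc)
    qed
    ultimately show ?thesis
      using 2 q by (simp add: coeff_letter_def E_degree_def q')
  qed
qed

lemma to_from_generators:
  assumes "odd CARD('p)" "f \<in> carrier (free_alg E_gens :: 'p::prime_card E_free ring)"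
  shows "to_generators (from_generators f) = f"
proof -
  have "prod_list (map coeff_letter (map (E_degree CARD('p)) w)) = (word w :: 'p E_free)" if "set w \<subseteq> E_gens" for w
    using that by (induction w) (simp_all add: coeff_letter_E_degree[OF assms(1)] word_Cons[symmetric])
  then have "to_generators (from_generators f) = lin word f"
    unfolding to_generators_def from_generators_def lin_lin
    using assms(2) unfolding carrier_free_alg by (intro lin_cong_supp[of f "\<lambda>w. set w \<subseteq> E_gens"]) auto
  then show ?thesis by simp
qed

subsection \<open>The relations in the tensor algebra\<close>

text \<open>Fermat's little theorem, read off from the definition of the inverse as the power with
  exponent p - 2.\<close>

lemma power_CARD_minus_1: "c \<noteq> 0 \<Longrightarrow> c ^ (CARD('p) - 1) = (1 :: 'p::prime_card mod_ring)"
proof -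
  assume c: "c \<noteq> 0"
  have "CARD('p) - 1 = Suc (nat (int CARD('p) - 2))"
    using prime_gt_1_nat[OF prime_card[where 'a = 'p]] by simp
  then have "c ^ (CARD('p) - 1) = c * inverse c"
    using c by (simp add: inverse_mod_ring_def)
  then show ?thesis using c by simp
qed

text \<open>Otherwise c^r = 1 for all units c, where r is the remainder of i modulo p - 1. Then X^r
  - 1 would have p - 1 roots although 0 < r < p - 1.\<close>

lemma exists_power_neq_1:
  assumes "\<not> CARD('p) - 1 dvd i"
  shows "\<exists>c :: 'p::prime_card mod_ring. c \<noteq> 0 \<and> c ^ i \<noteq> 1"
proof (rule ccontr)
  assume contra: "\<nexists>c :: 'p mod_ring. c \<noteq> 0 \<and> c ^ i \<noteq> 1"
  define q where "q = CARD('p) - 1"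
  have q': "CARD('p) - Suc 0 = q" by (simp add: q_def)
  define r where "r = i mod q"
  have r: "0 < r" "r < q"
    using assms CARD_minus_1_pos[where 'p = 'p] by (simp_all add: r_def q_def dvd_eq_mod_eq_0)
  have "c ^ r = 1" if "c \<noteq> 0" for c :: "'p mod_ring"
  proof -
    have "c ^ i = (c ^ q) ^ (i div q) * c ^ r"
      unfolding r_def power_mult[symmetric] power_add[symmetric] by simp
    moreover have "c ^ i = 1"
      using contra that by blast
    ultimately show ?thesis
      using power_CARD_minus_1[OF that] by (simp add: q_def)
  qed
  then have "UNIV - {0} \<subseteq> {c :: 'p mod_ring. poly (monom 1 r - 1) c = 0}"
    by (auto simp: poly_monom)
  then have "card (UNIV - {0 :: 'p mod_ring}) \<le> card {c :: 'p mod_ring. poly (monom 1 r - 1) c = 0}"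
    by (intro card_mono) auto
  also have "\<dots> \<le> degree (monom 1 r - 1 :: 'p mod_ring poly)"
  proof (rule card_poly_roots_bound)
    have "coeff (monom 1 r - 1 :: 'p mod_ring poly) r = 1"
      using r by simp
    then show "monom 1 r - 1 \<noteq> (0 :: 'p mod_ring poly)"
      by (metis coeff_0 zero_neq_one)
  qed
  also have "\<dots> \<le> r"
    by (rule degree_diff_le) (simp_all add: degree_monom_le)
  finally show False
    using r by (simp add: q_def card_Diff_singleton)
qed

lemma ideal_span_of_relation:
  assumes "induced f \<alpha> - word \<alpha> \<in> elementary_relations"
  shows "word \<alpha> - induced f \<alpha> \<in> elementary_ideal"
  using ideal_span_uminus[OF ideal_span_base[OF assms]] by simp

text \<open>The dilation relation is (c^m - 1) e_k with m = (k + 1) div 2, and its scalar factor is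
  invertible for a suitable c.\<close>

lemma letter_in_elementary_ideal:
  assumes "\<not> CARD('p) - 1 dvd (k + 1) div 2"
  shows "word [k] \<in> (elementary_ideal :: 'p::prime_card chains set)"
proof -
  obtain c :: "'p mod_ring" where c: "c \<noteq> 0" "c ^ ((k + 1) div 2) \<noteq> 1"
    using exists_power_neq_1[OF assms] by blast
  let ?d = "c ^ ((k + 1) div 2) - 1"
  have "induced (dilation c) [k] - word [k] \<in> elementary_relations"
    unfolding elementary_relations_def dilation_relations_def
    by (intro UnI1 CollectI exI[of _ c] exI[of _ "[k]"]) (use c in simp)
  then have "scalar (inverse ?d) * (induced (dilation c) [k] - word [k]) \<in> elementary_ideal"
    by (intro ideal_span_left ideal_span_base)
  moreover have "induced (dilation c) [k] - word [k] = scalar ?d * word [k]"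
    unfolding induced_dilation by (simp add: single_diff left_diff_distrib del: mult_single)
  ultimately show ?thesis
    using c by (simp add: scalar_mult del: mult_single)
qed

lemma dvd_coeff_letter:
  "(2 * q dvd k \<or> 2 * q dvd Suc k) \<longleftrightarrow> q dvd (k + 1) div 2" for q k :: nat
proof (cases "even k")
  case True
  then obtain i where "k = 2 * i" by (elim evenE)
  moreover have "\<not> 2 * q dvd Suc (2 * i)"
    by (metis dvd_mult_left even_Suc dvd_triv_left)
  ultimately show ?thesis by simp
next
  case False
  then obtain i where i: "k = Suc (2 * i)" by (metis oddE Suc_eq_plus1)
  have "\<not> 2 * q dvd k"
    using False by (metis dvd_mult_left)
  moreover have "Suc k = 2 * Suc i" "(k + 1) div 2 = Suc i"
    using i by simp_all
  ultimately show ?thesis by (metis nat_mult_dvd_cancel_disj zero_neq_numeral)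
qed

lemma from_to_coeff_letter: "word [k] - from_generators (coeff_letter k) \<in> (elementary_ideal :: 'p::prime_card chains set)"
proof -
  define q where "q = CARD('p) - 1"
  have q': "CARD('p) - Suc 0 = q" by (simp add: q_def)
  have "from_generators (coeff_letter k) = (word [k] :: 'p chains)" if "2 * q dvd k \<or> 2 * q dvd Suc k"
  proof (cases "2 * q dvd k")
    case True
    then have "2 * (k div (2 * q)) * q = k"
      by (metis dvd_div_mult_self mult.commute mult.left_commute)
    then show ?thesis
      using True by (simp add: coeff_letter_def q' E_degree_def)
  next
    case False
    then have "2 * (Suc k div (2 * q)) * q = Suc k"
      using that by (metis dvd_div_mult_self mult.commute mult.left_commute)
    then show ?thesis
      using that False by (simp add: coeff_letter_def q' E_degree_def)
  qed
  moreover have "coeff_letter k = (0 :: 'p E_free)" if "\<not> (2 * q dvd k \<or> 2 * q dvd Suc k)"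
    using that by (simp add: coeff_letter_def q_def)
  ultimately show ?thesis
    using letter_in_elementary_ideal[of k, where 'p = 'p] dvd_coeff_letter[of q k]
    by (cases "2 * q dvd k \<or> 2 * q dvd Suc k") (simp_all add: q_def ideal_span.zero)
qed

lemma from_to_generators: "z - from_generators (to_generators z) \<in> (elementary_ideal :: 'p::prime_card chains set)"
proof -
  have *: "word \<alpha> - from_generators (to_generators (word \<alpha>)) \<in> (elementary_ideal :: 'p chains set)" for \<alpha>
  proof (induction \<alpha>)
    case (Cons k \<alpha>)
    have "word (k # \<alpha>) - from_generators (to_generators (word (k # \<alpha>))) =
        (word [k] - from_generators (coeff_letter k)) * word \<alpha> +
        from_generators (coeff_letter k) * (word \<alpha> - from_generators (to_generators (word \<alpha>)) :: 'p chains)"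
      by (simp add: word_Cons[of k \<alpha>] algebra_simps)
    then show ?case
      using Cons.IH from_to_coeff_letter by (metis ideal_span_add ideal_span_left ideal_span_right)
  qed (simp add: ideal_span.zero)
  have "lin (\<lambda>\<alpha>. word \<alpha> - from_generators (to_generators (word \<alpha>))) z \<in> (elementary_ideal :: 'p chains set)"
    by (rule ideal_span_lin[of z "\<lambda>_. True"]) (use * in \<open>auto simp: supp_def\<close>)
  moreover have "from_generators (to_generators z) = lin (\<lambda>\<alpha>. from_generators (to_generators (word \<alpha>))) z"
    by (simp add: from_generators_def to_generators_def lin_lin)
  ultimately show ?thesis
    by (simp add: lin_fun_diff)
qed

text \<open>The interchange handles two letters. One letter is then moved past a word, and one word
  past another, while the signs multiply.\<close>

lemma word_graded_commutative:
  "word u * word v - (- 1) ^ (sum_list u * sum_list v) * (word v * word u) \<in> (elementary_ideal :: 'p::prime_card chains set)"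
proof -
  have swap: "word [k] * word [l] - (- 1) ^ (k * l) * (word [l] * word [k]) \<in> (elementary_ideal :: 'p chains set)" for k l
  proof -
    have "word [k, l] - induced interchange [k, l] \<in> (elementary_ideal :: 'p chains set)"
      by (rule ideal_span_of_relation) (auto simp: elementary_relations_def interchange_relations_def)
    then show ?thesis
      by (simp add: induced_interchange word_append[symmetric] del: mult_single)
  qed
  have letter: "word [k] * word v - (- 1) ^ (k * sum_list v) * (word v * word [k]) \<in> (elementary_ideal :: 'p chains set)"
    for k v
  proof (induction v)
    case (Cons l v)
    have "word [k] * word (l # v) - (- 1) ^ (k * sum_list (l # v)) * (word (l # v) * word [k]) =
        (word [k] * word [l] - (- 1) ^ (k * l) * (word [l] * word [k])) * word v +
        ((- 1) ^ (k * l) * word [l]) * (word [k] * word v - (- 1) ^ (k * sum_list v) * (word v * word [k]) :: 'p chains)"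
      unfolding word_Cons[of l v]
      by (simp add: algebra_simps power_add sign_left_commute[of "word [l]"] del: mult_single)
    then show ?case
      using Cons.IH swap by (metis ideal_span_add ideal_span_left ideal_span_right)
  qed (simp add: ideal_span.zero)
  show ?thesis
  proof (induction u)
    case (Cons k u)
    have "word (k # u) * word v - (- 1) ^ (sum_list (k # u) * sum_list v) * (word v * word (k # u)) =
        word [k] * (word u * word v - (- 1) ^ (sum_list u * sum_list v) * (word v * word u)) +
        (- 1) ^ (sum_list u * sum_list v) *
          ((word [k] * word v - (- 1) ^ (k * sum_list v) * (word v * word [k])) * word u :: 'p chains)"
      unfolding word_Cons[of k u]
      by (simp add: algebra_simps power_add sign_left_commute[of "word [k]"]
          sign_left_commute[of "(- 1) ^ (k * sum_list v)"] del: mult_single)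
    then show ?case
      using Cons.IH letter by (metis ideal_span_add ideal_span_left ideal_span_right)
  qed (simp add: ideal_span.zero)
qed

lemma graded_commutative:
  assumes "x \<in> supp (\<lambda>\<alpha>. sum_list \<alpha> = k)" "y \<in> supp (\<lambda>\<alpha>. sum_list \<alpha> = l)"
  shows "x * y - (- 1) ^ (k * l) * (y * x) \<in> (elementary_ideal :: 'p::prime_card chains set)"
proof -
  have x: "word u * y - (- 1) ^ (k * l) * (y * word u) \<in> (elementary_ideal :: 'p chains set)" if "sum_list u = k" for u
  proof -
    have "lin (\<lambda>v. word u * word v - (- 1) ^ (k * l) * (word v * word u)) y \<in> (elementary_ideal :: 'p chains set)"
      by (rule ideal_span_lin[OF assms(2)]) (use word_graded_commutative[of u] that in auto)
    then show ?thesis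
      by (simp only: lin_fun_diff lin_mult_left lin_mult_right lin_words)
  qed
  have "lin (\<lambda>u. word u * y - (- 1) ^ (k * l) * (y * word u)) x \<in> (elementary_ideal :: 'p chains set)"
    by (rule ideal_span_lin[OF assms(1) x])
  then show ?thesis
    by (simp only: lin_fun_diff lin_mult_left lin_mult_right lin_words)
qed

subsection \<open>The power series identities\<close>

lemma fps_compose_X_power_nth:
  fixes f :: "'a::ring_1 fps"
  assumes "0 < m"
  shows "fps_nth (fps_compose f (fps_X ^ m)) n = (if m dvd n then fps_nth f (n div m) else 0)"
proof -
  have "fps_nth (fps_compose f (fps_X ^ m)) n = (\<Sum>i = 0..n. if n = m * i then fps_nth f i else 0)"
    unfolding fps_compose_nth by (intro sum.cong) (auto simp: power_mult[symmetric])
  also have "\<dots> = (if m dvd n then fps_nth f (n div m) else 0)"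
  proof (cases "m dvd n")
    case True
    have "(\<Sum>i = 0..n. if n = m * i then fps_nth f i else 0) = (\<Sum>i = 0..n. if i = n div m then fps_nth f i else 0)"
      using True assms by (intro sum.cong) auto
    then show ?thesis
      using True by simp
  qed (auto intro!: sum.neutral)
  finally show ?thesis .
qed

text \<open>Substituting s^(p-1) puts E^0_n at exponent (p - 1) n, half the degree of its class. The
  series is thus the image of the sum of all e_{2i} s^i, where the classes that die have coefficient
  0.\<close>

lemma E0_tilde_nth: "fps_nth E0_tilde i = (coeff_letter (2 * i) :: 'p::prime_card E_free)"
proof -
  define q where "q = CARD('p) - 1"
  have q: "CARD('p) - Suc 0 = q" "0 < q"
    using CARD_minus_1_pos[where 'p = 'p] by (simp_all add: q_def)
  have "\<not> 2 * q dvd Suc (2 * i)"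
    by (metis dvd_mult_left even_Suc dvd_triv_left)
  then show ?thesis
    using q by (simp add: E0_tilde_def fps_compose_X_power_nth E_series_def coeff_letter_def)
qed

text \<open>After division by s, E^1_n sits at exponent i = (p - 1) n - 1, and its degree 2 (p - 1)
  n - 1 is 2i + 1. So this is the series of all odd classes.\<close>

lemma E1_tilde_nth: "fps_nth E1_tilde i = (coeff_letter (Suc (2 * i)) :: 'p::prime_card E_free)"
proof -
  define q where "q = CARD('p) - 1"
  have q: "CARD('p) - Suc 0 = q" "0 < q"
    using CARD_minus_1_pos[where 'p = 'p] by (simp_all add: q_def)
  have 1: "\<not> 2 * q dvd Suc (2 * i)"
    by (metis dvd_mult_left even_Suc dvd_triv_left)
  have 2: "Suc (Suc (2 * i)) = 2 * Suc i" by simp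
  \<comment> \<open>Excludes the index 0, at which \<open>E_series 1\<close> has coefficient
    0.\<close>
  have 3: "Suc 0 \<le> Suc i div q" if "q dvd Suc i"
    using that q by (metis Suc_leI dvd_div_eq_0_iff nat.distinct(1) neq0_conv)
  show ?thesis
    using q 1 3 unfolding coeff_letter_def 2
    by (simp add: E1_tilde_def fps_compose_X_power_nth E_series_def del: mult_Suc_right)
qed

lemma at_s_times_at_t_nth: "fps_nth (fps_nth (at_s f * at_t g) j) i = fps_nth f i * fps_nth g j"
  by (simp add: at_s_def at_t_def)

lemma at_s_times_at_s_plus_t_nth: "fps_nth (fps_nth (at_s f * at_s_plus_t g) j) i =
    (\<Sum>a\<le>i. of_nat ((i - a + j) choose j) * (fps_nth f a * fps_nth g (i - a + j)))"
proof -
  have "fps_nth (at_s f * at_s_plus_t g) j = f * Abs_fps (\<lambda>i. of_nat ((i + j) choose i) * fps_nth g (i + j))"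
    by (simp add: at_s_def at_s_plus_t_def)
  then have "fps_nth (fps_nth (at_s f * at_s_plus_t g) j) i =
      (\<Sum>a\<le>i. fps_nth f a * (of_nat ((i - a + j) choose (i - a)) * fps_nth g (i - a + j)))"
    by (simp only: fps_mult_nth fps_nth_Abs_fps atLeast0AtMost)
  also have "\<dots> = (\<Sum>a\<le>i. of_nat ((i - a + j) choose j) * (fps_nth f a * fps_nth g (i - a + j)))"
  proof (rule sum.cong[OF refl])
    fix a
    have "(i - a + j) choose (i - a) = (i - a + j) choose j"
      using binomial_symmetric[of j "i - a + j"] by simp
    then show "fps_nth f a * (of_nat ((i - a + j) choose (i - a)) * fps_nth g (i - a + j)) =
        of_nat ((i - a + j) choose j) * (fps_nth f a * fps_nth g (i - a + j))"
      by (metis mult.assoc mult_of_nat_commute)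
  qed
  finally show ?thesis .
qed

lemma to_generators_shear_chain: "to_generators (shear_chain \<epsilon> \<eta> i l) =
    (\<Sum>j\<le>i. of_nat ((i - j + l) choose l) * (coeff_letter (2 * j + \<epsilon>) * coeff_letter (2 * (i - j + l) + \<eta>)))"
  by (simp add: shear_chain_def to_generators_sum)

text \<open>At s^i t^j the left side of an identity gives the word [2i + \<epsilon>, 2j + \<eta>]
  and the right side its image under the shear; hence the minus sign. The four identities are the
  four parity patterns, so every word of length 2 occurs.\<close>

lemma E_identities_coefficients:
  assumes "odd CARD('p)"
  shows "{fps_nth (fps_nth (l - r) j) i | l r i j. (l, r) \<in> E_identities} =
    {- to_generators x | x. x \<in> (shear_relations :: 'p::prime_card chains set)}" (is "?L = ?R")
proof -
  note nth = at_s_times_at_t_nth at_s_times_at_s_plus_t_nth E0_tilde_nth E1_tilde_nth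
  have c00: "fps_nth (fps_nth (at_s E0_tilde * at_t E0_tilde - at_s E0_tilde * at_s_plus_t E0_tilde) j) i =
      - to_generators (induced shear [2 * i, 2 * j] - word [2 * i, 2 * j] :: 'p chains)" for i j
    by (simp add: nth induced_shear[OF assms] to_generators_shear_chain)
  have c01: "fps_nth (fps_nth (at_s E0_tilde * at_t E1_tilde - at_s E0_tilde * at_s_plus_t E1_tilde) j) i =
      - to_generators (induced shear [2 * i, Suc (2 * j)] - word [2 * i, Suc (2 * j)] :: 'p chains)" for i j
    by (simp add: nth induced_shear[OF assms] to_generators_shear_chain)
  have c10: "fps_nth (fps_nth (at_s E1_tilde * at_t E0_tilde -
        (at_s E1_tilde * at_s_plus_t E0_tilde + at_s E0_tilde * at_s_plus_t E1_tilde)) j) i =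
      - to_generators (induced shear [Suc (2 * i), 2 * j] - word [Suc (2 * i), 2 * j] :: 'p chains)" for i j
    by (simp add: nth induced_shear[OF assms] to_generators_shear_chain)
  have c11: "fps_nth (fps_nth (at_s E1_tilde * at_t E1_tilde - at_s E1_tilde * at_s_plus_t E1_tilde) j) i =
      - to_generators (induced shear [Suc (2 * i), Suc (2 * j)] - word [Suc (2 * i), Suc (2 * j)] :: 'p chains)" for i j
    by (simp add: nth induced_shear[OF assms] to_generators_shear_chain)
  show ?thesis
  proof (intro equalityI subsetI)
    fix z
    assume "z \<in> ?L"
    then obtain l r :: "'p E_free fps fps" and i j where z: "z = fps_nth (fps_nth (l - r) j) i" and lr: "(l, r) \<in> E_identities"
      by blast
    have rel: "- to_generators (induced shear [k, m] - word [k, m]) \<in> ?R" for k m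
    proof -
      have "induced shear [k, m] - word [k, m] \<in> (shear_relations :: 'p chains set)"
        unfolding shear_relations_def by (intro CollectI exI[of _ "[k, m]"]) simp
      then show ?thesis by blast
    qed
    show "z \<in> ?R"
      using lr unfolding E_identities_def z
      by (elim insertE; simp only: prod.inject empty_iff; elim conjE; simp only: c00 c01 c10 c11 rel)
  next
    fix z
    assume "z \<in> ?R"
    then obtain \<alpha> :: "nat list" where \<alpha>: "length \<alpha> = 2" and z: "z = - to_generators (induced shear \<alpha> - word \<alpha> :: 'p chains)"
      by (auto simp: shear_relations_def)
    have coefficient: "fps_nth (fps_nth (l - r) j) i \<in> ?L"
      if "(l, r) \<in> E_identities" for l r :: "'p E_free fps fps" and i j
      using that by blast
    obtain k m where km: "\<alpha> = [k, m]"
      using \<alpha> by (rule length_2E)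
    obtain i where i: "k = 2 * i \<or> k = Suc (2 * i)"
      by (metis evenE oddE Suc_eq_plus1)
    obtain j where j: "m = 2 * j \<or> m = Suc (2 * j)"
      by (metis evenE oddE Suc_eq_plus1)
    show "z \<in> ?L"
      using i j unfolding z km
      by (elim disjE; simp only: c00[symmetric] c01[symmetric] c10[symmetric] c11[symmetric])
        (rule coefficient, simp add: E_identities_def)+
  qed
qed

subsection \<open>Comparison of the kernels\<close>

abbreviation E_gc_ideal :: "'p::prime_card E_free set" where
  "E_gc_ideal \<equiv> gc_ideal E_gens (E_degree CARD('p))"

definition gc_generators :: "'p::prime_card E_free set" where
  "gc_generators = {a * b - (- 1) ^ (k * l) * b * a | a b k l.
     a \<in> carrier (free_alg E_gens) \<and> b \<in> carrier (free_alg E_gens) \<and>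
     homogeneous (E_degree CARD('p)) k a \<and> homogeneous (E_degree CARD('p)) l b}"

lemma gc_generators_carrier: "gc_generators \<subseteq> carrier (free_alg E_gens :: 'p::prime_card E_free ring)"
proof -
  have "a * b - (- 1) ^ (k * l) * b * a \<in> carrier (free_alg E_gens :: 'p E_free ring)"
    if "a \<in> carrier (free_alg E_gens)" "b \<in> carrier (free_alg E_gens)" for a b :: "'p E_free" and k l
    unfolding mult.assoc using free_alg_times_closed[OF that] free_alg_times_closed[OF that(2,1)]
    by (simp add: carrier_free_alg supp_diff supp_sign)
  then show ?thesis
    unfolding gc_generators_def by blast
qed

lemma E_gc_ideal_eq: "E_gc_ideal = Idl\<^bsub>free_alg E_gens\<^esub> (gc_generators :: 'p::prime_card E_free set)"
  by (simp add: gc_ideal_def gc_generators_def)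

lemma ideal_E_gc_ideal: "ideal E_gc_ideal (free_alg E_gens :: 'p::prime_card E_free ring)"
  unfolding E_gc_ideal_eq by (rule ring.genideal_ideal[OF ring_free_alg gc_generators_carrier])

lemma E_gc_alg_eq: "E_gc_alg = free_alg E_gens Quot (E_gc_ideal :: 'p::prime_card E_free set)"
  by (simp add: E_gc_alg_def free_gc_alg_def)

lemma E_gc_class_eq: "E_gc_class = (+>\<^bsub>free_alg E_gens\<^esub>) (E_gc_ideal :: 'p::prime_card E_free set)"
  by (rule ext) (simp add: E_gc_class_def)

lemma E_gc_class_ring_hom:
  "ring_hom_ring (free_alg E_gens) (E_gc_alg :: 'p::prime_card E_free set ring) E_gc_class"
  unfolding E_gc_alg_eq E_gc_class_eq by (rule ideal.rcos_ring_hom_ring[OF ideal_E_gc_ideal])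

lemma carrier_quotient: "carrier (R Quot I) = (\<lambda>x. I +>\<^bsub>R\<^esub> x) ` carrier R"
  unfolding FactRing_def A_RCOSETS_def' by auto

lemma quotient_zero: "\<zero>\<^bsub>R Quot I\<^esub> = I"
  by (simp add: FactRing_def)

lemma coset_eq_ideal_iff:
  assumes "ideal I R" "x \<in> carrier R"
  shows "I +>\<^bsub>R\<^esub> x = I \<longleftrightarrow> x \<in> I"
proof -
  interpret ideal I R by (rule assms(1))
  show ?thesis
    using a_coset_join1[OF _ assms(2) a_subgroup] a_coset_join2[OF assms(2) a_subgroup] by blast
qed

definition identity_classes :: "'p::prime_card E_free set set" where
  "identity_classes = {E_gc_class (fps_nth (fps_nth (l - r) j) i) | l r i j. (l, r) \<in> E_identities}"

lemma identity_classes_eq: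
  assumes "odd CARD('p)"
  shows "identity_classes = {E_gc_class (- to_generators x) | x. x \<in> (shear_relations :: 'p::prime_card chains set)}"
proof -
  have "identity_classes = E_gc_class ` {fps_nth (fps_nth (l - r) j) i | l r i j. (l, r) \<in> (E_identities :: ('p E_free fps fps \<times> _) set)}"
    unfolding identity_classes_def by blast
  then show ?thesis
    unfolding E_identities_coefficients[OF assms] by blast
qed

lemma uminus_to_generators_carrier: "- to_generators x \<in> carrier (free_alg E_gens :: 'p::prime_card E_free ring)"
  using to_generators_carrier[of x] by (simp add: carrier_free_alg supp_uminus)

lemma identity_classes_carrier:
  assumes "odd CARD('p)"
  shows "identity_classes \<subseteq> carrier (E_gc_alg :: 'p::prime_card E_free set ring)"
proof -
  interpret ring_hom_ring "free_alg E_gens" "E_gc_alg :: 'p E_free set ring" E_gc_class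
    by (rule E_gc_class_ring_hom)
  show ?thesis
    unfolding identity_classes_eq[OF assms] using hom_closed[OF uminus_to_generators_carrier] by blast
qed

lemma ring_E_gc_alg: "ring (E_gc_alg :: 'p::prime_card E_free set ring)"
  unfolding E_gc_alg_eq by (rule ideal.quotient_is_ring[OF ideal_E_gc_ideal])

lemma E_ideal_eq: "E_ideal = Idl\<^bsub>E_gc_alg\<^esub> (identity_classes :: 'p::prime_card E_free set set)"
  by (simp add: E_ideal_def identity_classes_def)

lemma ideal_E_ideal:
  assumes "odd CARD('p)"
  shows "ideal E_ideal (E_gc_alg :: 'p::prime_card E_free set ring)"
  unfolding E_ideal_eq by (rule ring.genideal_ideal[OF ring_E_gc_alg identity_classes_carrier[OF assms]])

lemma from_generators_degree:
  assumes "homogeneous (E_degree CARD('p)) k (a :: 'p::prime_card E_free)"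
  shows "from_generators a \<in> supp (\<lambda>\<alpha>. sum_list \<alpha> = k)"
  unfolding from_generators_def using assms
  by (intro supp_lin[of a "\<lambda>w. sum_list (map (E_degree CARD('p)) w) = k"])
    (auto simp: homogeneous_def supp_def)

text \<open>The preimage \<open>I\<close> of the elementary ideal contains \<open>E_gc_ideal\<close>
  by graded commutativity. Its image in \<open>E_gc_alg\<close> is an ideal that contains the
  classes of the identities, because \<open>from_generators\<close> undoes
  \<open>to_generators\<close> modulo the ideal. Membership in this image can be pulled back to
  \<open>I\<close>, which contains the kernel of the projection.\<close>

lemma from_generators_of_kernel:
  assumes odd: "odd CARD('p)" and f: "f \<in> carrier (free_alg E_gens)" "E_gc_class f \<in> E_ideal"
  shows "from_generators f \<in> (elementary_ideal :: 'p::prime_card chains set)"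
proof -
  define I where "I = {f \<in> carrier (free_alg E_gens :: 'p E_free ring). from_generators f \<in> elementary_ideal}"
  have ideal_I: "ideal I (free_alg E_gens)"
    by (rule ideal_free_algI)
      (auto simp: I_def free_alg_times_closed ideal_span_add ideal_span_left ideal_span_right ideal_span.zero,
        auto simp: carrier_free_alg supp_add)
  have "gc_generators \<subseteq> I"
  proof
    fix g
    assume g: "g \<in> (gc_generators :: 'p E_free set)"
    then obtain a b :: "'p E_free" and k l where "g = a * b - (- 1) ^ (k * l) * b * a"
      and "homogeneous (E_degree CARD('p)) k a" "homogeneous (E_degree CARD('p)) l b"
      unfolding gc_generators_def by blast
    then have "from_generators g \<in> elementary_ideal"
      using graded_commutative[OF from_generators_degree from_generators_degree, of k a l b]
      by (simp add: scalar_minus_one_power mult.assoc)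
    then show "g \<in> I"
      using g gc_generators_carrier by (auto simp: I_def)
  qed
  then have gc_I: "E_gc_ideal \<subseteq> I"
    unfolding E_gc_ideal_eq by (rule ring.genideal_minimal[OF ring_free_alg ideal_I])
  have "ideal (E_gc_class ` I) E_gc_alg"
    unfolding E_gc_alg_eq E_gc_class_eq
    by (rule ring.ring_ideal_imp_quot_ideal[OF ring_free_alg ideal_E_gc_ideal ideal_I])
  moreover have "identity_classes \<subseteq> E_gc_class ` I"
  proof
    fix c
    assume "c \<in> (identity_classes :: 'p E_free set set)"
    then obtain x :: "'p chains" where c: "c = E_gc_class (- to_generators x)" and x: "x \<in> shear_relations"
      unfolding identity_classes_eq[OF odd] by blast
    have "x \<in> elementary_ideal"
      using x by (intro ideal_span_base) (simp add: elementary_relations_def)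
    then have "from_generators (to_generators x) \<in> elementary_ideal"
      using ideal_span_diff[OF _ from_to_generators[of x]] by fastforce
    then have "- to_generators x \<in> I"
      using uminus_to_generators_carrier[of x] by (simp add: I_def ideal_span_uminus)
    then show "c \<in> E_gc_class ` I"
      unfolding c by (rule imageI)
  qed
  ultimately have "E_ideal \<subseteq> E_gc_class ` I"
    unfolding E_ideal_eq by (rule ring.genideal_minimal[OF ring_E_gc_alg])
  then obtain f' where f': "f' \<in> I" "E_gc_class f = E_gc_class f'"
    using f(2) by blast
  \<comment> \<open>Back from cosets to elements: \<open>f\<close> lies in its own coset, which is
    that of \<open>f'\<close>, and so differs from \<open>f'\<close> by an element of
    \<open>E_gc_ideal\<close>.\<close>
  have "0 \<in> E_gc_ideal"
    using additive_subgroup.zero_closed[OF ideal.axioms(1)[OF ideal_E_gc_ideal]] by simp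
  then have "f \<in> E_gc_class f"
    unfolding E_gc_class_eq a_r_coset_def' by force
  then obtain g where g: "g \<in> E_gc_ideal" "f = g + f'"
    unfolding f'(2) unfolding E_gc_class_eq a_r_coset_def' by auto
  then have "g \<in> I" using gc_I by blast
  then have "f \<in> I"
    unfolding g(2) using f'(1) additive_subgroup.a_closed[OF ideal.axioms(1)[OF ideal_I]] by fastforce
  then show ?thesis by (simp add: I_def)
qed

lemma homogeneous_coeff_letter: "homogeneous (E_degree CARD('p)) k (coeff_letter k :: 'p::prime_card E_free)"
proof -
  define q where "q = CARD('p) - 1"
  have q': "CARD('p) - Suc 0 = q" by (simp add: q_def)
  show ?thesis
  proof (cases "2 * q dvd k")
    case True
    then have "2 * (k div (2 * q)) * q = k"
      by (metis dvd_div_mult_self mult.commute mult.left_commute)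
    then show ?thesis
      using True by (simp add: homogeneous_def coeff_letter_def q' E_degree_def)
  next
    case ndvd: False
    show ?thesis
    proof (cases "2 * q dvd Suc k")
      case True
      then have "2 * (Suc k div (2 * q)) * q = Suc k"
        by (metis dvd_div_mult_self mult.commute mult.left_commute)
      then show ?thesis
        using True ndvd by (simp add: homogeneous_def coeff_letter_def q' E_degree_def)
    qed (use ndvd in \<open>simp add: homogeneous_def coeff_letter_def q'\<close>)
  qed
qed

text \<open>Each kind of relation has its own fate: a dilation relation becomes 0 already in the
  free algebra, an interchange a graded commutator of letters up to sign, and a shear a coefficient
  of an identity up to sign.\<close>

lemma to_generators_in_kernel:
  assumes odd: "odd CARD('p)" and z: "z \<in> (elementary_ideal :: 'p::prime_card chains set)"
  shows "E_gc_class (to_generators z) \<in> E_ideal"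
proof -
  interpret h: ring_hom_ring "free_alg E_gens" "E_gc_alg :: 'p E_free set ring" E_gc_class
    by (rule E_gc_class_ring_hom)
  interpret I: ideal E_ideal "E_gc_alg :: 'p E_free set ring"
    by (rule ideal_E_ideal[OF odd])
  have zero: "E_gc_class 0 \<in> (E_ideal :: 'p E_free set set)"
    using h.hom_zero by simp
  have gc: "E_gc_class g \<in> E_ideal" if "g \<in> E_gc_ideal" for g :: "'p E_free"
  proof -
    have "g \<in> carrier (free_alg E_gens)"
      using that ideal.Icarr[OF ideal_E_gc_ideal] by blast
    then have "E_gc_class g = \<zero>\<^bsub>E_gc_alg\<^esub>"
      unfolding E_gc_class_eq E_gc_alg_eq quotient_zero using that
      by (simp add: coset_eq_ideal_iff[OF ideal_E_gc_ideal])
    then show ?thesis by simp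
  qed
  have minus: "E_gc_class (to_generators x) \<in> E_ideal" if "E_gc_class (- to_generators x) \<in> E_ideal" for x :: "'p chains"
  proof -
    have m1: "- 1 \<in> carrier (free_alg E_gens :: 'p E_free ring)"
      by (simp add: carrier_free_alg supp_uminus supp_one)
    have "E_gc_class (- 1) \<otimes>\<^bsub>E_gc_alg\<^esub> E_gc_class (- to_generators x) \<in> E_ideal"
      using that h.hom_closed[OF m1] by (rule I.I_l_closed)
    then show ?thesis
      using h.hom_mult[OF m1 uminus_to_generators_carrier[of x]] by simp
  qed
  have rel: "E_gc_class (to_generators r) \<in> E_ideal" if "r \<in> elementary_relations" for r :: "'p chains"
  proof -
    consider "r \<in> dilation_relations" | "r \<in> interchange_relations" | "r \<in> shear_relations"
      using \<open>r \<in> elementary_relations\<close> by (auto simp: elementary_relations_def)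
    then show ?thesis
    proof cases
      case 1
      then obtain c \<alpha> where c: "c \<noteq> 0" and "length \<alpha> = 1" and r: "r = induced (dilation c) \<alpha> - word \<alpha>"
        by (auto simp: dilation_relations_def)
      then obtain k where \<alpha>: "\<alpha> = [k]" by (elim length_1E)
      have "to_generators r = (scalar (c ^ ((k + 1) div 2)) - 1) * coeff_letter k"
        unfolding r \<alpha> induced_dilation by (simp add: left_diff_distrib del: mult_single)
      also have "\<dots> = 0"
      \<comment> \<open>Either the scalar factor is 0 by Fermat's theorem, or the letter itself is
        sent to 0.\<close>
      proof (cases "CARD('p) - 1 dvd (k + 1) div 2")
        case True
        then obtain n where "(k + 1) div 2 = (CARD('p) - 1) * n" by (elim dvdE)
        then have "c ^ ((k + 1) div 2) = 1"
          using power_CARD_minus_1[OF c] by (simp only: power_mult power_one)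
        then show ?thesis by simp
      next
        case False
        then have "coeff_letter k = (0 :: 'p E_free)"
          using dvd_coeff_letter[of "CARD('p) - 1" k] by (simp add: coeff_letter_def)
        then show ?thesis by simp
      qed
      finally show ?thesis using zero by simp
    next
      case 2
      then obtain \<alpha> where "length \<alpha> = 2" and r: "r = induced interchange \<alpha> - word \<alpha>"
        by (auto simp: interchange_relations_def)
      then obtain k l where \<alpha>: "\<alpha> = [k, l]" by (elim length_2E)
      have "- to_generators r = coeff_letter k * coeff_letter l - (- 1) ^ (k * l) * coeff_letter l * coeff_letter k"
        unfolding r \<alpha> induced_interchange scalar_minus_one_power by (simp add: mult.assoc del: mult_single)
      also have "\<dots> \<in> gc_generators"
        unfolding gc_generators_def using coeff_letter_carrier homogeneous_coeff_letter by blast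
      finally have "- to_generators r \<in> E_gc_ideal"
        unfolding E_gc_ideal_eq using ring.genideal_self[OF ring_free_alg gc_generators_carrier] by blast
      then show ?thesis
        by (intro minus gc)
    next
      case 3
      then have "E_gc_class (- to_generators r) \<in> identity_classes"
        unfolding identity_classes_eq[OF odd] by blast
      then have "E_gc_class (- to_generators r) \<in> E_ideal"
        unfolding E_ideal_eq using ring.genideal_self[OF ring_E_gc_alg identity_classes_carrier[OF odd]] by blast
      then show ?thesis by (rule minus)
    qed
  qed
  show ?thesis
    using z
  proof (induction z rule: ideal_span.induct)
    case (add r x a b)
    have "E_gc_class (to_generators (a * r * b + x)) =
        (E_gc_class (to_generators a) \<otimes>\<^bsub>E_gc_alg\<^esub> E_gc_class (to_generators r)) \<otimes>\<^bsub>E_gc_alg\<^esub> E_gc_class (to_generators b)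
        \<oplus>\<^bsub>E_gc_alg\<^esub> E_gc_class (to_generators x)"
      using h.hom_add[of "to_generators a * to_generators r * to_generators b" "to_generators x"]
        h.hom_mult[of "to_generators a * to_generators r" "to_generators b"]
        h.hom_mult[of "to_generators a" "to_generators r"]
      by (simp add: to_generators_carrier free_alg_times_closed)
    also have "\<dots> \<in> E_ideal"
      using rel[OF add.hyps(1)] add.IH h.hom_closed[OF to_generators_carrier]
      by (intro I.a_closed I.I_r_closed I.I_l_closed) auto
    finally show ?case .
  qed (simp add: zero)
qed

theorem theorem33:
  assumes "odd CARD('p::prime_card)"
  shows "\<exists>h \<in> ring_iso (E_presented :: 'p E_free set set ring) (Ehat :: 'p chains set set ring).
           \<forall>\<epsilon>\<in>{0, 1}. \<forall>n\<ge>\<epsilon>. h (E_gen \<epsilon> n) = E_class \<epsilon> n"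
proof -
  define proj where "proj f = E_ideal +>\<^bsub>E_gc_alg\<^esub> E_gc_class f" for f :: "'p E_free"
  define F where "F f = coinvariant_class (from_generators f)" for f :: "'p E_free"
  have proj_hom: "ring_hom_ring (free_alg E_gens) E_presented proj"
  proof -
    have "(+>\<^bsub>E_gc_alg\<^esub>) E_ideal \<circ> E_gc_class \<in> Ring.ring_hom (free_alg E_gens) (E_presented :: 'p E_free set set ring)"
      unfolding E_presented_def
      by (rule ring_hom_trans[OF ring_hom_ring.homh[OF E_gc_class_ring_hom] ideal.rcos_ring_hom[OF ideal_E_ideal[OF assms]]])
    moreover have "(+>\<^bsub>E_gc_alg\<^esub>) E_ideal \<circ> E_gc_class = proj"
      by (rule ext) (simp add: proj_def)
    ultimately show ?thesis
      using ring_hom_ringI2[OF ring_free_alg ideal.quotient_is_ring[OF ideal_E_ideal[OF assms]]]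
      by (simp add: E_presented_def)
  qed
  interpret c: ring_hom_ring cycles "Ehat :: 'p chains set set ring" coinvariant_class
    by (rule coinvariant_class_ring_hom)
  have cycles_simps: "x \<oplus>\<^bsub>cycles\<^esub> y = x + y" "x \<otimes>\<^bsub>cycles\<^esub> y = x * y" "\<one>\<^bsub>cycles\<^esub> = (1 :: 'p chains)" for x y :: "'p chains"
    by (simp_all add: cycles_def)
  have F_hom: "ring_hom_ring (free_alg E_gens) (Ehat :: 'p chains set set ring) F"
  proof (rule ring_hom_ringI2[OF ring_free_alg c.S.ring_axioms ring_hom_memI])
    fix x y :: "'p E_free"
    show "F x \<in> carrier Ehat"
      by (simp add: F_def carrier_Ehat)
    show "F (x \<otimes>\<^bsub>free_alg E_gens\<^esub> y) = F x \<otimes>\<^bsub>Ehat\<^esub> F y" "F (x \<oplus>\<^bsub>free_alg E_gens\<^esub> y) = F x \<oplus>\<^bsub>Ehat\<^esub> F y"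
      using c.hom_mult[of "from_generators x" "from_generators y"] c.hom_add[of "from_generators x" "from_generators y"]
      by (simp_all add: F_def carrier_cycles cycles_simps)
    show "F \<one>\<^bsub>free_alg E_gens\<^esub> = \<one>\<^bsub>Ehat\<^esub>"
      using c.hom_one by (simp add: F_def cycles_simps)
  qed
  have proj_surj: "proj ` carrier (free_alg E_gens) = carrier E_presented"
    unfolding E_presented_def E_gc_alg_eq carrier_quotient image_image proj_def E_gc_class_eq ..
  have F_surj: "F ` carrier (free_alg E_gens) = carrier Ehat"
  proof -
    \<comment> \<open>A preimage is \<open>to_generators z\<close>: going back with
      \<open>from_generators\<close> changes \<open>z\<close> by an element of the ideal only, which
      is invisible in the coinvariants.\<close>
    have "coinvariant_class z \<in> F ` carrier (free_alg E_gens)" for z :: "'p chains"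
    proof (rule image_eqI[OF _ to_generators_carrier])
      have "coinvariant_class (z - from_generators (to_generators z)) = \<zero>\<^bsub>Ehat\<^esub>"
        unfolding coinvariant_class_zero_iff by (rule from_to_generators)
      then show "coinvariant_class z = F (to_generators z)"
        using c.hom_add[of "z - from_generators (to_generators z)" "from_generators (to_generators z)"]
          c.hom_closed[of "from_generators (to_generators z)"]
        by (simp add: F_def carrier_cycles cycles_simps)
    qed
    then show ?thesis
      by (auto simp: carrier_Ehat F_def)
  qed
  have ker: "proj f = \<zero>\<^bsub>E_presented\<^esub> \<longleftrightarrow> F f = \<zero>\<^bsub>Ehat\<^esub>" if f: "f \<in> carrier (free_alg E_gens)" for f
  proof -
    have "E_gc_class f \<in> carrier E_gc_alg"
      by (rule ring_hom_closed[OF ring_hom_ring.homh[OF E_gc_class_ring_hom] f])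
    then have "proj f = \<zero>\<^bsub>E_presented\<^esub> \<longleftrightarrow> E_gc_class f \<in> E_ideal"
      unfolding proj_def E_presented_def quotient_zero by (rule coset_eq_ideal_iff[OF ideal_E_ideal[OF assms]])
    also have "\<dots> \<longleftrightarrow> from_generators f \<in> elementary_ideal"
      \<comment> \<open>For the backward direction, \<open>to_generators\<close> carries membership
        in the ideal over to the free algebra and recovers \<open>f\<close> from its image.\<close>
      using from_generators_of_kernel[OF assms f] to_generators_in_kernel[OF assms, of "from_generators f"]
        to_from_generators[OF assms f] by auto
    finally show ?thesis
      by (simp add: F_def coinvariant_class_zero_iff)
  qed
  obtain h where h: "h \<in> ring_iso E_presented Ehat" "\<And>f. f \<in> carrier (free_alg E_gens) \<Longrightarrow> h (proj f) = F f"
    using ring_iso_of_same_kernel[OF proj_hom F_hom proj_surj F_surj ker] by blast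
  have "h (E_gen \<epsilon> n) = E_class \<epsilon> n" if "\<epsilon> \<in> {0, 1}" "\<epsilon> \<le> n" for \<epsilon> n
  proof -
    have "word [(\<epsilon>, n)] \<in> carrier (free_alg E_gens :: 'p E_free ring)"
      using that by (auto simp: carrier_free_alg E_gens_def intro!: supp_single)
    then have "h (proj (word [(\<epsilon>, n)])) = F (word [(\<epsilon>, n)])"
      by (rule h(2))
    then show ?thesis
      by (simp add: proj_def F_def E_gen_def E_class_def coinvariant_class_def E_degree_def mult.assoc mult.commute[of n])
  qed
  then show ?thesis
    using h(1) by blast
qed

end
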